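(* Let $n\ge 2$ and $0\le k\le n$ be integers, with $k<n$ if $n=2$. Then there exists a compact symplectic nilmanifold $(M,\omega)$ of dimension $2n$ with a positive compatible almost complex structure $J$ such that the distribution $\operatorname{Im} N^{J}$ has constant rank equal to $2k$ and such that the two distributions $\operatorname{Im} N^{J}$ and $(\operatorname{Im} N^{J})^\perp$ are both involutive. Moreover, when $0<k<n$, there also exists such a compact symplectic nilmanifold with a positive compatible almost complex structure $J$ for which $\operatorname{Im} N^J$ has constant rank $2k$ and the two distributions $\operatorname{Im} N^{J}$ and $(\operatorname{Im} N^{J})^\perp$ are both non involutive.
   Context: A compact nilmanifold is a quotient $\Gamma\backslash G$ of a nilpotent Lie group $G$ by a lattice $\Gamma$ (a discrete subgroup acting cocompactly). An almost complex structure $J$ (a smooth field of endomorphisms of the tangent bundle with $J^2=-\mathrm{Id}$) on a symplectic manifold $(M,\omega)$ is compatible with $\omega$ if $g_J(X,Y):=\omega(X,JY)$ is symmetric, and positive if moreover $g_J$ is positive definite. Its Nijenhuis tensor is $N^J(X,Y)=[JX,JY]-J[JX,Y]-J[X,JY]-[X,Y]$. The distribution $\operatorname{Im} N^J$ assigns to a point $x$ the linear span of all the values $N^J_x(X,Y)$, $X,Y\in T_xM$; $(\operatorname{Im} N^J)^\perp$ assigns to $x$ the $\omega_x$-orthogonal complement of $(\operatorname{Im} N^J)_x$ (which coincides with its $g_J$-orthogonal complement, since $(\operatorname{Im} N^J)_x$ is $J$-stable). A constant rank distribution is involutive if the bracket of any two vector fields with values in it again has values in it. *)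

theory Defs
  imports
    "HOL-Analysis.Analysis"
    "HOL-Algebra.Generated_Groups"
    "HOL-Library.Function_Algebras"
begin

section \<open>Smooth manifolds\<close>

primrec Ck_on :: "nat \<Rightarrow> 'e::real_normed_vector set \<Rightarrow> ('e \<Rightarrow> 'f::real_normed_vector) \<Rightarrow> bool" where
  "Ck_on 0 S f \<longleftrightarrow> continuous_on S f"
| "Ck_on (Suc r) S f \<longleftrightarrow>
     (\<forall>x\<in>S. f differentiable (at x)) \<and> (\<forall>v. Ck_on r S (\<lambda>x. frechet_derivative f (at x) v))"

text \<open>Only used for open \<open>S\<close> in finite-dimensional spaces, where it is the usual
  \<open>C\<^sup>\<infinity>\<close>-smoothness.\<close>

definition smooth_on :: "'e::real_normed_vector set \<Rightarrow> ('e \<Rightarrow> 'f::real_normed_vector) \<Rightarrow> bool" where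
  "smooth_on S f \<longleftrightarrow> (\<forall>r. Ck_on r S f)"

record ('a, 'e) manifold =
  topo :: "'a topology"
  atlas :: "('a set \<times> ('a \<Rightarrow> 'e)) set"

abbreviation points :: "('a, 'e) manifold \<Rightarrow> 'a set" where
  "points M \<equiv> topspace (topo M)"

text \<open>The dimension is that of the model space \<open>'e\<close>. The atlas need not be maximal.\<close>

definition smooth_manifold :: "('a, 'e::euclidean_space) manifold \<Rightarrow> bool" where
  "smooth_manifold M \<longleftrightarrow>
     Hausdorff_space (topo M) \<and>
     (\<exists>\<B>. countable \<B> \<and> (\<forall>V\<in>\<B>. openin (topo M) V) \<and>
        (\<forall>W x. openin (topo M) W \<and> x \<in> W \<longrightarrow> (\<exists>V\<in>\<B>. x \<in> V \<and> V \<subseteq> W))) \<and>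
     (\<Union>(U, \<phi>)\<in>atlas M. U) = points M \<and>
     (\<forall>(U, \<phi>)\<in>atlas M. openin (topo M) U \<and> open (\<phi> ` U) \<and>
        homeomorphic_map (subtopology (topo M) U) (top_of_set (\<phi> ` U)) \<phi>) \<and>
     (\<forall>(U, \<phi>)\<in>atlas M. \<forall>(V, \<psi>)\<in>atlas M. smooth_on (\<phi> ` (U \<inter> V)) (\<psi> \<circ> inv_into U \<phi>))"

definition smooth_map ::
  "('a, 'e::euclidean_space) manifold \<Rightarrow> ('b, 'f::euclidean_space) manifold \<Rightarrow> ('a \<Rightarrow> 'b) \<Rightarrow> bool" where
  "smooth_map M N f \<longleftrightarrow> continuous_map (topo M) (topo N) f \<and>
     (\<forall>(U, \<phi>)\<in>atlas M. \<forall>(V, \<psi>)\<in>atlas N.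
        smooth_on (\<phi> ` (U \<inter> f -` V)) (\<psi> \<circ> f \<circ> inv_into U \<phi>))"

definition prod_manifold ::
  "('a, 'e) manifold \<Rightarrow> ('b, 'f) manifold \<Rightarrow> ('a \<times> 'b, 'e \<times> 'f) manifold" where
  "prod_manifold M N =
     \<lparr>topo = prod_topology (topo M) (topo N),
      atlas = {(U \<times> V, map_prod \<phi> \<psi>) | U \<phi> V \<psi>. (U, \<phi>) \<in> atlas M \<and> (V, \<psi>) \<in> atlas N}\<rparr>"

definition smooth_fun_on :: "('a, 'e::euclidean_space) manifold \<Rightarrow> 'a set \<Rightarrow> ('a \<Rightarrow> real) \<Rightarrow> bool" where
  "smooth_fun_on M V f \<longleftrightarrow> openin (topo M) V \<and>
     (\<forall>(U, \<phi>)\<in>atlas M. smooth_on (\<phi> ` (U \<inter> V)) (f \<circ> inv_into U \<phi>))"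

definition smooth_near :: "('a, 'e::euclidean_space) manifold \<Rightarrow> 'a \<Rightarrow> ('a \<Rightarrow> real) \<Rightarrow> bool" where
  "smooth_near M x f \<longleftrightarrow> (\<exists>V. x \<in> V \<and> smooth_fun_on M V f)"


section \<open>Tangent vectors and vector fields\<close>

instantiation "fun" :: (type, scaleR) scaleR
begin
definition scaleR_fun :: "real \<Rightarrow> ('a \<Rightarrow> 'b) \<Rightarrow> 'a \<Rightarrow> 'b" where
  "scaleR_fun c f = (\<lambda>x. c *\<^sub>R f x)"
instance ..
end

instance "fun" :: (type, real_vector) real_vector
  by standard (auto simp: scaleR_fun_def plus_fun_def scaleR_add_right scaleR_add_left)

type_synonym 'a tangent = "('a \<Rightarrow> real) \<Rightarrow> real"

text \<open>Derivations at \<open>x\<close> of the algebra of functions that are smooth near \<open>x\<close>. The value on any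
  other function is irrelevant and fixed to \<open>0\<close>, so that a derivation is determined by its
  values on that algebra. Derivations automatically depend on the germ only, because the
  indicator function of a neighbourhood of \<open>x\<close> is itself smooth near \<open>x\<close>.\<close>

definition tangent_space :: "('a, 'e::euclidean_space) manifold \<Rightarrow> 'a \<Rightarrow> 'a tangent set" where
  "tangent_space M x = {v.
     (\<forall>f g. smooth_near M x f \<and> smooth_near M x g \<longrightarrow>
        v (\<lambda>y. f y + g y) = v f + v g \<and>
        v (\<lambda>y. f y * g y) = f x * v g + g x * v f) \<and>
     (\<forall>c f. smooth_near M x f \<longrightarrow> v (\<lambda>y. c * f y) = c * v f) \<and>
     (\<forall>f. \<not> smooth_near M x f \<longrightarrow> v f = 0)}"

definition vector_field :: "('a, 'e::euclidean_space) manifold \<Rightarrow> ('a \<Rightarrow> 'a tangent) \<Rightarrow> bool" where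
  "vector_field M X \<longleftrightarrow>
     (\<forall>x\<in>points M. X x \<in> tangent_space M x) \<and>
     (\<forall>V f. smooth_fun_on M V f \<longrightarrow> smooth_fun_on M V (\<lambda>x. X x f))"

definition lie_bracket ::
  "('a, 'e::euclidean_space) manifold \<Rightarrow> ('a \<Rightarrow> 'a tangent) \<Rightarrow> ('a \<Rightarrow> 'a tangent) \<Rightarrow> 'a \<Rightarrow> 'a tangent" where
  "lie_bracket M X Y x f =
     (if smooth_near M x f then X x (\<lambda>y. Y y f) - Y x (\<lambda>y. X y f) else 0)"


section \<open>Symplectic forms and almost complex structures\<close>

definition closed_2form ::
  "('a, 'e::euclidean_space) manifold \<Rightarrow> ('a \<Rightarrow> 'a tangent \<Rightarrow> 'a tangent \<Rightarrow> real) \<Rightarrow> bool" where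
  "closed_2form M \<omega> \<longleftrightarrow>
     (\<forall>X Y Z. vector_field M X \<and> vector_field M Y \<and> vector_field M Z \<longrightarrow>
       (\<forall>x\<in>points M.
          X x (\<lambda>y. \<omega> y (Y y) (Z y)) - Y x (\<lambda>y. \<omega> y (X y) (Z y)) + Z x (\<lambda>y. \<omega> y (X y) (Y y))
          - \<omega> x (lie_bracket M X Y x) (Z x) + \<omega> x (lie_bracket M X Z x) (Y x)
          - \<omega> x (lie_bracket M Y Z x) (X x) = 0))"

definition symplectic_form ::
  "('a, 'e::euclidean_space) manifold \<Rightarrow> ('a \<Rightarrow> 'a tangent \<Rightarrow> 'a tangent \<Rightarrow> real) \<Rightarrow> bool" where
  "symplectic_form M \<omega> \<longleftrightarrow>
     (\<forall>x\<in>points M. \<forall>u\<in>tangent_space M x. \<forall>v\<in>tangent_space M x. \<forall>w\<in>tangent_space M x. \<forall>a b.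
        \<omega> x (a *\<^sub>R u + b *\<^sub>R v) w = a * \<omega> x u w + b * \<omega> x v w \<and> \<omega> x u v = - \<omega> x v u) \<and>
     (\<forall>x\<in>points M. \<forall>u\<in>tangent_space M x. (\<forall>v\<in>tangent_space M x. \<omega> x u v = 0) \<longrightarrow> u = 0) \<and>
     (\<forall>X Y. vector_field M X \<and> vector_field M Y \<longrightarrow>
        smooth_fun_on M (points M) (\<lambda>x. \<omega> x (X x) (Y x))) \<and>
     closed_2form M \<omega>"

definition symplectic_manifold ::
  "('a, 'e::euclidean_space) manifold \<Rightarrow> ('a \<Rightarrow> 'a tangent \<Rightarrow> 'a tangent \<Rightarrow> real) \<Rightarrow> bool" where
  "symplectic_manifold M \<omega> \<longleftrightarrow> smooth_manifold M \<and> symplectic_form M \<omega>"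

definition almost_complex_structure ::
  "('a, 'e::euclidean_space) manifold \<Rightarrow> ('a \<Rightarrow> 'a tangent \<Rightarrow> 'a tangent) \<Rightarrow> bool" where
  "almost_complex_structure M J \<longleftrightarrow>
     (\<forall>x\<in>points M. \<forall>u\<in>tangent_space M x. \<forall>v\<in>tangent_space M x. \<forall>a b.
        J x u \<in> tangent_space M x \<and>
        J x (a *\<^sub>R u + b *\<^sub>R v) = a *\<^sub>R J x u + b *\<^sub>R J x v \<and>
        J x (J x u) = - u) \<and>
     (\<forall>X. vector_field M X \<longrightarrow> vector_field M (\<lambda>x. J x (X x)))"

definition positive_compatible ::
  "('a, 'e::euclidean_space) manifold \<Rightarrow> ('a \<Rightarrow> 'a tangent \<Rightarrow> 'a tangent \<Rightarrow> real) \<Rightarrow>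
   ('a \<Rightarrow> 'a tangent \<Rightarrow> 'a tangent) \<Rightarrow> bool" where
  "positive_compatible M \<omega> J \<longleftrightarrow>
     (\<forall>x\<in>points M. \<forall>u\<in>tangent_space M x. \<forall>v\<in>tangent_space M x.
        \<omega> x u (J x v) = \<omega> x v (J x u)) \<and>
     (\<forall>x\<in>points M. \<forall>u\<in>tangent_space M x. u \<noteq> 0 \<longrightarrow> 0 < \<omega> x u (J x u))"

definition nijenhuis ::
  "('a, 'e::euclidean_space) manifold \<Rightarrow> ('a \<Rightarrow> 'a tangent \<Rightarrow> 'a tangent) \<Rightarrow>
   ('a \<Rightarrow> 'a tangent) \<Rightarrow> ('a \<Rightarrow> 'a tangent) \<Rightarrow> 'a \<Rightarrow> 'a tangent" where
  "nijenhuis M J X Y x =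
     lie_bracket M (\<lambda>y. J y (X y)) (\<lambda>y. J y (Y y)) x
     - J x (lie_bracket M (\<lambda>y. J y (X y)) Y x)
     - J x (lie_bracket M X (\<lambda>y. J y (Y y)) x)
     - lie_bracket M X Y x"


section \<open>Distributions\<close>

text \<open>The value at \<open>x\<close> of the Nijenhuis tensor on tangent vectors \<open>u\<close>, \<open>v\<close> is its value on any
  vector fields extending them; hence the span ranges over vector fields.\<close>

definition Im_N ::
  "('a, 'e::euclidean_space) manifold \<Rightarrow> ('a \<Rightarrow> 'a tangent \<Rightarrow> 'a tangent) \<Rightarrow> 'a \<Rightarrow> 'a tangent set" where
  "Im_N M J x = span {nijenhuis M J X Y x | X Y. vector_field M X \<and> vector_field M Y}"

definition symplectic_orthogonal ::
  "('a, 'e::euclidean_space) manifold \<Rightarrow> ('a \<Rightarrow> 'a tangent \<Rightarrow> 'a tangent \<Rightarrow> real) \<Rightarrow>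
   ('a \<Rightarrow> 'a tangent set) \<Rightarrow> 'a \<Rightarrow> 'a tangent set" where
  "symplectic_orthogonal M \<omega> D x = {v \<in> tangent_space M x. \<forall>w\<in>D x. \<omega> x v w = 0}"

definition constant_rank ::
  "('a, 'e::euclidean_space) manifold \<Rightarrow> ('a \<Rightarrow> 'a tangent set) \<Rightarrow> nat \<Rightarrow> bool" where
  "constant_rank M D r \<longleftrightarrow> (\<forall>x\<in>points M. dim (D x) = r)"

definition involutive ::
  "('a, 'e::euclidean_space) manifold \<Rightarrow> ('a \<Rightarrow> 'a tangent set) \<Rightarrow> bool" where
  "involutive M D \<longleftrightarrow>
     (\<forall>X Y. vector_field M X \<and> vector_field M Y \<and>
        (\<forall>x\<in>points M. X x \<in> D x) \<and> (\<forall>x\<in>points M. Y x \<in> D x) \<longrightarrow>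
        (\<forall>x\<in>points M. lie_bracket M X Y x \<in> D x))"


section \<open>Lie groups and nilmanifolds\<close>

definition lie_group :: "('a, 'c) monoid_scheme \<Rightarrow> ('a, 'e::euclidean_space) manifold \<Rightarrow> bool" where
  "lie_group G S \<longleftrightarrow> group G \<and> smooth_manifold S \<and> carrier G = points S \<and>
     smooth_map (prod_manifold S S) S (\<lambda>(x, y). x \<otimes>\<^bsub>G\<^esub> y) \<and>
     smooth_map S S (\<lambda>x. inv\<^bsub>G\<^esub> x)"

primrec lower_central :: "('a, 'c) monoid_scheme \<Rightarrow> nat \<Rightarrow> 'a set" where
  "lower_central G 0 = carrier G"
| "lower_central G (Suc i) =
     generate G {h \<otimes>\<^bsub>G\<^esub> g \<otimes>\<^bsub>G\<^esub> inv\<^bsub>G\<^esub> h \<otimes>\<^bsub>G\<^esub> inv\<^bsub>G\<^esub> g | h g. h \<in> lower_central G i \<and> g \<in> carrier G}"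

definition nilpotent_group :: "('a, 'c) monoid_scheme \<Rightarrow> bool" where
  "nilpotent_group G \<longleftrightarrow> group G \<and> (\<exists>i. lower_central G i = {\<one>\<^bsub>G\<^esub>})"

definition quotient_topology :: "'a topology \<Rightarrow> ('a \<Rightarrow> 'b) \<Rightarrow> 'b topology" where
  "quotient_topology T p =
     topology (\<lambda>V. V \<subseteq> p ` topspace T \<and> openin T {x \<in> topspace T. p x \<in> V})"

lemma openin_quotient_topology:
  "openin (quotient_topology T p) V \<longleftrightarrow>
     V \<subseteq> p ` topspace T \<and> openin T {x \<in> topspace T. p x \<in> V}"
proof -
  have "istopology (\<lambda>V. V \<subseteq> p ` topspace T \<and> openin T {x \<in> topspace T. p x \<in> V})"
    unfolding istopology_def
  proof (rule conjI; intro allI impI conjI)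
    fix A B
    assume "A \<subseteq> p ` topspace T \<and> openin T {x \<in> topspace T. p x \<in> A}"
      and "B \<subseteq> p ` topspace T \<and> openin T {x \<in> topspace T. p x \<in> B}"
    moreover have "{x \<in> topspace T. p x \<in> A \<inter> B} =
        {x \<in> topspace T. p x \<in> A} \<inter> {x \<in> topspace T. p x \<in> B}"
      by auto
    ultimately show "A \<inter> B \<subseteq> p ` topspace T" "openin T {x \<in> topspace T. p x \<in> A \<inter> B}"
      by auto
  next
    fix K
    assume K: "\<forall>A\<in>K. A \<subseteq> p ` topspace T \<and> openin T {x \<in> topspace T. p x \<in> A}"
    then show "\<Union>K \<subseteq> p ` topspace T"
      by auto
    have "{x \<in> topspace T. p x \<in> \<Union>K} = (\<Union>A\<in>K. {x \<in> topspace T. p x \<in> A})"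
      by auto
    then show "openin T {x \<in> topspace T. p x \<in> \<Union>K}"
      using K by auto
  qed
  then show ?thesis
    by (simp add: quotient_topology_def)
qed

lemma quotient_map_quotient_topology: "quotient_map T (quotient_topology T p) p"
proof -
  have "{x \<in> topspace T. p x \<in> p ` topspace T} = topspace T"
    by blast
  then have "openin (quotient_topology T p) (p ` topspace T)"
    by (simp add: openin_quotient_topology)
  then have "topspace (quotient_topology T p) = p ` topspace T"
    by (meson openin_quotient_topology openin_subset openin_topspace subset_antisym)
  then show ?thesis
    by (auto simp: quotient_map_def openin_quotient_topology)
qed

text \<open>The space \<open>\<Gamma>\G\<close> of cosets \<open>\<Gamma>g\<close>. Its charts are the charts of \<open>G\<close>, restricted to open
  sets on which the projection is injective and pushed down along it, so that the projection
  is a local diffeomorphism.\<close>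

definition quotient_manifold ::
  "('a, 'c) monoid_scheme \<Rightarrow> ('a, 'e) manifold \<Rightarrow> 'a set \<Rightarrow> ('a set, 'e) manifold" where
  "quotient_manifold G S \<Gamma> = (let p = (\<lambda>x. \<Gamma> #>\<^bsub>G\<^esub> x) in
     \<lparr>topo = quotient_topology (topo S) p,
      atlas = {(p ` W, \<phi> \<circ> inv_into W p) | U \<phi> W.
                 (U, \<phi>) \<in> atlas S \<and> W \<subseteq> U \<and> openin (topo S) W \<and> inj_on p W}\<rparr>)"

definition lattice_in ::
  "('a, 'c) monoid_scheme \<Rightarrow> ('a, 'e) manifold \<Rightarrow> 'a set \<Rightarrow> bool" where
  "lattice_in G S \<Gamma> \<longleftrightarrow> subgroup \<Gamma> G \<and> subtopology (topo S) \<Gamma> = discrete_topology \<Gamma> \<and>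
     compact_space (topo (quotient_manifold G S \<Gamma>))"

text \<open>The points of a nilmanifold are cosets, that is, sets of elements of \<open>G\<close>, hence the type
  \<open>'a set\<close>.\<close>

definition compact_nilmanifold :: "('a set, 'e::euclidean_space) manifold \<Rightarrow> bool" where
  "compact_nilmanifold M \<longleftrightarrow>
     (\<exists>(G :: 'a monoid) S \<Gamma>. lie_group G S \<and> nilpotent_group G \<and> lattice_in G S \<Gamma> \<and>
        M = quotient_manifold G S \<Gamma>)"

end

(*
On R^(2n) = span {e_i} + span {f_i} with J e_i = f_i and omega(u, v) = <J u, v>, consider nilpotent
Lie algebras whose nonzero brackets are of the form [e_a(i), e_i] = f_i for i in a set K of k indices,
and possibly [e_0, f_1] = 2 f_0; in all cases omega is closed. If only the brackets of the first kind
occur then N(e_a(i), e_i) = - f_i, so that Im N is spanned by the e_i and f_i with i in K; it contains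
all brackets, and the brackets of its orthogonal complement vanish. Taking a(i) = i + 1 mod n gives
every rank 2k allowed. For the non-involutive examples take a(i) = 0 and K = {1..k} and add the bracket
[e_0, f_1] = 2 f_0. Then the generators f_1 and e_1 of Im N are replaced by f_1 - 2 e_0 and e_1 + 2 f_0,
whose bracket -2 f_1 is not in Im N, and similarly for the complement, which contains e_0 + 2 f_1 and
f_0 - 2 e_1. The corresponding group laws on R^(2n) are polynomial with integral coefficients, so that
Z^(2n) is a lattice.

Everything is computed upstairs: vector fields on the quotient by a lattice are the functions with
values in the Lie algebra that are invariant under the lattice, their bracket is
D_xi eta - D_eta xi + [xi, eta], and Hadamard's lemma shows that derivations at a point are the values
of left-invariant vector fields.
*)
theory Submission
  imports Defs
begin

section \<open>Smooth functions between Euclidean spaces\<close>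

text \<open>Every bracket between basis vectors is, up to a factor, J of one of its two arguments,
  and omega(J x, y) = - <x, y>. Hence the cyclic sum of omega([u, v], w) cancels coordinate by
  coordinate, whatever the map a is. What limits the rank are collisions: if a(i) = j and a(j) = i
  with i, j in K, then [e_j, e_i] = f_i - f_j, and two generators of Im N merge into one; if a(i) =
  i, the bracket is zero. On K = {0..k-1} the shift i + 1 mod n creates such a pair only for n = k =
  2, the excluded case. In the non-involutive case k < n leaves the index 0 outside K, so that e_0
  and f_0 are available for the second bracket. This bracket changes Im N by an injective linear
  shear, hence tilts it without changing its dimension.\<close>

lemma frechet_derivative_cong_open:
  assumes "open S" "x \<in> S" "\<And>y. y \<in> S \<Longrightarrow> f y = g y"
  shows "frechet_derivative f (at x) = frechet_derivative g (at x)"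
proof -
  have "(f has_derivative D) (at x) \<longleftrightarrow> (g has_derivative D) (at x)" for D
    using has_derivative_transform_within_open[OF _ assms(1,2)] assms(3) assms(3)[symmetric] by blast
  then show ?thesis
    by (simp add: frechet_derivative_def)
qed

lemma differentiable_cong_open:
  assumes "open S" "x \<in> S" "\<And>y. y \<in> S \<Longrightarrow> f y = g y"
  shows "f differentiable (at x) \<longleftrightarrow> g differentiable (at x)"
proof
  assume "f differentiable (at x)"
  then show "g differentiable (at x)"
    unfolding differentiable_def using has_derivative_transform_within_open[OF _ assms(1,2)] assms(3) by blast
next
  assume "g differentiable (at x)"
  then show "f differentiable (at x)"
    unfolding differentiable_def
    using has_derivative_transform_within_open[OF _ assms(1,2)] assms(3)[symmetric] by blast
qed

lemma Ck_on_cong: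
  assumes "open S" "\<And>y. y \<in> S \<Longrightarrow> f y = g y"
  shows "Ck_on r S f \<longleftrightarrow> Ck_on r S g"
  using assms(2)
proof (induction r arbitrary: f g)
  case 0
  then show ?case by (simp cong: continuous_on_cong)
next
  case (Suc r)
  have "Ck_on r S (\<lambda>x. frechet_derivative f (at x) v) \<longleftrightarrow>
        Ck_on r S (\<lambda>x. frechet_derivative g (at x) v)" for v
    by (intro Suc.IH) (simp add: frechet_derivative_cong_open[OF \<open>open S\<close> _ Suc.prems])
  moreover have "f differentiable (at x) \<longleftrightarrow> g differentiable (at x)" if "x \<in> S" for x
    using Suc.prems differentiable_cong_open[OF \<open>open S\<close> that] by blast
  ultimately show ?case by simp
qed

lemma Ck_on_subset: "Ck_on r S f \<Longrightarrow> T \<subseteq> S \<Longrightarrow> Ck_on r T f"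
  by (induction r arbitrary: f) (auto intro: continuous_on_subset)

lemma Ck_on_Suc_imp: "Ck_on (Suc r) S f \<Longrightarrow> Ck_on r S f"
proof (induction r arbitrary: f)
  case 0
  then show ?case
    by (simp add: differentiable_imp_continuous_on differentiable_at_imp_differentiable_on)
next
  case (Suc r)
  then show ?case by auto
qed

lemma Ck_on_local:
  assumes "\<And>x. x \<in> S \<Longrightarrow> \<exists>U. open U \<and> x \<in> U \<and> Ck_on r U f"
  shows "Ck_on r S f"
  using assms
proof (induction r arbitrary: f)
  case 0
  have "continuous (at x) f" if "x \<in> S" for x
    using 0[OF that] continuous_on_eq_continuous_at by auto
  then show ?case
    by (simp add: continuous_at_imp_continuous_on)
next
  case (Suc r)
  have "f differentiable (at x)" if "x \<in> S" for x
    using Suc.prems[OF that] by auto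
  moreover have "Ck_on r S (\<lambda>x. frechet_derivative f (at x) v)" for v
  proof (rule Suc.IH)
    fix x assume "x \<in> S"
    then show "\<exists>U. open U \<and> x \<in> U \<and> Ck_on r U (\<lambda>x. frechet_derivative f (at x) v)"
      using Suc.prems[of x] by auto
  qed
  ultimately show ?case by simp
qed

lemma Ck_on_const: "Ck_on r S (\<lambda>x. c)"
  by (induction r arbitrary: c) simp_all

lemma Ck_on_bounded_linear:
  assumes "bounded_linear f"
  shows "Ck_on r S f"
proof (cases r)
  case 0
  then show ?thesis using assms by (simp add: linear_continuous_on)
next
  case (Suc r')
  have "(f has_derivative f) (at x)" for x
    using assms by (simp add: bounded_linear_imp_has_derivative)
  then have "f differentiable (at x)" "frechet_derivative f (at x) = f" for x
    by (auto intro: differentiableI frechet_derivative_at[symmetric])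
  then show ?thesis
    using Suc by (simp add: Ck_on_const)
qed

lemma has_derivative_frechet:
  "f differentiable (at x) \<Longrightarrow> (f has_derivative frechet_derivative f (at x)) (at x)"
  by (simp add: frechet_derivative_works)

lemma frechet_derivative_eqI:
  "(f has_derivative D) (at x) \<Longrightarrow> frechet_derivative f (at x) = D"
  by (rule frechet_derivative_at[symmetric])

lemma Ck_on_add:
  assumes "open S" "Ck_on r S f" "Ck_on r S g"
  shows "Ck_on r S (\<lambda>x. f x + g x)"
  using assms(2,3)
proof (induction r arbitrary: f g)
  case 0
  then show ?case by (simp add: continuous_on_add)
next
  case (Suc r)
  have "frechet_derivative (\<lambda>x. f x + g x) (at x) =
      (\<lambda>v. frechet_derivative f (at x) v + frechet_derivative g (at x) v)" if "x \<in> S" for x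
    using Suc.prems that
    by (intro frechet_derivative_eqI has_derivative_add has_derivative_frechet) auto
  then have "Ck_on r S (\<lambda>x. frechet_derivative (\<lambda>x. f x + g x) (at x) v)" for v
    using Suc by (simp cong: Ck_on_cong[OF \<open>open S\<close>])
  then show ?case using Suc.prems by auto
qed

lemma Ck_on_bilinear:
  assumes "bounded_bilinear p" "open S" "Ck_on r S f" "Ck_on r S g"
  shows "Ck_on r S (\<lambda>x. p (f x) (g x))"
  using assms(3,4)
proof (induction r arbitrary: f g)
  case 0
  then show ?case using bounded_bilinear.continuous_on[OF assms(1)] by auto
next
  case (Suc r)
  have 1: "((\<lambda>x. p (f x) (g x)) has_derivative
      (\<lambda>v. p (f x) (frechet_derivative g (at x) v) + p (frechet_derivative f (at x) v) (g x))) (at x)"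
    if "x \<in> S" for x
    using Suc.prems that
    by (intro bounded_bilinear.FDERIV[OF assms(1)] has_derivative_frechet) auto
  then have 2: "frechet_derivative (\<lambda>x. p (f x) (g x)) (at x) =
      (\<lambda>v. p (f x) (frechet_derivative g (at x) v) + p (frechet_derivative f (at x) v) (g x))"
    if "x \<in> S" for x
    using that frechet_derivative_eqI by blast
  have "Ck_on r S (\<lambda>x. frechet_derivative (\<lambda>x. p (f x) (g x)) (at x) v)" for v
  proof -
    have "Ck_on r S (\<lambda>x. p (f x) (frechet_derivative g (at x) v) + p (frechet_derivative f (at x) v) (g x))"
      using Suc.prems Ck_on_Suc_imp[OF Suc.prems(1)] Ck_on_Suc_imp[OF Suc.prems(2)]
      by (intro Ck_on_add assms(2) Suc.IH) auto
    then show ?thesis using 2 by (simp cong: Ck_on_cong[OF \<open>open S\<close>])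
  qed
  then show ?case using differentiableI[OF 1] by auto
qed

lemma (in bounded_linear) Ck_on_compose:
  assumes "open S" "Ck_on r S g"
  shows "Ck_on r S (\<lambda>x. f (g x))"
  using assms(2)
proof (induction r arbitrary: g)
  case 0
  then show ?case by (simp add: continuous_on)
next
  case (Suc r)
  have 1: "((\<lambda>x. f (g x)) has_derivative (\<lambda>v. f (frechet_derivative g (at x) v))) (at x)"
    if "x \<in> S" for x
    using Suc.prems that by (intro has_derivative has_derivative_frechet) auto
  have "Ck_on r S (\<lambda>x. f (frechet_derivative g (at x) v))" for v
    using Suc by auto
  then show ?case
    using differentiableI[OF 1]
    by (auto simp: frechet_derivative_eqI[OF 1] cong: Ck_on_cong[OF \<open>open S\<close>])
qed

lemma Ck_on_sum:
  assumes "open S" "\<And>i. i \<in> I \<Longrightarrow> Ck_on r S (f i)"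
  shows "Ck_on r S (\<lambda>x. \<Sum>i\<in>I. f i x)"
  using assms(2)
  by (induction I rule: infinite_finite_induct) (auto simp: Ck_on_const Ck_on_add[OF \<open>open S\<close>])

lemma frechet_derivative_Basis:
  fixes f :: "'a::euclidean_space \<Rightarrow> 'b::real_normed_vector"
  assumes "f differentiable (at x)"
  shows "frechet_derivative f (at x) v = (\<Sum>b\<in>Basis. (v \<bullet> b) *\<^sub>R frechet_derivative f (at x) b)"
proof -
  have lin: "linear (frechet_derivative f (at x))"
    by (rule linear_frechet_derivative[OF assms])
  have "frechet_derivative f (at x) v = frechet_derivative f (at x) (\<Sum>b\<in>Basis. (v \<bullet> b) *\<^sub>R b)"
    by (simp add: euclidean_representation)
  also have "\<dots> = (\<Sum>b\<in>Basis. (v \<bullet> b) *\<^sub>R frechet_derivative f (at x) b)"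
    by (simp add: linear_sum[OF lin] linear_cmul[OF lin])
  finally show ?thesis .
qed

text \<open>The chain rule differentiates \<open>g\<close> in a direction that depends on
  \<open>x\<close>, whereas \<open>Ck_on\<close> fixes directions. Expanding this direction in the
  basis leaves derivatives of \<open>g\<close> in constant directions, and the induction hypothesis,
  stated for arbitrary \<open>g\<close>, applies to each of them.\<close>

lemma Ck_on_o:
  fixes f :: "'a::real_normed_vector \<Rightarrow> 'b::euclidean_space"
    and g :: "'b \<Rightarrow> 'c::real_normed_vector"
  assumes "open S" "open T" "Ck_on r S f" "Ck_on r T g" "f ` S \<subseteq> T"
  shows "Ck_on r S (\<lambda>x. g (f x))"
  using assms(3-5)
proof (induction r arbitrary: g)
  case 0
  then show ?case using continuous_on_compose2 by auto
next
  case (Suc r)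
  have g: "g differentiable (at (f x))" if "x \<in> S" for x
    using Suc.prems that by auto
  have 1: "((\<lambda>x. g (f x)) has_derivative
      (\<lambda>v. frechet_derivative g (at (f x)) (frechet_derivative f (at x) v))) (at x)"
    if "x \<in> S" for x
  proof -
    have "(f has_derivative frechet_derivative f (at x)) (at x)"
      using Suc.prems that by (intro has_derivative_frechet) auto
    from has_derivative_compose[OF this has_derivative_frechet[OF g[OF that]]]
    show ?thesis .
  qed
  have 2: "frechet_derivative (\<lambda>x. g (f x)) (at x) v =
      (\<Sum>b\<in>Basis. (frechet_derivative f (at x) v \<bullet> b) *\<^sub>R frechet_derivative g (at (f x)) b)"
    if "x \<in> S" for x v
    using frechet_derivative_eqI[OF 1[OF that]] frechet_derivative_Basis[OF g[OF that]] by metis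
  have "Ck_on r S (\<lambda>x. \<Sum>b\<in>Basis. (frechet_derivative f (at x) v \<bullet> b) *\<^sub>R
      frechet_derivative g (at (f x)) b)" for v
    using Suc.prems Ck_on_Suc_imp[OF Suc.prems(1)]
    by (intro Ck_on_sum assms(1) Ck_on_bilinear[OF bounded_bilinear_scaleR]
        bounded_linear.Ck_on_compose[OF bounded_linear_inner_left] Suc.IH) auto
  then show ?case
    using differentiableI[OF 1] by (auto simp: 2 cong: Ck_on_cong[OF \<open>open S\<close>])
qed

lemma smooth_on_cong:
  assumes "open S" "\<And>y. y \<in> S \<Longrightarrow> f y = g y"
  shows "smooth_on S f \<longleftrightarrow> smooth_on S g"
  using Ck_on_cong[of S f g] assms by (simp add: smooth_on_def)

lemma smooth_on_subset: "smooth_on S f \<Longrightarrow> T \<subseteq> S \<Longrightarrow> smooth_on T f"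
  using Ck_on_subset unfolding smooth_on_def by blast

lemma smooth_on_local:
  assumes "\<And>x. x \<in> S \<Longrightarrow> \<exists>U. open U \<and> x \<in> U \<and> smooth_on U f"
  shows "smooth_on S f"
  using assms unfolding smooth_on_def by (meson Ck_on_local)

lemma smooth_on_imp_differentiable: "smooth_on S f \<Longrightarrow> x \<in> S \<Longrightarrow> f differentiable (at x)"
  unfolding smooth_on_def by (metis Ck_on.simps(2))

lemma smooth_on_imp_continuous_on: "smooth_on S f \<Longrightarrow> continuous_on S f"
  unfolding smooth_on_def by (metis Ck_on.simps(1))

lemma smooth_on_frechet_derivative:
  "smooth_on S f \<Longrightarrow> smooth_on S (\<lambda>x. frechet_derivative f (at x) v)"
  unfolding smooth_on_def by (metis Ck_on.simps(2))

lemma smooth_on_const: "smooth_on S (\<lambda>x. c)"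
  by (simp add: smooth_on_def Ck_on_const)

lemma smooth_on_bounded_linear: "bounded_linear f \<Longrightarrow> smooth_on S f"
  by (simp add: smooth_on_def Ck_on_bounded_linear)

lemma smooth_on_add:
  "open S \<Longrightarrow> smooth_on S f \<Longrightarrow> smooth_on S g \<Longrightarrow> smooth_on S (\<lambda>x. f x + g x)"
  by (simp add: smooth_on_def Ck_on_add)

lemma smooth_on_sum:
  "open S \<Longrightarrow> (\<And>i. i \<in> I \<Longrightarrow> smooth_on S (f i)) \<Longrightarrow> smooth_on S (\<lambda>x. \<Sum>i\<in>I. f i x)"
  by (simp add: smooth_on_def Ck_on_sum)

lemma smooth_on_bilinear:
  "bounded_bilinear p \<Longrightarrow> open S \<Longrightarrow> smooth_on S f \<Longrightarrow> smooth_on S g \<Longrightarrow> smooth_on S (\<lambda>x. p (f x) (g x))"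
  by (simp add: smooth_on_def Ck_on_bilinear)

lemmas smooth_on_scaleR = smooth_on_bilinear[OF bounded_bilinear_scaleR]
lemmas smooth_on_mult = smooth_on_bilinear[OF bounded_bilinear_mult]
lemmas smooth_on_inner = smooth_on_bilinear[OF bounded_bilinear_inner]

lemma smooth_on_o:
  fixes f :: "'a::real_normed_vector \<Rightarrow> 'b::euclidean_space"
    and g :: "'b \<Rightarrow> 'c::real_normed_vector"
  shows "open S \<Longrightarrow> open T \<Longrightarrow> smooth_on S f \<Longrightarrow> smooth_on T g \<Longrightarrow> f ` S \<subseteq> T \<Longrightarrow>
    smooth_on S (\<lambda>x. g (f x))"
  by (simp add: smooth_on_def Ck_on_o)

lemma smooth_on_linear_compose:
  fixes g :: "'b::euclidean_space \<Rightarrow> 'c::real_normed_vector"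
  shows "open S \<Longrightarrow> linear g \<Longrightarrow> smooth_on S f \<Longrightarrow> smooth_on S (\<lambda>x. g (f x))"
  unfolding smooth_on_def
  by (simp add: linear_conv_bounded_linear bounded_linear.Ck_on_compose)

lemma smooth_on_minus:
  fixes f :: "'a::real_normed_vector \<Rightarrow> 'b::real_normed_vector"
  shows "open S \<Longrightarrow> smooth_on S f \<Longrightarrow> smooth_on S (\<lambda>x. - f x)"
  using bounded_linear.Ck_on_compose[OF bounded_linear_minus[OF bounded_linear_ident]]
  unfolding smooth_on_def by blast

lemma smooth_on_diff:
  fixes f :: "'a::real_normed_vector \<Rightarrow> 'b::real_normed_vector"
  shows "open S \<Longrightarrow> smooth_on S f \<Longrightarrow> smooth_on S g \<Longrightarrow> smooth_on S (\<lambda>x. f x - g x)"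
  using smooth_on_add[of S f "\<lambda>x. - g x"] smooth_on_minus[of S g] by simp

lemma smooth_on_ident: "smooth_on U (\<lambda>x. x)"
  by (rule smooth_on_bounded_linear[OF bounded_linear_ident])

lemma smooth_on_inner_const: "open U \<Longrightarrow> smooth_on U f \<Longrightarrow> smooth_on U (\<lambda>y. f y \<bullet> b)"
  by (intro smooth_on_inner smooth_on_const)

lemma smooth_on_componentwise:
  fixes f :: "'a::real_normed_vector \<Rightarrow> 'b::euclidean_space"
  assumes "open S" "\<And>b. b \<in> Basis \<Longrightarrow> smooth_on S (\<lambda>x. f x \<bullet> b)"
  shows "smooth_on S f"
proof -
  have "smooth_on S (\<lambda>x. \<Sum>b\<in>Basis. (f x \<bullet> b) *\<^sub>R b)"
    using assms by (intro smooth_on_sum smooth_on_scaleR smooth_on_const)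
  then show ?thesis by (simp add: euclidean_representation)
qed

lemma smooth_on_Pair:
  fixes f :: "'a::real_normed_vector \<Rightarrow> 'b::real_normed_vector"
    and g :: "'a::real_normed_vector \<Rightarrow> 'c::real_normed_vector"
  assumes "open S" "smooth_on S f" "smooth_on S g"
  shows "smooth_on S (\<lambda>x. (f x, g x))"
proof -
  have "bounded_linear (\<lambda>y::'b. (y, 0::'c))" "bounded_linear (\<lambda>y::'c. (0::'b, y))"
    by (simp_all add: bounded_linear_Pair bounded_linear_ident bounded_linear_zero)
  from this[THEN bounded_linear.Ck_on_compose, OF \<open>open S\<close>]
  have "smooth_on S (\<lambda>x. (f x, 0) + (0, g x))"
    using assms unfolding smooth_on_def by (intro allI Ck_on_add) blast+
  then show ?thesis by simp
qed

text \<open>Base point and direction both move. Smoothness of the left-invariant frame, of its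
  inverse and of derivatives along it is obtained in this form.\<close>

lemma smooth_on_frechet_derivative_apply:
  fixes f :: "'a::euclidean_space \<Rightarrow> 'b::real_normed_vector"
    and h :: "'c::real_normed_vector \<Rightarrow> 'a"
  assumes "open S" "open T" "smooth_on T f" "smooth_on S h" "h ` S \<subseteq> T" "smooth_on S v"
  shows "smooth_on S (\<lambda>x. frechet_derivative f (at (h x)) (v x))"
proof -
  have "smooth_on S (\<lambda>x. \<Sum>b\<in>Basis. (v x \<bullet> b) *\<^sub>R frechet_derivative f (at (h x)) b)"
    using assms(1,6)
  proof (intro smooth_on_sum smooth_on_scaleR smooth_on_inner smooth_on_const)
    show "smooth_on S (\<lambda>x. frechet_derivative f (at (h x)) b)" for b
      by (rule smooth_on_o[OF assms(1,2,4) smooth_on_frechet_derivative[OF assms(3)] assms(5)])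
  qed
  moreover have "frechet_derivative f (at (h x)) (v x) =
      (\<Sum>b\<in>Basis. (v x \<bullet> b) *\<^sub>R frechet_derivative f (at (h x)) b)" if "x \<in> S" for x
    by (rule frechet_derivative_Basis[OF smooth_on_imp_differentiable[OF assms(3)]])
       (use assms(5) that in blast)
  ultimately show ?thesis
    by (rule smooth_on_cong[OF \<open>open S\<close>, THEN iffD2, rotated])
qed

section \<open>Symmetry of second derivatives and Hadamard's lemma\<close>

lemma has_real_derivative_along_line:
  assumes "f differentiable (at (a + s *\<^sub>R u))"
  shows "((\<lambda>s. f (a + s *\<^sub>R u)) has_real_derivative frechet_derivative f (at (a + s *\<^sub>R u)) u) (at s)"
proof -
  have "((\<lambda>s. a + s *\<^sub>R u) has_derivative (\<lambda>s. s *\<^sub>R u)) (at s)"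
    by (auto intro!: derivative_eq_intros)
  from has_derivative_compose[OF this has_derivative_frechet[OF assms]]
  have "((\<lambda>s. f (a + s *\<^sub>R u)) has_derivative
      (\<lambda>t. frechet_derivative f (at (a + s *\<^sub>R u)) (t *\<^sub>R u))) (at s)" .
  then show ?thesis
    by (simp add: has_field_derivative_def linear_cmul[OF linear_frechet_derivative[OF assms]]
        mult.commute[of _ "frechet_derivative f (at (a + s *\<^sub>R u)) u"] mult_commute_abs)
qed

text \<open>The mean value theorem is used twice: along \<open>u\<close> for the difference of
  \<open>f\<close> on two parallel segments, then along \<open>v\<close> for the derivative of
  \<open>f\<close> in direction \<open>u\<close>. The bound on \<open>h\<close> keeps the
  parallelogram inside the ball.\<close>

lemma second_difference_mvt:
  fixes f :: "'a::euclidean_space \<Rightarrow> real"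
  assumes f: "smooth_on (ball x e) f" and "0 < h" and h: "h * (norm u + norm v) < e"
  obtains y where "dist x y \<le> h * (norm u + norm v)"
    "f (x + h *\<^sub>R u + h *\<^sub>R v) - f (x + h *\<^sub>R u) - f (x + h *\<^sub>R v) + f x =
      h * h * frechet_derivative (\<lambda>z. frechet_derivative f (at z) u) (at y) v"
proof -
  have d: "dist x (x + s *\<^sub>R u + t *\<^sub>R v) \<le> h * (norm u + norm v)"
    if "0 \<le> s" "s \<le> h" "0 \<le> t" "t \<le> h" for s t
  proof -
    have "dist x (x + s *\<^sub>R u + t *\<^sub>R v) \<le> s * norm u + t * norm v"
      using norm_triangle_ineq[of "s *\<^sub>R u" "t *\<^sub>R v"] that
      by (subst dist_commute) (simp add: dist_norm add.assoc)
    also have "\<dots> \<le> h * norm u + h * norm v"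
      by (intro add_mono mult_right_mono that) auto
    finally show ?thesis by (simp add: algebra_simps)
  qed
  then have b: "x + s *\<^sub>R u + t *\<^sub>R v \<in> ball x e"
    if "0 \<le> s" "s \<le> h" "0 \<le> t" "t \<le> h" for s t
    using order.strict_trans1[OF d[OF that] h] by simp
  have df: "f differentiable (at y)" if "y \<in> ball x e" for y
    using smooth_on_imp_differentiable[OF f that] .
  define f1 where "f1 = (\<lambda>z. frechet_derivative f (at z) u)"
  have df1: "f1 differentiable (at y)" if "y \<in> ball x e" for y
    using smooth_on_imp_differentiable[OF smooth_on_frechet_derivative[OF f] that]
    unfolding f1_def .
  define g where "g = (\<lambda>s. f (x + h *\<^sub>R v + s *\<^sub>R u) - f (x + s *\<^sub>R u))"
  have "(g has_real_derivative f1 (x + h *\<^sub>R v + s *\<^sub>R u) - f1 (x + s *\<^sub>R u)) (at s)"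
    if "0 \<le> s" "s \<le> h" for s
    unfolding g_def f1_def
    using b[OF that, of h] b[OF that, of 0] \<open>0 < h\<close>
    by (intro DERIV_diff has_real_derivative_along_line df) (simp_all add: add_ac)
  from MVT2[OF \<open>0 < h\<close>, of g, OF this]
  obtain s where s: "0 < s" "s < h"
    "g h - g 0 = h * (f1 (x + h *\<^sub>R v + s *\<^sub>R u) - f1 (x + s *\<^sub>R u))"
    by auto
  have "((\<lambda>t. f1 (x + s *\<^sub>R u + t *\<^sub>R v)) has_real_derivative
      frechet_derivative f1 (at (x + s *\<^sub>R u + t *\<^sub>R v)) v) (at t)" if "0 \<le> t" "t \<le> h" for t
    using b[of s t] s that by (intro has_real_derivative_along_line df1) auto
  from MVT2[OF \<open>0 < h\<close>, of "\<lambda>t. f1 (x + s *\<^sub>R u + t *\<^sub>R v)", OF this]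
  obtain t where t: "0 < t" "t < h"
    "f1 (x + s *\<^sub>R u + h *\<^sub>R v) - f1 (x + s *\<^sub>R u) =
      h * frechet_derivative f1 (at (x + s *\<^sub>R u + t *\<^sub>R v)) v"
    by auto
  have "g h - g 0 = h * h * frechet_derivative f1 (at (x + s *\<^sub>R u + t *\<^sub>R v)) v"
    using s(3) t(3) by (simp add: add_ac)
  moreover have "g h - g 0 = f (x + h *\<^sub>R u + h *\<^sub>R v) - f (x + h *\<^sub>R u) - f (x + h *\<^sub>R v) + f x"
    by (simp add: g_def add_ac)
  ultimately show thesis
    using that[OF d[of s t]] s t unfolding f1_def by auto
qed

text \<open>The second difference is symmetric in \<open>u\<close> and \<open>v\<close>, so its two
  mean value expressions agree. As the step tends to zero, the intermediate points tend to
  \<open>x\<close>, and second derivatives are continuous.\<close>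

lemma smooth_on_second_derivative_symmetric:
  fixes f :: "'a::euclidean_space \<Rightarrow> real"
  assumes "open S" "smooth_on S f" "x \<in> S"
  shows "frechet_derivative (\<lambda>z. frechet_derivative f (at z) u) (at x) v =
         frechet_derivative (\<lambda>z. frechet_derivative f (at z) v) (at x) u"
proof -
  obtain e where e: "0 < e" "ball x e \<subseteq> S"
    using assms(1,3) open_contains_ball by blast
  then have f: "smooth_on (ball x e) f"
    using assms(2) smooth_on_subset by blast
  define K where "K = norm u + norm v + 1"
  have K: "K > 0" by (simp add: K_def add_nonneg_pos)
  \<comment> \<open>The summand \<open>1\<close> keeps \<open>K\<close> positive when
    \<open>u\<close> and \<open>v\<close> vanish, and the shift \<open>n + 2\<close> makes
    \<open>h n * K < e\<close> strict already for \<open>n = 0\<close>.\<close>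
  define h where "h = (\<lambda>n::nat. e / K * inverse (real (n + 2)))"
  have h: "h n > 0" "h n * K < e" for n
  proof -
    have "e * inverse (real (n + 2)) < e * 1"
      using e by (intro mult_strict_left_mono) (auto simp: field_simps)
    then show "h n > 0" "h n * K < e"
      using e K by (simp_all add: h_def)
  qed
  have hK: "h n * (norm u + norm v) < e" "h n * (norm v + norm u) < e" for n
    using h(2)[of n] h(1)[of n] by (simp_all add: K_def algebra_simps)
  have lim: "(\<lambda>n. h n * (norm u + norm v)) \<longlonglongrightarrow> 0"
  proof -
    have "(\<lambda>n. e / K * inverse (real (n + 2))) \<longlonglongrightarrow> e / K * 0"
      by (intro tendsto_mult tendsto_const LIMSEQ_ignore_initial_segment[OF lim_inverse_n])
    then have "h \<longlonglongrightarrow> 0" by (simp add: h_def)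
    then show ?thesis using tendsto_mult_left_zero by blast
  qed
  have "\<exists>y. dist x y \<le> h n * (norm u + norm v) \<and>
    f (x + h n *\<^sub>R u + h n *\<^sub>R v) - f (x + h n *\<^sub>R u) - f (x + h n *\<^sub>R v) + f x =
      h n * h n * frechet_derivative (\<lambda>z. frechet_derivative f (at z) u) (at y) v" for n
    using second_difference_mvt[OF f h(1) hK(1)] by metis
  then obtain y where y: "\<And>n. dist x (y n) \<le> h n * (norm u + norm v)"
    "\<And>n. f (x + h n *\<^sub>R u + h n *\<^sub>R v) - f (x + h n *\<^sub>R u) - f (x + h n *\<^sub>R v) + f x =
      h n * h n * frechet_derivative (\<lambda>z. frechet_derivative f (at z) u) (at (y n)) v"
    by metis
  have "\<exists>y. dist x y \<le> h n * (norm v + norm u) \<and>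
    f (x + h n *\<^sub>R v + h n *\<^sub>R u) - f (x + h n *\<^sub>R v) - f (x + h n *\<^sub>R u) + f x =
      h n * h n * frechet_derivative (\<lambda>z. frechet_derivative f (at z) v) (at y) u" for n
    using second_difference_mvt[OF f h(1) hK(2)] by metis
  then obtain z where z: "\<And>n. dist x (z n) \<le> h n * (norm v + norm u)"
    "\<And>n. f (x + h n *\<^sub>R v + h n *\<^sub>R u) - f (x + h n *\<^sub>R v) - f (x + h n *\<^sub>R u) + f x =
      h n * h n * frechet_derivative (\<lambda>z. frechet_derivative f (at z) v) (at (z n)) u"
    by metis
  have "y \<longlonglongrightarrow> x" "z \<longlonglongrightarrow> x"
    using y(1) z(1) unfolding tendsto_dist_iff[of _ x]
    by (auto intro: tendsto_sandwich[OF _ _ tendsto_const lim] simp: dist_commute add.commute)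
  moreover have "isCont (\<lambda>y. frechet_derivative (\<lambda>z. frechet_derivative f (at z) u) (at y) v) x" for u v
    using smooth_on_imp_continuous_on[OF smooth_on_frechet_derivative[OF smooth_on_frechet_derivative[OF f]]]
      e(1) by (simp add: continuous_on_eq_continuous_at)
  ultimately have
    "(\<lambda>n. frechet_derivative (\<lambda>z. frechet_derivative f (at z) u) (at (y n)) v) \<longlonglongrightarrow>
      frechet_derivative (\<lambda>z. frechet_derivative f (at z) u) (at x) v"
    "(\<lambda>n. frechet_derivative (\<lambda>z. frechet_derivative f (at z) v) (at (z n)) u) \<longlonglongrightarrow>
      frechet_derivative (\<lambda>z. frechet_derivative f (at z) v) (at x) u"
    by (auto intro: isCont_tendsto_compose)
  moreover have "frechet_derivative (\<lambda>z. frechet_derivative f (at z) u) (at (y n)) v =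
      frechet_derivative (\<lambda>z. frechet_derivative f (at z) v) (at (z n)) u" for n
  proof -
    have "h n * h n * frechet_derivative (\<lambda>z. frechet_derivative f (at z) u) (at (y n)) v =
      h n * h n * frechet_derivative (\<lambda>z. frechet_derivative f (at z) v) (at (z n)) u"
      unfolding y(2)[symmetric] z(2)[symmetric] by (simp add: add_ac)
    then show ?thesis using h(1)[of n] by simp
  qed
  ultimately show ?thesis
    using LIMSEQ_unique by simp
qed

lemma segment_in_ball:
  fixes x y :: "'a::euclidean_space"
  assumes "y \<in> ball x e" "0 \<le> t" "t \<le> 1"
  shows "x + t *\<^sub>R (y - x) \<in> ball x e"
proof -
  have "norm (t *\<^sub>R (y - x)) \<le> norm (y - x)"
    using assms by (simp add: mult_left_le_one_le)
  then show ?thesis using assms(1) by (simp add: dist_norm norm_minus_commute)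
qed

text \<open>Differentiating under the integral sign produces a factor \<open>t\<close> from the
  chain rule. An arbitrary power \<open>t ^ j\<close> makes the statement stable under
  differentiation, so that the induction on \<open>r\<close> closes.\<close>

lemma Ck_on_ray_integral:
  fixes g :: "'a::euclidean_space \<Rightarrow> real"
  assumes "smooth_on (ball x e) g"
  shows "Ck_on r (ball x e) (\<lambda>y. integral {0..1} (\<lambda>t. t ^ j * g (x + t *\<^sub>R (y - x))))"
  using assms
proof (induction r arbitrary: g j)
  case (0 g j)
  have "continuous_on (ball x e \<times> cbox 0 1) (\<lambda>(y, t). t ^ j * g (x + t *\<^sub>R (y - x)))"
    unfolding split_beta
    by (intro continuous_intros continuous_on_compose2[OF smooth_on_imp_continuous_on[OF 0]])
       (auto intro: segment_in_ball simp del: mem_ball)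
  then show ?case
    using integral_continuous_on_param[of "ball x e" 0 "1::real"] by simp
next
  case (Suc r g j)
  have dg: "g differentiable (at (x + t *\<^sub>R (y - x)))" if "y \<in> ball x e" "t \<in> {0..1}" for y t
    using smooth_on_imp_differentiable[OF Suc.prems segment_in_ball] that by simp
  \<comment> \<open>The derivative is packaged as a bounded operator because Leibniz' rule wants
    continuity of the operator in both variables; this is then checked on basis vectors.\<close>
  define G where "G = (\<lambda>y t. Blinfun (\<lambda>v. t ^ Suc j * frechet_derivative g (at (x + t *\<^sub>R (y - x))) v))"
  have G: "blinfun_apply (G y t) v = t ^ Suc j * frechet_derivative g (at (x + t *\<^sub>R (y - x))) v"
    if "y \<in> ball x e" "t \<in> {0..1}" for y t v
    unfolding G_def
    using bounded_linear_const_mult[OF has_derivative_bounded_linear[OF has_derivative_frechet[OF dg[OF that]]]]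
    by (simp add: bounded_linear_Blinfun_apply)
  have cont: "continuous_on (ball x e \<times> {0..1}) (\<lambda>(y, t). G y t)"
  proof (rule continuous_on_blinfun_componentwise)
    fix i :: 'a
    have "continuous_on (ball x e \<times> {0..1}) (\<lambda>z. snd z ^ Suc j *
        frechet_derivative g (at (x + snd z *\<^sub>R (fst z - x))) i)"
      by (intro continuous_intros
          continuous_on_compose2[OF smooth_on_imp_continuous_on[OF smooth_on_frechet_derivative[OF Suc.prems]]])
         (auto intro: segment_in_ball simp del: mem_ball)
    then show "continuous_on (ball x e \<times> {0..1}) (\<lambda>z. blinfun_apply (case z of (y, t) \<Rightarrow> G y t) i)"
      by (rule continuous_on_eq) (auto simp: G simp del: mem_ball)
  qed
  have int: "(\<lambda>t. t ^ j * g (x + t *\<^sub>R (y - x))) integrable_on {0..1}" if "y \<in> ball x e" for y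
    by (intro integrable_continuous_real continuous_intros
          continuous_on_compose2[OF smooth_on_imp_continuous_on[OF Suc.prems]])
       (use that in \<open>auto intro: segment_in_ball simp del: mem_ball\<close>)
  have intG: "G y integrable_on {0..1}" if "y \<in> ball x e" for y
  proof (rule integrable_continuous_real)
    have "continuous_on {0..1} (Pair y)" by (intro continuous_intros)
    moreover have "Pair y ` {0..1} \<subseteq> ball x e \<times> {0..1}" using that by blast
    ultimately show "continuous_on {0..1} (G y)"
      using continuous_on_compose2[OF cont] by fastforce
  qed
  have der: "((\<lambda>y. integral {0..1} (\<lambda>t. t ^ j * g (x + t *\<^sub>R (y - x)))) has_derivative
      integral {0..1} (G y)) (at y)" if "y \<in> ball x e" for y
  proof -
    have 1: "((\<lambda>y. t ^ j * g (x + t *\<^sub>R (y - x))) has_derivative blinfun_apply (G y t)) (at y within ball x e)"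
      if "y \<in> ball x e" "t \<in> cbox 0 1" for y t
    proof -
      have lin: "linear (frechet_derivative g (at (x + t *\<^sub>R (y - x))))"
        using dg[of y t] that linear_frechet_derivative by auto
      have "((\<lambda>y. x + t *\<^sub>R (y - x)) has_derivative (\<lambda>v. t *\<^sub>R v)) (at y)"
        by (auto intro!: derivative_eq_intros)
      from has_derivative_compose[OF this has_derivative_frechet[OF dg]] that
      have "((\<lambda>y. t ^ j * g (x + t *\<^sub>R (y - x))) has_derivative
        (\<lambda>v. t ^ j * frechet_derivative g (at (x + t *\<^sub>R (y - x))) (t *\<^sub>R v))) (at y)"
        by (intro has_derivative_mult_right) auto
      moreover have "(\<lambda>v. t ^ j * frechet_derivative g (at (x + t *\<^sub>R (y - x))) (t *\<^sub>R v)) = blinfun_apply (G y t)"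
        using that by (auto simp: G linear_cmul[OF lin] simp del: mem_ball)
      ultimately show ?thesis
        by (metis has_derivative_at_withinI)
    qed
    from leibniz_rule[of "ball x e" 0 1 "\<lambda>y t. t ^ j * g (x + t *\<^sub>R (y - x))" G, OF 1 _ _ that] cont int
    show ?thesis using at_within_open[OF that] by (simp del: mem_ball)
  qed
  have "frechet_derivative (\<lambda>y. integral {0..1} (\<lambda>t. t ^ j * g (x + t *\<^sub>R (y - x)))) (at y) v =
      integral {0..1} (\<lambda>t. t ^ Suc j * frechet_derivative g (at (x + t *\<^sub>R (y - x))) v)"
    if "y \<in> ball x e" for y v
  proof -
    have "frechet_derivative (\<lambda>y. integral {0..1} (\<lambda>t. t ^ j * g (x + t *\<^sub>R (y - x)))) (at y) v =
      integral {0..1} (\<lambda>t. blinfun_apply (G y t) v)"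
      using frechet_derivative_eqI[OF der[OF that]] blinfun_apply_integral[OF intG[OF that]] by simp
    also have "\<dots> = integral {0..1} (\<lambda>t. t ^ Suc j * frechet_derivative g (at (x + t *\<^sub>R (y - x))) v)"
      by (intro integral_cong G that)
    finally show ?thesis .
  qed
  moreover have "Ck_on r (ball x e) (\<lambda>y. integral {0..1} (\<lambda>t. t ^ Suc j * frechet_derivative g (at (x + t *\<^sub>R (y - x))) v))" for v
    by (rule Suc.IH[OF smooth_on_frechet_derivative[OF Suc.prems]])
  ultimately show ?case
    using differentiableI[OF der] by (auto simp del: mem_ball power_Suc cong: Ck_on_cong[OF open_ball])
qed

text \<open>The fundamental theorem of calculus on the segment from \<open>x\<close> to
  \<open>y\<close>: \<open>g b\<close> is the mean of a partial derivative over the segment, smooth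
  in \<open>y\<close> by \<open>Ck_on_ray_integral\<close> with exponent \<open>0\<close>.\<close>

lemma hadamard:
  fixes f :: "'a::euclidean_space \<Rightarrow> real"
  assumes f: "smooth_on (ball x e) f"
  obtains g where "\<And>b. smooth_on (ball x e) (g b)"
    "\<And>y. y \<in> ball x e \<Longrightarrow> f y = f x + (\<Sum>b\<in>Basis. ((y - x) \<bullet> b) * g b y)"
    "\<And>b. g b x = frechet_derivative f (at x) b"
proof
  define g where "g = (\<lambda>b y. integral {0..1} (\<lambda>t. t ^ 0 * frechet_derivative f (at (x + t *\<^sub>R (y - x))) b))"
  show "smooth_on (ball x e) (g b)" for b
    unfolding smooth_on_def g_def using Ck_on_ray_integral[OF smooth_on_frechet_derivative[OF f]] by blast
  show "g b x = frechet_derivative f (at x) b" for b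
    by (simp add: g_def)
  fix y assume y: "y \<in> ball x e"
  have df: "f differentiable (at (x + t *\<^sub>R (y - x)))" if "t \<in> {0..1}" for t
    using smooth_on_imp_differentiable[OF f segment_in_ball] that y by simp
  have "((\<lambda>t. frechet_derivative f (at (x + t *\<^sub>R (y - x))) (y - x)) has_integral
      f (x + 1 *\<^sub>R (y - x)) - f (x + 0 *\<^sub>R (y - x))) {0..1}"
  proof (rule fundamental_theorem_of_calculus)
    show "((\<lambda>t. f (x + t *\<^sub>R (y - x))) has_vector_derivative
       frechet_derivative f (at (x + t *\<^sub>R (y - x))) (y - x)) (at t within {0..1})" if "t \<in> {0..1}" for t
      using has_real_derivative_along_line[OF df[OF that]]
      by (simp add: has_real_derivative_iff_has_vector_derivative has_vector_derivative_at_within)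
  qed simp
  then have "f y - f x = integral {0..1} (\<lambda>t. frechet_derivative f (at (x + t *\<^sub>R (y - x))) (y - x))"
    by (simp add: integral_unique)
  also have "\<dots> = integral {0..1} (\<lambda>t. \<Sum>b\<in>Basis. ((y - x) \<bullet> b) * frechet_derivative f (at (x + t *\<^sub>R (y - x))) b)"
    by (intro integral_cong) (subst frechet_derivative_Basis[OF df]; simp)
  also have "\<dots> = (\<Sum>b\<in>Basis. integral {0..1} (\<lambda>t. ((y - x) \<bullet> b) * frechet_derivative f (at (x + t *\<^sub>R (y - x))) b))"
  proof (rule integral_sum)
    show "(\<lambda>t. (y - x) \<bullet> b * frechet_derivative f (at (x + t *\<^sub>R (y - x))) b) integrable_on {0..1}" for b
      by (intro integrable_continuous_real continuous_intros
          continuous_on_compose2[OF smooth_on_imp_continuous_on[OF smooth_on_frechet_derivative[OF f]]])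
         (use y in \<open>auto intro: segment_in_ball simp del: mem_ball\<close>)
  qed simp
  also have "\<dots> = (\<Sum>b\<in>Basis. ((y - x) \<bullet> b) * g b y)"
    by (simp add: g_def)
  finally show "f y = f x + (\<Sum>b\<in>Basis. ((y - x) \<bullet> b) * g b y)" by simp
qed

section \<open>Quotients of a Lie group structure on a Euclidean space\<close>

text \<open>The group is a whole Euclidean space with identity \<open>0\<close>, so one chart
  suffices for it. Closedness of \<open>L\<close> makes the quotient Hausdorff, discreteness at
  \<open>0\<close> makes the projection locally injective, and a compact set meeting every coset
  makes the quotient compact.\<close>

locale lattice_quotient =
  fixes mul :: "'e::euclidean_space \<Rightarrow> 'e \<Rightarrow> 'e" (infixl "\<odot>" 70)
    and iv :: "'e \<Rightarrow> 'e" and L :: "'e set"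
  assumes mul_assoc: "(x \<odot> y) \<odot> z = x \<odot> (y \<odot> z)"
    and mul_0_left [simp]: "0 \<odot> x = x" and mul_0_right [simp]: "x \<odot> 0 = x"
    and iv_left [simp]: "iv x \<odot> x = 0" and iv_right [simp]: "x \<odot> iv x = 0"
    and smooth_mul: "smooth_on UNIV (\<lambda>(x, y). x \<odot> y)" and smooth_iv: "smooth_on UNIV iv"
    and L_0: "0 \<in> L" and L_mul: "x \<in> L \<Longrightarrow> y \<in> L \<Longrightarrow> x \<odot> y \<in> L" and L_iv: "x \<in> L \<Longrightarrow> iv x \<in> L"
    and L_closed: "closed L" and L_discrete: "\<exists>e>0. L \<inter> ball 0 e = {0}"
    and L_cocompact: "\<exists>K. compact K \<and> (\<forall>x. \<exists>h\<in>L. h \<odot> x \<in> K)"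
begin

definition G :: "'e monoid" where
  "G = \<lparr>carrier = UNIV, mult = (\<odot>), one = 0\<rparr>"

definition S :: "('e, 'e) manifold" where
  "S = \<lparr>topo = euclidean, atlas = {(UNIV, id)}\<rparr>"

definition M :: "('e set, 'e) manifold" where
  "M = quotient_manifold G S L"

definition p :: "'e \<Rightarrow> 'e set" where
  "p x = L #>\<^bsub>G\<^esub> x"

lemma iv_mul_cancel [simp]: "iv x \<odot> (x \<odot> y) = y" "x \<odot> (iv x \<odot> y) = y"
  by (simp_all flip: mul_assoc)

lemma mul_iv_cancel [simp]: "x \<odot> y \<odot> iv y = x" "x \<odot> iv y \<odot> y = x"
  by (simp_all add: mul_assoc)

lemma iv_iv [simp]: "iv (iv x) = x"
  by (metis iv_left iv_mul_cancel(1) mul_0_right)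

lemma iv_mul: "iv (x \<odot> y) = iv y \<odot> iv x"
  by (metis iv_mul_cancel(1) mul_assoc iv_right mul_0_right)

lemma group_G: "group G"
  by (rule groupI) (auto simp: G_def mul_assoc intro: iv_left)

lemma G_simps [simp]: "carrier G = UNIV" "x \<otimes>\<^bsub>G\<^esub> y = x \<odot> y" "\<one>\<^bsub>G\<^esub> = 0"
  by (simp_all add: G_def)

lemma inv_G [simp]: "inv\<^bsub>G\<^esub> x = iv x"
  by (rule group.inv_equality[OF group_G]) auto

lemma subgroup_L: "subgroup L G"
  by (rule group.subgroupI[OF group_G]) (auto simp: L_0 L_mul L_iv intro: L_0)

lemma p_altdef: "p x = (\<lambda>h. h \<odot> x) ` L"
  by (auto simp: p_def r_coset_def)

lemma p_eq_iff: "p x = p y \<longleftrightarrow> x \<odot> iv y \<in> L"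
proof
  assume "p x = p y"
  then have "0 \<odot> x \<in> (\<lambda>h. h \<odot> y) ` L"
    using L_0 unfolding p_altdef by (metis imageI)
  then show "x \<odot> iv y \<in> L"
    by auto
next
  assume *: "x \<odot> iv y \<in> L"
  have "h \<odot> x \<in> (\<lambda>h. h \<odot> y) ` L" if "h \<in> L" for h
    by (rule image_eqI[of _ _ "h \<odot> (x \<odot> iv y)"]) (use * that L_mul in \<open>auto simp: mul_assoc\<close>)
  moreover have "h \<odot> y \<in> (\<lambda>h. h \<odot> x) ` L" if "h \<in> L" for h
    by (rule image_eqI[of _ _ "h \<odot> iv (x \<odot> iv y)"])
       (use L_mul[OF that L_iv[OF *]] in \<open>auto simp: mul_assoc iv_mul\<close>)
  ultimately show "p x = p y"
    unfolding p_altdef by blast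
qed

lemma p_translate: "h \<in> L \<Longrightarrow> p (h \<odot> x) = p x"
  by (simp add: p_eq_iff)

lemma p_eqE:
  assumes "p x = p y" obtains h where "h \<in> L" "x = h \<odot> y"
  using assms unfolding p_eq_iff by (metis mul_iv_cancel(2))

lemma smooth_on_mul:
  fixes f g :: "'b::real_normed_vector \<Rightarrow> 'e"
  assumes "open U" "smooth_on U f" "smooth_on U g"
  shows "smooth_on U (\<lambda>x. f x \<odot> g x)"
  using smooth_on_o[OF assms(1) open_UNIV smooth_on_Pair[OF assms] smooth_mul] by simp

lemma smooth_on_iv:
  fixes f :: "'b::real_normed_vector \<Rightarrow> 'e"
  shows "open U \<Longrightarrow> smooth_on U f \<Longrightarrow> smooth_on U (\<lambda>x. iv (f x))"
  using smooth_on_o[of U UNIV f iv] smooth_iv by simp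

lemma continuous_translate: "continuous_on U (\<lambda>x. y \<odot> x)"
  by (rule continuous_on_subset[OF smooth_on_imp_continuous_on[OF
        smooth_on_mul[OF open_UNIV smooth_on_const smooth_on_ident]]]) simp

lemma continuous_mul_iv: "continuous_on U (\<lambda>z. fst z \<odot> iv (snd z))"
proof -
  have "smooth_on UNIV (\<lambda>z. fst z \<odot> iv (snd z))"
    by (intro smooth_on_mul smooth_on_iv open_UNIV smooth_on_bounded_linear
        bounded_linear_fst bounded_linear_snd)
  from smooth_on_imp_continuous_on[OF this] show ?thesis
    using continuous_on_subset by blast
qed

lemma open_translate: "open U \<Longrightarrow> open ((\<lambda>x. y \<odot> x) ` U)"
proof -
  assume "open U"
  have "(\<lambda>x. y \<odot> x) ` U = (\<lambda>x. iv y \<odot> x) -` U"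
    by (auto simp: image_iff) (metis iv_mul_cancel(2))
  then show ?thesis
    using \<open>open U\<close> continuous_translate[of UNIV "iv y"] by (simp add: open_vimage)
qed

section \<open>Manifold structures on the group and on the quotient\<close>

lemma smooth_manifold_S: "smooth_manifold S"
proof -
  obtain B :: "'e set set" where B: "countable B" "topological_basis B"
    using ex_countable_basis by blast
  have "\<exists>\<B>::'e set set. countable \<B> \<and> (\<forall>V\<in>\<B>. open V) \<and>
        (\<forall>W x. open W \<and> x \<in> W \<longrightarrow> (\<exists>V\<in>\<B>. x \<in> V \<and> V \<subseteq> W))"
    using B topological_basis_open topological_basisE by (metis (no_types, lifting))
  then show ?thesis
    unfolding smooth_manifold_def S_def
    by (auto simp: homeomorphic_map_id[unfolded id_def] smooth_on_bounded_linear id_def inv_id[unfolded id_def]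
        Hausdorff_space_euclidean bounded_linear_ident comp_def)
qed

lemma lie_group_G: "lie_group G S"
proof -
  have inv_id2: "inv_into UNIV (map_prod id id) = (\<lambda>z::'e \<times> 'e. z)"
  proof -
    have "map_prod id id = (id :: 'e \<times> 'e \<Rightarrow> _)" by auto
    then show ?thesis by (simp add: id_def[symmetric])
  qed
  have "continuous_on UNIV (\<lambda>(x, y). x \<odot> y)" "continuous_on UNIV iv"
    using smooth_mul smooth_iv smooth_on_imp_continuous_on by blast+
  then show ?thesis
    using smooth_mul smooth_iv group_G smooth_manifold_S
    unfolding lie_group_def smooth_map_def
    by (auto simp: S_def prod_manifold_def comp_def inv_id2 euclidean_product_topology map_prod_def
        case_prod_unfold)
qed

lemma openin_M: "openin (topo M) V \<longleftrightarrow> V \<subseteq> range p \<and> open (p -` V)"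
  by (simp add: M_def quotient_manifold_def Let_def openin_quotient_topology S_def vimage_def
      p_def[abs_def])

lemma points_M: "points M = range p"
proof -
  have "p -` range p = UNIV" by auto
  then have "openin (topo M) (range p)" by (simp add: openin_M)
  then show ?thesis
    by (meson openin_M openin_subset openin_topspace subset_antisym)
qed

lemma atlas_M: "atlas M = {(p ` W, inv_into W p) | W. open W \<and> inj_on p W}"
  by (auto simp: M_def quotient_manifold_def Let_def S_def p_def[abs_def])

lemma continuous_map_p: "continuous_map euclidean (topo M) p"
  by (auto simp: continuous_map_def points_M openin_M vimage_def)

lemma openin_p_image: "open W \<Longrightarrow> openin (topo M) (p ` W)"
proof -
  assume "open W"
  have "p -` (p ` W) = (\<Union>h\<in>L. (\<lambda>x. h \<odot> x) ` W)"
    by (auto simp: p_translate elim!: p_eqE)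
  then show ?thesis
    using \<open>open W\<close> by (auto simp: openin_M intro!: open_translate)
qed

text \<open>The map sending (a, b) to \<open>a \<odot> iv b\<close> is continuous and takes the
  diagonal to \<open>0\<close>. Near (x, x) its values avoid the nonzero elements of
  \<open>L\<close>, so points with equal cosets coincide.\<close>

lemma ex_inj_nbhd: "\<exists>W. open W \<and> x \<in> W \<and> inj_on p W"
proof -
  obtain e where e: "e > 0" "L \<inter> ball 0 e = {0}" using L_discrete by blast
  have "open ((\<lambda>z. fst z \<odot> iv (snd z)) -` ball 0 e)"
    by (rule open_vimage[OF open_ball continuous_mul_iv])
  moreover have "(x, x) \<in> (\<lambda>z. fst z \<odot> iv (snd z)) -` ball 0 e" using e by simp
  ultimately obtain A B where AB: "open A" "open B" "x \<in> A" "x \<in> B"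
    "A \<times> B \<subseteq> (\<lambda>z. fst z \<odot> iv (snd z)) -` ball 0 e"
    by (rule open_prod_elim) auto
  have "inj_on p (A \<inter> B)"
  proof (rule inj_onI)
    fix a b assume "a \<in> A \<inter> B" "b \<in> A \<inter> B" "p a = p b"
    then have "a \<odot> iv b \<in> L \<inter> ball 0 e"
      using AB(5) by (auto simp: p_eq_iff)
    then have "a \<odot> iv b = 0" using e by simp
    then show "a = b" by (metis mul_0_left mul_iv_cancel(2))
  qed
  then show ?thesis using AB by blast
qed

text \<open>For distinct cosets \<open>x \<odot> iv y\<close> lies in the open complement of
  \<open>L\<close>. This persists on a product of neighbourhoods of \<open>x\<close> and
  \<open>y\<close>, whose images are therefore disjoint.\<close>

lemma Hausdorff_M: "Hausdorff_space (topo M)"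
  unfolding Hausdorff_space_def points_M
proof (intro allI impI)
  fix q r assume qr: "q \<in> range p \<and> r \<in> range p \<and> q \<noteq> r"
  then obtain x y where xy: "q = p x" "r = p y" by blast
  have "open ((\<lambda>z. fst z \<odot> iv (snd z)) -` (- L))"
    by (rule open_vimage[OF _ continuous_mul_iv]) (use L_closed in auto)
  moreover have "(x, y) \<in> (\<lambda>z. fst z \<odot> iv (snd z)) -` (- L)" using qr xy by (simp add: p_eq_iff)
  ultimately obtain A B where AB: "open A" "open B" "x \<in> A" "y \<in> B"
    "A \<times> B \<subseteq> (\<lambda>z. fst z \<odot> iv (snd z)) -` (- L)"
    by (rule open_prod_elim) auto
  have "p a \<noteq> p b" if "a \<in> A" "b \<in> B" for a b
    using AB(5) that by (auto simp: p_eq_iff)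
  then have "disjnt (p ` A) (p ` B)"
    unfolding disjnt_def by blast
  then show "\<exists>U V. openin (topo M) U \<and> openin (topo M) V \<and> q \<in> U \<and> r \<in> V \<and> disjnt U V"
    using AB openin_p_image xy by blast
qed

lemma second_countable_M:
  "\<exists>\<B>. countable \<B> \<and> (\<forall>V\<in>\<B>. openin (topo M) V) \<and>
        (\<forall>W x. openin (topo M) W \<and> x \<in> W \<longrightarrow> (\<exists>V\<in>\<B>. x \<in> V \<and> V \<subseteq> W))"
proof -
  obtain B :: "'e set set" where B: "countable B" "topological_basis B"
    using ex_countable_basis by blast
  have "\<exists>V\<in>(`) p ` B. q \<in> V \<and> V \<subseteq> W" if W: "openin (topo M) W" "q \<in> W" for W q
  proof -
    obtain x where x: "q = p x" using W by (auto simp: openin_M)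
    then obtain V where "V \<in> B" "x \<in> V" "V \<subseteq> p -` W"
      using topological_basisE[OF B(2), of "p -` W" x] W by (auto simp: openin_M)
    then show ?thesis using x by blast
  qed
  moreover have "\<forall>V\<in>(`) p ` B. openin (topo M) V"
    using topological_basis_open[OF B(2)] openin_p_image by blast
  ultimately show ?thesis
    using B(1) by (intro exI[of _ "(`) p ` B"]) auto
qed

lemma chart_homeomorphic:
  assumes W: "open W" "inj_on p W"
  shows "homeomorphic_map (subtopology (topo M) (p ` W)) (top_of_set W) (inv_into W p)"
proof -
  have tops: "topspace (subtopology (topo M) (p ` W)) = p ` W"
    by (auto simp: points_M)
  have "homeomorphic_map (top_of_set W) (subtopology (topo M) (p ` W)) p"
  proof (rule bijective_open_imp_homeomorphic_map)
    show "continuous_map (top_of_set W) (subtopology (topo M) (p ` W)) p"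
      by (auto simp: continuous_map_in_subtopology continuous_map_from_subtopology[OF continuous_map_p])
    show "open_map (top_of_set W) (subtopology (topo M) (p ` W)) p"
      unfolding open_map_def
    proof (intro allI impI)
      fix U assume "openin (top_of_set W) U"
      then have U: "open U" "U \<subseteq> W"
        using W(1) by (auto simp: openin_open_eq)
      then show "openin (subtopology (topo M) (p ` W)) (p ` U)"
        by (simp add: openin_open_subtopology[OF openin_p_image[OF W(1)]] openin_p_image image_mono)
    qed
  qed (use W in \<open>auto simp: points_M\<close>)
  then obtain g where g: "homeomorphic_maps (top_of_set W) (subtopology (topo M) (p ` W)) p g"
    using homeomorphic_map_maps by blast
  then have "homeomorphic_map (subtopology (topo M) (p ` W)) (top_of_set W) g"
    using homeomorphic_maps_sym homeomorphic_map_maps by blast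
  moreover have "g q = inv_into W p q" if "q \<in> p ` W" for q
    using that g W(2) by (auto simp: homeomorphic_maps_def)
  ultimately show ?thesis
    using homeomorphic_map_eq tops by metis
qed

lemma inv_chart:
  "inj_on p W \<Longrightarrow> y \<in> W \<Longrightarrow> inv_into (p ` W) (inv_into W p) y = p y"
  by (intro inv_into_f_eq) (auto simp: inj_on_inv_into)

lemma chart_image: "inj_on p W \<Longrightarrow> inv_into W p ` (p ` W \<inter> V) = W \<inter> p -` V"
  by (force simp: image_iff)

lemma open_chart_overlap: "open W \<Longrightarrow> openin (topo M) V \<Longrightarrow> open (W \<inter> p -` V)"
  by (simp add: openin_M open_Int)

text \<open>Near each point a single \<open>h\<close> in \<open>L\<close> carries one sheet into the
  other, and there the change of charts is left translation by \<open>h\<close>.\<close>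

lemma smooth_transition:
  assumes W: "open W" "inj_on p W" and W': "open W'" "inj_on p W'"
  shows "smooth_on (W \<inter> p -` (p ` W')) (inv_into W' p \<circ> p)"
proof (rule smooth_on_local)
  fix y assume "y \<in> W \<inter> p -` (p ` W')"
  then obtain y' where y': "y \<in> W" "y' \<in> W'" "p y = p y'" by auto
  then obtain h where h: "h \<in> L" "y' = h \<odot> y" by (metis p_eqE)
  define U where "U = W \<inter> (\<lambda>x. h \<odot> x) -` W'"
  have U: "open U" unfolding U_def
    using W(1) W'(1) by (intro open_Int open_vimage continuous_translate)
  have "smooth_on U (\<lambda>x. h \<odot> x)"
    by (intro smooth_on_mul U smooth_on_const smooth_on_ident)
  moreover have "(inv_into W' p \<circ> p) x = h \<odot> x" if "x \<in> U" for x
    using that W'(2) h p_translate[OF h(1), of x] unfolding U_def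
    by (metis IntD2 comp_apply inv_into_f_f vimageE)
  ultimately have "smooth_on U (inv_into W' p \<circ> p)"
    using smooth_on_cong[OF U] by blast
  then show "\<exists>U. open U \<and> y \<in> U \<and> smooth_on U (inv_into W' p \<circ> p)"
    using U y' h by (auto simp: U_def)
qed

lemma smooth_manifold_M: "smooth_manifold M"
  unfolding smooth_manifold_def
proof (intro conjI Hausdorff_M second_countable_M)
  show "(\<Union>(U, \<phi>)\<in>atlas M. U) = points M"
  proof
    show "points M \<subseteq> (\<Union>(U, \<phi>)\<in>atlas M. U)"
      unfolding points_M atlas_M using ex_inj_nbhd by fast
  qed (auto simp: atlas_M points_M)
  show "\<forall>(U, \<phi>)\<in>atlas M. openin (topo M) U \<and> open (\<phi> ` U) \<and>
        homeomorphic_map (subtopology (topo M) U) (top_of_set (\<phi> ` U)) \<phi>"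
    unfolding atlas_M using chart_homeomorphic openin_p_image by auto
  show "\<forall>(U, \<phi>)\<in>atlas M. \<forall>(V, \<psi>)\<in>atlas M. smooth_on (\<phi> ` (U \<inter> V)) (\<psi> \<circ> inv_into U \<phi>)"
  proof clarify
    fix U \<phi> V \<psi>
    assume charts: "(U, \<phi>) \<in> atlas M" "(V, \<psi>) \<in> atlas M"
    obtain W where W: "U = p ` W" "\<phi> = inv_into W p" "open W" "inj_on p W"
      using charts(1) unfolding atlas_M by blast
    obtain W' where W': "V = p ` W'" "\<psi> = inv_into W' p" "open W'" "inj_on p W'"
      using charts(2) unfolding atlas_M by blast
    have "(inv_into W' p \<circ> p) y = (inv_into W' p \<circ> inv_into (p ` W) (inv_into W p)) y"
      if "y \<in> W \<inter> p -` (p ` W')" for y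
      using inv_chart[OF W(4)] that by (simp del: vimage_eq)
    from smooth_on_cong[OF open_chart_overlap[OF W(3) openin_p_image[OF W'(3)]],
        where f = "inv_into W' p \<circ> p" and g = "inv_into W' p \<circ> inv_into (p ` W) (inv_into W p)", OF this]
    have "smooth_on (W \<inter> p -` (p ` W')) (inv_into W' p \<circ> inv_into (p ` W) (inv_into W p))"
      using smooth_transition[OF W(3,4) W'(3,4)] by blast
    then show "smooth_on (\<phi> ` (U \<inter> V)) (\<psi> \<circ> inv_into U \<phi>)"
      unfolding W(1,2) W' by (simp only: chart_image[OF W(4)])
  qed
qed

text \<open>Charts are local inverses of \<open>p\<close>, so a function read in a chart is its
  composition with \<open>p\<close>. Smoothness on the quotient is henceforth tested on the group,
  without the atlas.\<close>

lemma smooth_fun_on_M: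
  "smooth_fun_on M V f \<longleftrightarrow> openin (topo M) V \<and> smooth_on (p -` V) (\<lambda>x. f (p x))"
proof
  assume f: "smooth_fun_on M V f"
  then have V: "openin (topo M) V" by (simp add: smooth_fun_on_def)
  have "smooth_on (p -` V) (\<lambda>x. f (p x))"
  proof (rule smooth_on_local)
    fix x assume x: "x \<in> p -` V"
    obtain W where W: "open W" "x \<in> W" "inj_on p W" using ex_inj_nbhd by blast
    then have "(p ` W, inv_into W p) \<in> atlas M" by (auto simp: atlas_M)
    then have "smooth_on (W \<inter> p -` V) (f \<circ> inv_into (p ` W) (inv_into W p))"
      using f W by (fastforce simp: smooth_fun_on_def chart_image)
    then have "smooth_on (W \<inter> p -` V) (\<lambda>x. f (p x))"
      using smooth_on_cong[OF open_chart_overlap[OF W(1) V], of "\<lambda>x. f (p x)" "f \<circ> inv_into (p ` W) (inv_into W p)"]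
        inv_chart[OF W(3)] by simp
    then show "\<exists>U. open U \<and> x \<in> U \<and> smooth_on U (\<lambda>x. f (p x))"
      using open_chart_overlap[OF W(1) V] W(2) x by blast
  qed
  then show "openin (topo M) V \<and> smooth_on (p -` V) (\<lambda>x. f (p x))" using V by simp
next
  assume f: "openin (topo M) V \<and> smooth_on (p -` V) (\<lambda>x. f (p x))"
  have "smooth_on (W \<inter> p -` V) (f \<circ> inv_into (p ` W) (inv_into W p))" if W: "open W" "inj_on p W" for W
  proof -
    have "smooth_on (W \<inter> p -` V) (\<lambda>x. f (p x))" using f smooth_on_subset by blast
    then show ?thesis
      using f smooth_on_cong[OF open_chart_overlap[OF W(1)], of V "\<lambda>x. f (p x)" "f \<circ> inv_into (p ` W) (inv_into W p)"]
        inv_chart[OF W(2)] by simp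
  qed
  then show "smooth_fun_on M V f"
    using f by (auto simp: smooth_fun_on_def atlas_M chart_image)
qed

lemma compact_M: "compact_space (topo M)"
proof -
  obtain K where K: "compact K" "\<And>x. \<exists>h\<in>L. h \<odot> x \<in> K" using L_cocompact by blast
  have "range p \<subseteq> p ` K"
    using K(2) p_translate by (metis image_subsetI rev_image_eqI)
  then have "p ` K = points M" by (auto simp: points_M)
  then show ?thesis
    using image_compactin[of euclidean K, OF _ continuous_map_p] K(1)
    by (simp add: compact_space_def)
qed

lemma discrete_L: "subtopology euclidean L = discrete_topology L"
proof -
  obtain e where e: "e > 0" "L \<inter> ball 0 e = {0}" using L_discrete by blast
  have "openin (top_of_set L) {h}" if "h \<in> L" for h
  proof -
    have "x = h" if "x \<in> L" "iv h \<odot> x \<in> ball 0 e" for x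
    proof -
      have "iv h \<odot> x \<in> L \<inter> ball 0 e" using that \<open>h \<in> L\<close> L_mul L_iv by simp
      then have "iv h \<odot> x = 0" using e by simp
      then show ?thesis by (metis iv_mul_cancel(2) mul_0_right)
    qed
    then have "{h} = L \<inter> (\<lambda>x. iv h \<odot> x) -` ball 0 e"
      using e that by auto
    moreover have "open ((\<lambda>x. iv h \<odot> x) -` ball 0 e)"
      by (intro open_vimage continuous_translate open_ball)
    ultimately show ?thesis by (metis openin_open)
  qed
  then show ?thesis
    by (metis discrete_topology_unique topspace_euclidean_subtopology)
qed

lemma compact_nilmanifold_M:
  assumes "nilpotent_group G"
  shows "compact_nilmanifold M"
proof -
  have "lattice_in G S L"
    using subgroup_L discrete_L compact_M by (simp add: lattice_in_def M_def[symmetric]) (simp add: S_def)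
  then show ?thesis
    unfolding compact_nilmanifold_def M_def using lie_group_G assms by blast
qed

end

text \<open>The inner product of \<open>f\<close> with the component of \<open>d u\<close>
  orthogonal to \<open>W\<close> is constantly zero, hence so is its derivative. It shows that
  differentiating the coordinates of a section of a left-invariant distribution stays in the
  distribution.\<close>

lemma has_derivative_in_subspace:
  fixes f :: "'a::real_normed_vector \<Rightarrow> 'b::euclidean_space"
  assumes "(f has_derivative d) (at z)" "subspace W" "\<And>y. f y \<in> W"
  shows "d u \<in> W"
proof -
  obtain y w where yw: "y \<in> span W" "\<And>v. v \<in> span W \<Longrightarrow> orthogonal w v" "d u = y + w"
    using orthogonal_subspace_decomp_exists by blast
  have W: "span W = W" using assms(2) by (simp add: span_eq_iff)
  have "((\<lambda>y. f y \<bullet> w) has_derivative (\<lambda>u. d u \<bullet> w)) (at z)"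
    by (rule has_derivative_inner_left[OF assms(1)])
  moreover have "f y \<bullet> w = 0" for y
    using yw(2)[of "f y"] assms(3)[of y] by (simp add: W orthogonal_def inner_commute[of w])
  ultimately have "(\<lambda>u. d u \<bullet> w) = (\<lambda>u. 0)"
    by simp (metis frechet_derivative_eqI has_derivative_const)
  then have "d u \<bullet> w = 0" by metis
  moreover have "y \<bullet> w = 0" using yw(1) yw(2)[of y] by (simp add: orthogonal_def inner_commute[of w])
  ultimately have "w = 0" using yw(3) by (simp add: inner_left_distrib)
  then show ?thesis using yw W by simp
qed

text \<open>The product rule for the evaluation of a varying functional at a varying vector.
  Differentiability of the family is known only vector by vector, so the proof works in
  coordinates.\<close>

lemma has_derivative_linear_family:
  fixes F :: "'a::real_normed_vector \<Rightarrow> 'c::euclidean_space \<Rightarrow> real"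
  assumes U: "open U" "z \<in> U" and lin: "\<And>y. y \<in> U \<Longrightarrow> linear (F y)"
    and dF: "\<And>v. (\<lambda>y. F y v) differentiable (at z)" and dw: "w differentiable (at z)"
  shows "((\<lambda>y. F y (w y)) has_derivative
    (\<lambda>u. frechet_derivative (\<lambda>y. F y (w z)) (at z) u + F z (frechet_derivative w (at z) u))) (at z)"
proof -
  have rep: "F y v = (\<Sum>b\<in>Basis. (v \<bullet> b) * F y b)" if "y \<in> U" for y v
  proof -
    have "F y v = F y (\<Sum>b\<in>Basis. (v \<bullet> b) *\<^sub>R b)" by (simp add: euclidean_representation)
    then show ?thesis by (simp add: linear_sum[OF lin[OF that]] linear_cmul[OF lin[OF that]])
  qed
  have "((\<lambda>y. \<Sum>b\<in>Basis. (w z \<bullet> b) * F y b) has_derivative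
      (\<lambda>u. \<Sum>b\<in>Basis. (w z \<bullet> b) * frechet_derivative (\<lambda>y. F y b) (at z) u)) (at z)"
    by (intro has_derivative_sum has_derivative_mult_right has_derivative_frechet dF)
  then have "((\<lambda>y. F y (w z)) has_derivative
      (\<lambda>u. \<Sum>b\<in>Basis. (w z \<bullet> b) * frechet_derivative (\<lambda>y. F y b) (at z) u)) (at z)"
    by (rule has_derivative_transform_within_open[OF _ U]) (simp add: rep[symmetric])
  from frechet_derivative_eqI[OF this]
  have 1: "frechet_derivative (\<lambda>y. F y (w z)) (at z) u =
      (\<Sum>b\<in>Basis. (w z \<bullet> b) * frechet_derivative (\<lambda>y. F y b) (at z) u)" for u
    by simp
  have "((\<lambda>y. \<Sum>b\<in>Basis. (w y \<bullet> b) * F y b) has_derivative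
      (\<lambda>u. \<Sum>b\<in>Basis. (w z \<bullet> b) * frechet_derivative (\<lambda>y. F y b) (at z) u
        + (frechet_derivative w (at z) u \<bullet> b) * F z b)) (at z)"
    by (intro has_derivative_sum has_derivative_mult has_derivative_inner_left
        has_derivative_frechet dF dw)
  then have "((\<lambda>y. F y (w y)) has_derivative
      (\<lambda>u. \<Sum>b\<in>Basis. (w z \<bullet> b) * frechet_derivative (\<lambda>y. F y b) (at z) u
        + (frechet_derivative w (at z) u \<bullet> b) * F z b)) (at z)"
    by (rule has_derivative_transform_within_open[OF _ U]) (simp add: rep[symmetric])
  then show ?thesis
    by (simp add: 1 rep[OF U(2), of "frechet_derivative w (at z) _"] sum.distrib)
qed

context lattice_quotient begin

subsection \<open>Left-invariant derivatives\<close>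

text \<open>\<open>D g x u\<close> is the value at \<open>x\<close> of the derivative of \<open>g\<close> along the left-invariant vector
  field with value \<open>u\<close> at the identity \<open>0\<close>, and \<open>A x\<close> is the differential at \<open>0\<close> of the left
  translation by \<open>x\<close>. The derivative is defined without reference to \<open>A\<close>, which makes its
  invariance under left translations evident.\<close>

definition D :: "('e \<Rightarrow> 'b::real_normed_vector) \<Rightarrow> 'e \<Rightarrow> 'e \<Rightarrow> 'b" where
  "D g x u = frechet_derivative (\<lambda>y. g (x \<odot> y)) (at 0) u"

definition A :: "'e \<Rightarrow> 'e \<Rightarrow> 'e" where
  "A x = frechet_derivative (\<lambda>y. x \<odot> y) (at 0)"

definition B :: "'e \<Rightarrow> 'e \<Rightarrow> 'e" where
  "B x = frechet_derivative (\<lambda>y. iv x \<odot> y) (at x)"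

text \<open>The Lie algebra bracket: the commutator at \<open>0\<close> of the left-invariant fields
  with values \<open>A y u\<close> and \<open>A y v\<close> at \<open>y\<close>, where
  \<open>A 0\<close> is the identity.\<close>

definition br :: "'e \<Rightarrow> 'e \<Rightarrow> 'e" where
  "br u v = frechet_derivative (\<lambda>y. A y v) (at 0) u - frechet_derivative (\<lambda>y. A y u) (at 0) v"

lemma has_derivative_translate:
  "((\<lambda>y. x \<odot> y) has_derivative (\<lambda>v. frechet_derivative (\<lambda>(x, y). x \<odot> y) (at (x, z)) (0, v))) (at z)"
proof -
  have 1: "((\<lambda>y. (x, y)) has_derivative (\<lambda>v. (0, v))) (at z)"
    by (auto intro!: derivative_eq_intros)
  have 2: "((\<lambda>(x, y). x \<odot> y) has_derivative frechet_derivative (\<lambda>(x, y). x \<odot> y) (at (x, z))) (at (x, z))"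
    by (rule has_derivative_frechet[OF smooth_on_imp_differentiable[OF smooth_mul UNIV_I]])
  from has_derivative_compose[OF 1 2] show ?thesis by simp
qed

lemma translate_differentiable: "(\<lambda>y. x \<odot> y) differentiable (at z)"
  by (rule differentiableI[OF has_derivative_translate])

lemma A_eq: "A x v = frechet_derivative (\<lambda>(x, y). x \<odot> y) (at (x, 0)) (0, v)"
  using frechet_derivative_eqI[OF has_derivative_translate] by (simp add: A_def)

lemma B_eq: "B x v = frechet_derivative (\<lambda>(x, y). x \<odot> y) (at (iv x, x)) (0, v)"
  using frechet_derivative_eqI[OF has_derivative_translate] by (simp add: B_def)

lemma linear_A: "linear (A x)"
  unfolding A_def by (rule linear_frechet_derivative[OF translate_differentiable])

lemma A_0: "A 0 v = v"
  using frechet_derivative_eqI[OF has_derivative_ident] by (simp add: A_def)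

lemma B_A: "B x (A x u) = u"
proof -
  have 1: "((\<lambda>y. x \<odot> y) has_derivative A x) (at 0)"
    unfolding A_def by (rule has_derivative_frechet[OF translate_differentiable])
  have 2: "((\<lambda>y. iv x \<odot> y) has_derivative B x) (at (x \<odot> 0))"
    unfolding B_def mul_0_right by (rule has_derivative_frechet[OF translate_differentiable])
  from has_derivative_compose[OF 1 2]
  have "((\<lambda>y. y) has_derivative (\<lambda>v. B x (A x v))) (at (0::'e))" by simp
  then have "(\<lambda>v. B x (A x v)) = (\<lambda>v. v)"
    by (metis frechet_derivative_eqI has_derivative_ident)
  then show ?thesis by metis
qed

lemma A_B: "A x (B x w) = w"
proof -
  have 1: "((\<lambda>y. x \<odot> y) has_derivative A x) (at (iv x \<odot> x))"
    unfolding A_def iv_left by (rule has_derivative_frechet[OF translate_differentiable])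
  have 2: "((\<lambda>y. iv x \<odot> y) has_derivative B x) (at x)"
    unfolding B_def by (rule has_derivative_frechet[OF translate_differentiable])
  from has_derivative_compose[OF 2 1]
  have "((\<lambda>y. y) has_derivative (\<lambda>v. A x (B x v))) (at x)" by simp
  then have "(\<lambda>v. A x (B x v)) = (\<lambda>v. v)"
    by (metis frechet_derivative_eqI has_derivative_ident)
  then show ?thesis by metis
qed

lemma smooth_on_A:
  fixes a v :: "'b::real_normed_vector \<Rightarrow> 'e"
  assumes U: "open U" "smooth_on U a" "smooth_on U v"
  shows "smooth_on U (\<lambda>x. A (a x) (v x))"
  unfolding A_eq
  by (rule smooth_on_frechet_derivative_apply[OF U(1) open_UNIV smooth_mul
        smooth_on_Pair[OF U(1,2) smooth_on_const] _ smooth_on_Pair[OF U(1) smooth_on_const U(3)]]) simp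

lemma smooth_on_B:
  fixes a v :: "'b::real_normed_vector \<Rightarrow> 'e"
  assumes U: "open U" "smooth_on U a" "smooth_on U v"
  shows "smooth_on U (\<lambda>x. B (a x) (v x))"
  unfolding B_eq
  by (rule smooth_on_frechet_derivative_apply[OF U(1) open_UNIV smooth_mul
        smooth_on_Pair[OF U(1) smooth_on_iv[OF U(1,2)] U(2)] _ smooth_on_Pair[OF U(1) smooth_on_const U(3)]]) simp

lemma has_derivative_D:
  assumes "g differentiable (at x)"
  shows "((\<lambda>y. g (x \<odot> y)) has_derivative (\<lambda>u. frechet_derivative g (at x) (A x u))) (at 0)"
proof -
  have 1: "((\<lambda>y. x \<odot> y) has_derivative A x) (at 0)"
    unfolding A_def by (rule has_derivative_frechet[OF translate_differentiable])
  have 2: "(g has_derivative frechet_derivative g (at x)) (at (x \<odot> 0))"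
    using has_derivative_frechet[OF assms] by simp
  show ?thesis by (rule has_derivative_compose[OF 1 2])
qed

lemma D_eq: "g differentiable (at x) \<Longrightarrow> D g x u = frechet_derivative g (at x) (A x u)"
  unfolding D_def by (simp add: frechet_derivative_eqI[OF has_derivative_D])

lemma D_works:
  "g differentiable (at x) \<Longrightarrow> ((\<lambda>y. g (x \<odot> y)) has_derivative D g x) (at 0)"
  using has_derivative_D[of g x] frechet_derivative_eqI[OF has_derivative_D, of g x]
  by (simp add: D_def[abs_def])

lemma D_unique:
  "((\<lambda>y. g (x \<odot> y)) has_derivative d) (at 0) \<Longrightarrow> D g x = d"
  unfolding D_def by (simp add: frechet_derivative_eqI)

lemma linear_D: "g differentiable (at x) \<Longrightarrow> linear (D g x)"
  using D_works has_derivative_linear by blast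

lemma D_cong:
  assumes "open U" "x \<in> U" "\<And>y. y \<in> U \<Longrightarrow> f y = g y"
  shows "D f x = D g x"
proof -
  have "frechet_derivative (\<lambda>y. f (x \<odot> y)) (at 0) = frechet_derivative (\<lambda>y. g (x \<odot> y)) (at 0)"
    using assms
    by (intro frechet_derivative_cong_open[of "(\<lambda>y. x \<odot> y) -` U"] open_vimage continuous_translate) auto
  then show ?thesis by (auto simp: D_def)
qed

lemma D_invariant:
  assumes "\<And>y. g (h \<odot> y) = g y"
  shows "D g (h \<odot> x) = D g x"
  by (simp add: D_def[abs_def] mul_assoc assms)

lemma smooth_on_D:
  assumes U: "open U" "smooth_on U g" "smooth_on U v"
  shows "smooth_on U (\<lambda>x. D g x (v x))"
proof -
  have "smooth_on U (\<lambda>x. frechet_derivative g (at x) (A x (v x)))"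
    by (intro smooth_on_frechet_derivative_apply[OF U(1,1,2)] smooth_on_A U smooth_on_ident) auto
  moreover have "D g x (v x) = frechet_derivative g (at x) (A x (v x))" if "x \<in> U" for x
    by (rule D_eq[OF smooth_on_imp_differentiable[OF U(2) that]])
  ultimately show ?thesis
    by (rule smooth_on_cong[OF U(1), THEN iffD2, rotated])
qed

text \<open>The derivative of \<open>y \<mapsto> D g y v\<close> along \<open>u\<close> is the sum of the second derivative of
  \<open>y \<mapsto> g (x \<odot> y)\<close> at \<open>0\<close>, symmetric in \<open>u\<close> and \<open>v\<close>, and of a first-order term coming
  from the derivative of \<open>A\<close>.\<close>

lemma D_commutator:
  fixes g :: "'e \<Rightarrow> real"
  assumes U: "open U" "x \<in> U" "smooth_on U g"
  shows "D (\<lambda>y. D g y v) x u - D (\<lambda>y. D g y u) x v = D g x (br u v)"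
proof -
  define k where "k = (\<lambda>y. g (x \<odot> y))"
  define U' where "U' = (\<lambda>y. x \<odot> y) -` U"
  have U': "open U'" "0 \<in> U'" "smooth_on U' k"
  proof -
    show "open U'" unfolding U'_def by (intro open_vimage U continuous_translate)
    then show "smooth_on U' k" unfolding k_def
      by (intro smooth_on_o[OF _ U(1) _ U(3)] smooth_on_mul smooth_on_const smooth_on_ident)
         (auto simp: U'_def)
  qed (use U in \<open>simp add: U'_def\<close>)
  have dk: "k differentiable (at y)" if "y \<in> U'" for y
    using smooth_on_imp_differentiable[OF U'(3) that] .
  have dAv: "(\<lambda>y. A y v) differentiable (at 0)" for v
    using smooth_on_imp_differentiable[OF smooth_on_A[OF open_UNIV smooth_on_ident smooth_on_const]]
    by simp
  have lin: "linear (frechet_derivative k (at y))" if "y \<in> U'" for y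
    by (rule linear_frechet_derivative[OF dk[OF that]])
  have dfd: "(\<lambda>y. frechet_derivative k (at y) v) differentiable (at 0)" for v
    by (rule smooth_on_imp_differentiable[OF smooth_on_frechet_derivative[OF U'(3)] U'(2)])
  have 1: "D (\<lambda>y. D g y v) x u = frechet_derivative (\<lambda>y. frechet_derivative k (at y) v) (at 0) u
      + frechet_derivative k (at 0) (frechet_derivative (\<lambda>y. A y v) (at 0) u)" for u v
  proof -
    \<comment> \<open>As \<open>D\<close> translates before differentiating, associativity rewrites
      \<open>D g (x \<odot> y)\<close> in terms of \<open>k\<close> near \<open>0\<close>.\<close>
    have "D g (x \<odot> y) v = frechet_derivative k (at y) (A y v)" if "y \<in> U'" for y
      using D_eq[OF dk[OF that], of v] by (simp add: D_def mul_assoc k_def)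
    then have "D (\<lambda>y. D g y v) x u = frechet_derivative (\<lambda>y. frechet_derivative k (at y) (A y v)) (at 0) u"
      unfolding D_def[of "\<lambda>y. D g y v"]
      using frechet_derivative_cong_open[OF U'(1,2), of "\<lambda>y. D g (x \<odot> y) v"
          "\<lambda>y. frechet_derivative k (at y) (A y v)"]
      by simp
    also have "\<dots> = frechet_derivative (\<lambda>y. frechet_derivative k (at y) (A 0 v)) (at 0) u
      + frechet_derivative k (at 0) (frechet_derivative (\<lambda>y. A y v) (at 0) u)"
      using frechet_derivative_eqI[OF has_derivative_linear_family[OF U'(1,2),
            of "\<lambda>y. frechet_derivative k (at y)" "\<lambda>y. A y v", OF lin dfd dAv]]
      by (rule fun_cong)
    finally show ?thesis by (simp add: A_0)
  qed
  have "D (\<lambda>y. D g y v) x u - D (\<lambda>y. D g y u) x v = frechet_derivative k (at 0) (br u v)"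
    unfolding 1 br_def smooth_on_second_derivative_symmetric[OF U'(1,3,2), of v u]
    by (simp add: linear_diff[OF linear_frechet_derivative[OF dk[OF U'(2)]]])
  then show ?thesis by (simp add: k_def D_def)
qed

lemma D_linear_family:
  fixes g :: "'e \<Rightarrow> real"
  assumes U: "open U" "x \<in> U" "smooth_on U g" "smooth_on U w"
  shows "D (\<lambda>y. D g y (w y)) x u = D (\<lambda>y. D g y (w x)) x u + D g x (D w x u)"
proof -
  have lin: "linear (D g y)" if "y \<in> U" for y
    using linear_D smooth_on_imp_differentiable[OF U(3) that] by blast
  have dD: "(\<lambda>y. D g y (v y)) differentiable (at x)" if "smooth_on U v" for v
    using smooth_on_imp_differentiable[OF smooth_on_D[OF U(1,3) that] U(2)] .
  have dw: "w differentiable (at x)" using smooth_on_imp_differentiable[OF U(4,2)] .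
  have "frechet_derivative (\<lambda>y. D g y (w y)) (at x) (A x u) =
     frechet_derivative (\<lambda>y. D g y (w x)) (at x) (A x u) + D g x (frechet_derivative w (at x) (A x u))"
    using frechet_derivative_eqI[OF has_derivative_linear_family[OF U(1,2),
          of "D g" w, OF lin dD[OF smooth_on_const] dw]]
    by (rule fun_cong)
  then show ?thesis
    unfolding D_eq[OF dD[OF U(4)]] D_eq[OF dD[OF smooth_on_const]] D_eq[OF dw] .
qed

subsection \<open>The tangent spaces of the quotient\<close>

text \<open>The set \<open>U\<close> need not be a union of cosets. But the composition of
  \<open>f\<close> with \<open>p\<close> is invariant under \<open>L\<close>, so its smoothness
  spreads from \<open>U\<close> to all translates of \<open>U\<close>, which together form a
  saturated open set.\<close>

lemma smooth_near_iff:
  "smooth_near M (p x) f \<longleftrightarrow> (\<exists>U. open U \<and> x \<in> U \<and> smooth_on U (\<lambda>y. f (p y)))"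
proof
  assume "smooth_near M (p x) f"
  then obtain V where "p x \<in> V" "openin (topo M) V" "smooth_on (p -` V) (\<lambda>y. f (p y))"
    by (auto simp: smooth_near_def smooth_fun_on_M)
  then show "\<exists>U. open U \<and> x \<in> U \<and> smooth_on U (\<lambda>y. f (p y))"
    by (intro exI[of _ "p -` V"]) (auto simp: openin_M)
next
  assume "\<exists>U. open U \<and> x \<in> U \<and> smooth_on U (\<lambda>y. f (p y))"
  then obtain U where U: "open U" "x \<in> U" "smooth_on U (\<lambda>y. f (p y))" by blast
  have "smooth_on (p -` (p ` U)) (\<lambda>y. f (p y))"
  proof (rule smooth_on_local)
    fix y assume "y \<in> p -` (p ` U)"
    then obtain h z where h: "h \<in> L" "z \<in> U" "z = h \<odot> y"
      by (metis imageE p_eqE vimageE)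
    define U' where "U' = (\<lambda>y. h \<odot> y) -` U"
    have U': "open U'" unfolding U'_def by (intro open_vimage U continuous_translate)
    have "smooth_on U' (\<lambda>y. f (p (h \<odot> y)))"
      by (rule smooth_on_o[OF U' U(1) _ U(3)])
         (auto simp: U'_def intro!: smooth_on_mul smooth_on_const smooth_on_ident U'[unfolded U'_def])
    then show "\<exists>U. open U \<and> y \<in> U \<and> smooth_on U (\<lambda>y. f (p y))"
      using U' h by (intro exI[of _ U']) (simp add: p_translate[OF h(1)] U'_def)
  qed
  then show "smooth_near M (p x) f"
    using U openin_p_image by (auto simp: smooth_near_def smooth_fun_on_M)
qed

text \<open>Left-invariant fields on the group are preserved by left translations by
  \<open>L\<close>, hence descend to a global frame of the quotient; \<open>T q u\<close> is its
  member \<open>u\<close> at \<open>q\<close>. The choice of representative is immaterial by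
  \<open>T_p\<close>, and the value \<open>0\<close> on the remaining functions is the one that
  \<open>tangent_space\<close> prescribes.\<close>

definition T :: "'e set \<Rightarrow> 'e \<Rightarrow> 'e set tangent" where
  "T q u f = (if smooth_near M q f then D (\<lambda>x. f (p x)) (SOME x. p x = q) u else 0)"

lemma T_p: "T (p x) u f = (if smooth_near M (p x) f then D (\<lambda>x. f (p x)) x u else 0)"
proof -
  have "p (SOME y. p y = p x) = p x" by (rule someI) simp
  then obtain h where h: "h \<in> L" "(SOME y. p y = p x) = h \<odot> x" by (rule p_eqE)
  show ?thesis
    unfolding T_def h(2) by (subst D_invariant) (simp_all add: p_translate[OF h(1)])
qed

lemma smooth_near_imp_differentiable:
  "smooth_near M (p x) f \<Longrightarrow> (\<lambda>y. f (p y)) differentiable (at x)"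
  using smooth_on_imp_differentiable by (auto simp: smooth_near_iff)

lemma linear_T: "linear (T (p x))"
  using linear_D[OF smooth_near_imp_differentiable, of x]
  by (intro linearI ext) (auto simp: T_p plus_fun_def scaleR_fun_def linear_add linear_cmul)

lemma smooth_near_const: "smooth_near M (p x) (\<lambda>q. c)"
  using smooth_on_const[of UNIV] by (auto simp: smooth_near_iff)

lemma smooth_near_binop:
  assumes "smooth_near M (p x) f" "smooth_near M (p x) g"
  shows "smooth_near M (p x) (\<lambda>q. f q + g q)" "smooth_near M (p x) (\<lambda>q. f q * g q)"
proof -
  obtain U V where UV: "open U" "x \<in> U" "smooth_on U (\<lambda>y. f (p y))" "open V" "x \<in> V"
    "smooth_on V (\<lambda>y. g (p y))" using assms by (auto simp: smooth_near_iff)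
  have *: "open (U \<inter> V)" "x \<in> U \<inter> V" "smooth_on (U \<inter> V) (\<lambda>y. f (p y))" "smooth_on (U \<inter> V) (\<lambda>y. g (p y))"
    using UV by (auto intro: smooth_on_subset)
  then show "smooth_near M (p x) (\<lambda>q. f q + g q)" "smooth_near M (p x) (\<lambda>q. f q * g q)"
    unfolding smooth_near_iff using smooth_on_add[OF *(1,3,4)] smooth_on_mult[OF *(1,3,4)] by blast+
qed

lemma smooth_near_sum:
  "(\<And>i. i \<in> I \<Longrightarrow> smooth_near M (p x) (f i)) \<Longrightarrow> smooth_near M (p x) (\<lambda>q. \<Sum>i\<in>I. f i q)"
  by (induction I rule: infinite_finite_induct) (auto intro: smooth_near_const smooth_near_binop)

lemma T_in_tangent_space: "T (p x) u \<in> tangent_space M (p x)"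
proof -
  have "T (p x) u (\<lambda>y. f y + g y) = T (p x) u f + T (p x) u g"
    "T (p x) u (\<lambda>y. f y * g y) = f (p x) * T (p x) u g + g (p x) * T (p x) u f"
    if "smooth_near M (p x) f" "smooth_near M (p x) g" for f g
  proof -
    note d = that[THEN smooth_near_imp_differentiable, THEN D_works]
    show "T (p x) u (\<lambda>y. f y + g y) = T (p x) u f + T (p x) u g"
      using D_unique[OF has_derivative_add[OF d]] smooth_near_binop[OF that] that by (simp add: T_p)
    show "T (p x) u (\<lambda>y. f y * g y) = f (p x) * T (p x) u g + g (p x) * T (p x) u f"
      using D_unique[OF has_derivative_mult[OF d]] smooth_near_binop[OF that] that by (simp add: T_p)
  qed
  moreover have "T (p x) u (\<lambda>y. c * f y) = c * T (p x) u f" if f: "smooth_near M (p x) f" for c f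
    using D_unique[OF has_derivative_mult_right[OF D_works[OF smooth_near_imp_differentiable[OF f]], of c]]
      smooth_near_binop(2)[OF smooth_near_const f, of c] f by (simp add: T_p)
  ultimately show ?thesis
    by (simp add: tangent_space_def) (simp add: T_p)
qed

text \<open>Turns a function on a sheet \<open>W\<close> into one on the whole quotient. Its values
  outside the image of \<open>W\<close> are arbitrary, which is harmless because only germs at
  points of that image are used.\<close>

definition lift :: "'e set \<Rightarrow> ('e \<Rightarrow> real) \<Rightarrow> 'e set \<Rightarrow> real" where
  "lift W g q = g (inv_into W p q)"

lemma lift_p: "inj_on p W \<Longrightarrow> y \<in> W \<Longrightarrow> lift W g (p y) = g y"
  by (simp add: lift_def)

lemma smooth_near_lift:
  assumes "open W" "inj_on p W" "smooth_on W g" "x \<in> W"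
  shows "smooth_near M (p x) (lift W g)"
  using smooth_on_cong[OF assms(1), of "\<lambda>y. lift W g (p y)" g] assms lift_p[OF assms(2)]
  by (auto simp: smooth_near_iff)

lemma T_lift:
  assumes "open W" "inj_on p W" "smooth_on W g" "x \<in> W"
  shows "T (p x) u (lift W g) = D g x u"
  using D_cong[OF assms(1,4), of "\<lambda>y. lift W g (p y)" g] lift_p[OF assms(2)] smooth_near_lift[OF assms]
  by (simp add: T_p)

lemma T_coordinate:
  assumes "open W" "inj_on p W" "x \<in> W"
  shows "T (p x) u (lift W (\<lambda>y. y \<bullet> b)) = A x u \<bullet> b"
proof -
  have "((\<lambda>y. (x \<odot> y) \<bullet> b) has_derivative (\<lambda>u. A x u \<bullet> b)) (at 0)"
    unfolding A_def
    by (rule has_derivative_inner_left[OF has_derivative_frechet[OF translate_differentiable]])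
  from D_unique[of "\<lambda>y. y \<bullet> b", OF this] show ?thesis
    by (simp add: T_lift[OF assms(1,2) smooth_on_inner_const[OF assms(1) smooth_on_ident] assms(3)])
qed

lemma inj_T: "inj (T (p x))"
proof (rule injI)
  fix u v assume *: "T (p x) u = T (p x) v"
  obtain W where W: "open W" "x \<in> W" "inj_on p W" using ex_inj_nbhd by blast
  have "A x u \<bullet> b = A x v \<bullet> b" for b
    using T_coordinate[OF W(1,3,2), of u b] T_coordinate[OF W(1,3,2), of v b] * by simp
  then have "A x u = A x v" using euclidean_eqI by blast
  then have "B x (A x u) = B x (A x v)" by (rule arg_cong)
  then show "u = v" by (simp only: B_A)
qed

text \<open>A derivation kills constants and only depends on germs, so by Hadamard's lemma it is determined
  by its values on the coordinate functions of a chart.\<close>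

lemma tangent_space_M: "tangent_space M (p x) = range (T (p x))"
proof
  show "range (T (p x)) \<subseteq> tangent_space M (p x)" using T_in_tangent_space by blast
  show "tangent_space M (p x) \<subseteq> range (T (p x))"
  proof
    fix v assume v: "v \<in> tangent_space M (p x)"
    let ?sn = "smooth_near M (p x)"
    have v_add: "v (\<lambda>y. f y + g y) = v f + v g" if "?sn f" "?sn g" for f g
      using v that by (auto simp: tangent_space_def)
    have v_mult: "v (\<lambda>y. f y * g y) = f (p x) * v g + g (p x) * v f" if "?sn f" "?sn g" for f g
      using v that by (auto simp: tangent_space_def)
    have v_cmult: "v (\<lambda>y. c * f y) = c * v f" if "?sn f" for c f
      using v that by (auto simp: tangent_space_def)
    have v_nonsmooth: "v f = 0" if "\<not> ?sn f" for f
      using v that by (auto simp: tangent_space_def)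
    \<comment> \<open>The product rule gives \<open>v i = 2 * v i\<close>. This handles both the
      constant \<open>1\<close> and the indicator of a neighbourhood.\<close>
    have v_idem: "v i = 0" if "?sn i" "i (p x) = 1" "\<And>y. i y * i y = i y" for i
      using v_mult[OF that(1,1)] that by simp
    have v_const: "v (\<lambda>q. c) = 0" for c
      using v_cmult[OF smooth_near_const, of c 1] v_idem[of "\<lambda>q. 1"] smooth_near_const by simp
    have v_sum: "v (\<lambda>q. \<Sum>i\<in>I. f i q) = (\<Sum>i\<in>I. v (f i))" if "finite I" "\<And>i. i \<in> I \<Longrightarrow> ?sn (f i)"
      for I :: "'e set" and f
      using that by (induction I rule: finite_induct) (simp_all add: v_const v_add smooth_near_sum)
    obtain W where W: "open W" "x \<in> W" "inj_on p W" using ex_inj_nbhd by blast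
    \<comment> \<open>Coordinates centred at \<open>x\<close>: they vanish at \<open>p x\<close>, so
      in the product rule for \<open>c b\<close> times a function only the term with
      \<open>v (c b)\<close> survives.\<close>
    define c where "c = (\<lambda>b. lift W (\<lambda>y. (y - x) \<bullet> b))"
    have c: "?sn (c b)" "c b (p x) = 0" for b
      unfolding c_def using W
      by (auto simp: lift_p intro!: smooth_near_lift smooth_on_inner_const smooth_on_diff
          smooth_on_ident smooth_on_const)
    define w where "w = (\<Sum>b\<in>Basis. v (c b) *\<^sub>R b)"
    have "v f = T (p x) (B x w) f" for f
    proof (cases "?sn f")
      case True
      then obtain U where U: "open U" "x \<in> U" "smooth_on U (\<lambda>y. f (p y))"
        by (auto simp: smooth_near_iff)
      then obtain e where e: "0 < e" "ball x e \<subseteq> U \<inter> W"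
        using W open_contains_ball[of "U \<inter> W"] by (metis IntI open_Int)
      define V where "V = ball x e"
      have V: "open V" "x \<in> V" "V \<subseteq> W" "inj_on p V" "smooth_on V (\<lambda>y. f (p y))"
        using e W U by (auto simp: V_def intro: inj_on_subset smooth_on_subset)
      obtain g where g: "\<And>b. smooth_on V (g b)"
        "\<And>y. y \<in> V \<Longrightarrow> f (p y) = f (p x) + (\<Sum>b\<in>Basis. ((y - x) \<bullet> b) * g b y)"
        "\<And>b. g b x = frechet_derivative (\<lambda>y. f (p y)) (at x) b"
        by (rule hadamard[OF V(5)[unfolded V_def], folded V_def]) (rule that)
      define i where "i = (\<lambda>q. if q \<in> p ` V then 1 else 0 :: real)"
      have i: "?sn i" "i (p x) = 1" "\<And>q. i q * i q = i q" "v i = 0"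
      proof -
        have "smooth_on V (\<lambda>y. i (p y)) \<longleftrightarrow> smooth_on V (\<lambda>y. 1 :: real)"
          by (rule smooth_on_cong[OF V(1)]) (simp add: i_def)
        then show "?sn i" using V smooth_on_const unfolding smooth_near_iff by blast
        then show "v i = 0" using V(2) by (intro v_idem) (auto simp: i_def)
      qed (use V in \<open>auto simp: i_def\<close>)
      define F where "F = (\<lambda>q. \<Sum>b\<in>Basis. c b q * lift V (g b) q)"
      have G: "?sn (lift V (g b))" for b by (rule smooth_near_lift[OF V(1,4) g(1) V(2)])
      have snF: "?sn F" unfolding F_def by (intro smooth_near_sum smooth_near_binop c G)
      \<comment> \<open>Hadamard's expansion holds only on the image of \<open>V\<close>.
        Multiplication by the indicator \<open>i\<close> makes it an identity of functions on the
        whole quotient, and \<open>v\<close> does not see the factor \<open>i\<close>.\<close>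
      have "f q * i q = (f (p x) + F q) * i q" for q
        using g(2) V(3,4) W(3) by (auto simp: i_def F_def c_def lift_p subset_iff)
      then have "v (\<lambda>q. f q * i q) = v (\<lambda>q. (f (p x) + F q) * i q)" by presburger
      then have "v f = v (\<lambda>q. f (p x) + F q)"
        using v_mult[OF True i(1)] v_mult[OF smooth_near_binop(1)[OF smooth_near_const snF] i(1)] i
        by simp
      also have "\<dots> = v F" using v_add[OF smooth_near_const snF] by (simp add: v_const)
      also have "\<dots> = (\<Sum>b\<in>Basis. v (\<lambda>q. c b q * lift V (g b) q))"
        unfolding F_def by (rule v_sum) (auto intro: smooth_near_binop c G)
      also have "\<dots> = (\<Sum>b\<in>Basis. v (c b) * frechet_derivative (\<lambda>y. f (p y)) (at x) b)"
        by (intro sum.cong refl) (simp add: v_mult[OF c(1) G] c(2) lift_p[OF V(4,2)] g(3))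
      also have "\<dots> = frechet_derivative (\<lambda>y. f (p y)) (at x) w"
        unfolding w_def
        using linear_frechet_derivative[OF smooth_near_imp_differentiable[OF True]]
        by (simp add: linear_sum linear_cmul)
      also have "\<dots> = T (p x) (B x w) f"
        using True D_eq[OF smooth_near_imp_differentiable[OF True]] by (simp add: T_p A_B)
      finally show ?thesis .
    qed (simp add: v_nonsmooth T_p)
    then show "v \<in> range (T (p x))" by blast
  qed
qed

subsection \<open>Vector fields on the quotient\<close>

text \<open>The coordinates of a vector field in the frame of left-invariant vector fields, as a function
  on the group.\<close>

definition C :: "('e set \<Rightarrow> 'e set tangent) \<Rightarrow> 'e \<Rightarrow> 'e" where
  "C X x = inv_into UNIV (T (p x)) (X (p x))"

lemma inv_T_T [simp]: "inv_into UNIV (T (p x)) (T (p x) u) = u"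
  by (rule inv_f_f[OF inj_T])

lemma T_inv_T: "v \<in> tangent_space M (p x) \<Longrightarrow> T (p x) (inv_into UNIV (T (p x)) v) = v"
  unfolding tangent_space_M by (rule f_inv_into_f)

lemma vector_field_T_C: "vector_field M X \<Longrightarrow> X (p x) = T (p x) (C X x)"
  unfolding C_def by (subst T_inv_T) (auto simp: vector_field_def points_M)

lemma smooth_fun_on_near:
  assumes "openin (topo M) V" "\<And>y. p y \<in> V \<Longrightarrow> smooth_near M (p y) f"
  shows "smooth_fun_on M V f"
  using assms by (auto simp: smooth_fun_on_M smooth_near_iff intro!: smooth_on_local)

text \<open>Applying \<open>X\<close> to the coordinate functions of a sheet shows that
  \<open>A y (C X y)\<close> is smooth, and \<open>B\<close> removes \<open>A\<close>
  smoothly.\<close>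

lemma smooth_on_C:
  assumes X: "vector_field M X"
  shows "smooth_on UNIV (C X)"
proof (rule smooth_on_local)
  fix x
  obtain W where W: "open W" "x \<in> W" "inj_on p W" using ex_inj_nbhd by blast
  have "smooth_on W (\<lambda>y. A y (C X y))"
  proof (rule smooth_on_componentwise[OF W(1)])
    fix b :: 'e assume "b \<in> Basis"
    let ?c = "lift W (\<lambda>y. y \<bullet> b)"
    have "smooth_fun_on M (p ` W) ?c"
      using smooth_near_lift[OF W(1,3) smooth_on_inner_const[OF W(1) smooth_on_ident]]
      by (intro smooth_fun_on_near openin_p_image W) auto
    then have "smooth_fun_on M (p ` W) (\<lambda>q. X q ?c)"
      using X by (simp add: vector_field_def)
    then have "smooth_on W (\<lambda>y. X (p y) ?c)"
      by (auto simp: smooth_fun_on_M intro: smooth_on_subset)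
    moreover have "X (p y) ?c = A y (C X y) \<bullet> b" if "y \<in> W" for y
      using T_coordinate[OF W(1,3) that] vector_field_T_C[OF X, of y] by simp
    ultimately show "smooth_on W (\<lambda>y. A y (C X y) \<bullet> b)"
      by (rule smooth_on_cong[OF W(1), THEN iffD1, rotated])
  qed
  from smooth_on_B[OF W(1) smooth_on_ident this]
  show "\<exists>U. open U \<and> x \<in> U \<and> smooth_on U (C X)"
    using W by (auto simp: B_A)
qed

lemma smooth_on_T:
  assumes "open U" "smooth_on U (\<lambda>y. f (p y))" "smooth_on U \<xi>"
    and X: "\<And>x. X (p x) = T (p x) (\<xi> x)"
  shows "smooth_on U (\<lambda>y. X (p y) f)"
proof -
  have "X (p y) f = D (\<lambda>y. f (p y)) y (\<xi> y)" if "y \<in> U" for y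
  proof -
    have "smooth_near M (p y) f" using assms(1,2) that smooth_near_iff by blast
    then show ?thesis by (simp add: X T_p)
  qed
  then show ?thesis
    using smooth_on_D[OF assms(1-3)] by (rule smooth_on_cong[OF assms(1), THEN iffD2])
qed

text \<open>The second hypothesis contains the invariance of \<open>\<xi>\<close> under
  \<open>L\<close>, because each \<open>T (p x)\<close> is injective and depends on the coset
  only.\<close>

lemma vector_fieldI:
  assumes \<xi>: "smooth_on UNIV \<xi>" and X: "\<And>x. X (p x) = T (p x) (\<xi> x)"
  shows "vector_field M X"
  unfolding vector_field_def
proof (intro conjI ballI allI impI)
  show "X q \<in> tangent_space M q" if "q \<in> points M" for q
    using that T_in_tangent_space by (auto simp: points_M X)
  fix V f assume "smooth_fun_on M V f"
  then have V: "openin (topo M) V" "smooth_on (p -` V) (\<lambda>y. f (p y))"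
    by (simp_all add: smooth_fun_on_M)
  have "smooth_on (p -` V) (\<lambda>y. X (p y) f)"
    using V by (intro smooth_on_T[OF _ _ _ X] smooth_on_subset[OF \<xi>]) (auto simp: openin_M)
  then show "smooth_fun_on M V (\<lambda>q. X q f)" using V by (simp add: smooth_fun_on_M)
qed

lemma vector_field_apply:
  assumes "vector_field M X" "smooth_near M (p x) f"
  shows "X (p x) f = D (\<lambda>y. f (p y)) x (C X x)"
  using assms by (subst vector_field_T_C) (simp_all add: T_p)

lemma vector_field_const: "vector_field M (\<lambda>q. T q u)" "C (\<lambda>q. T q u) x = u"
  by (rule vector_fieldI[OF smooth_on_const]) (simp_all add: C_def)

lemma C_differentiable: "vector_field M X \<Longrightarrow> C X differentiable (at x)"
  by (rule smooth_on_imp_differentiable[OF smooth_on_C UNIV_I])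

text \<open>\<open>D_linear_family\<close> splits \<open>X (Y f)\<close> into a second-order part
  with the coefficients of \<open>Y\<close> frozen at \<open>x\<close> and a first-order part that
  differentiates them. By \<open>D_commutator\<close> the antisymmetrised second-order part is the
  derivative along \<open>br\<close>.\<close>

lemma lie_bracket_M:
  assumes X: "vector_field M X" and Y: "vector_field M Y"
  shows "lie_bracket M X Y (p x) =
    T (p x) (D (C Y) x (C X x) - D (C X) x (C Y x) + br (C X x) (C Y x))"
proof
  fix f
  show "lie_bracket M X Y (p x) f =
    T (p x) (D (C Y) x (C X x) - D (C X) x (C Y x) + br (C X x) (C Y x)) f"
  proof (cases "smooth_near M (p x) f")
    case True
    then obtain U where U: "open U" "x \<in> U" "smooth_on U (\<lambda>y. f (p y))"
      by (auto simp: smooth_near_iff)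
    define h where "h = (\<lambda>y. f (p y))"
    note h = U(3)[folded h_def]
    have sn: "smooth_near M (p y) f" if "y \<in> U" for y
      using U that smooth_near_iff by blast
    have sC: "smooth_on U (C X)" if "vector_field M X" for X
      using smooth_on_C[OF that] smooth_on_subset by blast
    have 1: "X (p x) (\<lambda>q. Y q f) = D (\<lambda>y. D h y (C Y x)) x (C X x) + D h x (D (C Y) x (C X x))"
      if X: "vector_field M X" and Y: "vector_field M Y" for X Y
    proof -
      have "smooth_on U (\<lambda>y. Y (p y) f)"
        by (rule smooth_on_T[OF U(1,3) sC[OF Y] vector_field_T_C[OF Y]])
      then have "smooth_near M (p x) (\<lambda>q. Y q f)"
        using U smooth_near_iff by blast
      then have "X (p x) (\<lambda>q. Y q f) = D (\<lambda>y. Y (p y) f) x (C X x)"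
        by (rule vector_field_apply[OF X])
      also have "\<dots> = D (\<lambda>y. D h y (C Y y)) x (C X x)"
        by (subst D_cong[OF U(1,2)]) (simp_all add: vector_field_apply[OF Y sn] h_def)
      also have "\<dots> = D (\<lambda>y. D h y (C Y x)) x (C X x) + D h x (D (C Y) x (C X x))"
        by (rule D_linear_family[OF U(1,2) h sC[OF Y]])
      finally show ?thesis .
    qed
    have "lie_bracket M X Y (p x) f = D h x (br (C X x) (C Y x))
        + D h x (D (C Y) x (C X x)) - D h x (D (C X) x (C Y x))"
      using True 1[OF X Y] 1[OF Y X] D_commutator[OF U(1,2) h, of "C Y x" "C X x"]
      by (simp add: lie_bracket_def)
    also have "\<dots> = D h x (D (C Y) x (C X x) - D (C X) x (C Y x) + br (C X x) (C Y x))"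
      using linear_D[OF smooth_on_imp_differentiable[OF h U(2)]]
      by (simp add: linear_add linear_diff)
    also have "\<dots> = T (p x) (D (C Y) x (C X x) - D (C X) x (C Y x) + br (C X x) (C Y x)) f"
      using True by (simp add: T_p h_def)
    finally show ?thesis .
  qed (simp add: lie_bracket_def T_p)
qed

text \<open>The fragment of bilinearity of \<open>br\<close> on which the \<open>J\<close>-stability
  of the image of the Nijenhuis tensor rests.\<close>

lemma br_minus_right: "br u (- v) = - br u v"
proof -
  have d: "(\<lambda>y. A y v) differentiable (at 0)"
    using smooth_on_imp_differentiable[OF smooth_on_A[OF open_UNIV smooth_on_ident smooth_on_const]]
    by simp
  have "frechet_derivative (\<lambda>y. A y (- v)) (at 0) = (\<lambda>u. - frechet_derivative (\<lambda>y. A y v) (at 0) u)"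
    using frechet_derivative_eqI[OF has_derivative_minus[OF has_derivative_frechet[OF d]]]
    by (simp add: linear_neg[OF linear_A])
  moreover have "frechet_derivative (\<lambda>y. A y u) (at 0) (- v) = - frechet_derivative (\<lambda>y. A y u) (at 0) v"
    by (rule linear_neg[OF linear_frechet_derivative[OF smooth_on_imp_differentiable[OF
        smooth_on_A[OF open_UNIV smooth_on_ident smooth_on_const]]]]) simp
  ultimately show ?thesis by (simp add: br_def)
qed

lemma br_antisym: "br v u = - br u v"
  by (simp add: br_def)

text \<open>Fields with values in \<open>Ds\<close> have coordinates in the fixed subspace
  \<open>W\<close>, and so do the derivatives of these coordinates; only the \<open>br\<close> term
  of the bracket can leave \<open>W\<close>. Fields with constant coordinates give the
  converse.\<close>

lemma involutive_T_iff:
  assumes Ds: "\<And>x. Ds (p x) = T (p x) ` W" and W: "subspace W"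
  shows "involutive M Ds \<longleftrightarrow> (\<forall>u\<in>W. \<forall>v\<in>W. br u v \<in> W)"
proof
  assume inv: "involutive M Ds"
  show "\<forall>u\<in>W. \<forall>v\<in>W. br u v \<in> W"
  proof (intro ballI)
    fix u v assume uv: "u \<in> W" "v \<in> W"
    have "lie_bracket M (\<lambda>q. T q u) (\<lambda>q. T q v) (p 0) \<in> Ds (p 0)"
      using inv uv vector_field_const unfolding involutive_def points_M by (force simp: Ds)
    moreover have "lie_bracket M (\<lambda>q. T q u) (\<lambda>q. T q v) (p 0) = T (p 0) (br u v)"
      using lie_bracket_M[OF vector_field_const(1) vector_field_const(1), of u v 0]
      by (simp add: D_unique[OF has_derivative_const] vector_field_const(2) C_def[abs_def])
    ultimately show "br u v \<in> W"
      using inj_T[of 0] by (auto simp: Ds inj_def)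
  qed
next
  assume br: "\<forall>u\<in>W. \<forall>v\<in>W. br u v \<in> W"
  have "lie_bracket M X Y (p x) \<in> Ds (p x)"
    if XY: "vector_field M X" "vector_field M Y" "\<forall>x\<in>points M. X x \<in> Ds x" "\<forall>x\<in>points M. Y x \<in> Ds x"
    for X Y x
  proof -
    have CW: "C Z y \<in> W" if "\<forall>x\<in>points M. Z x \<in> Ds x" for Z y
    proof -
      have "Z (p y) \<in> T (p y) ` W" using that by (simp add: points_M Ds)
      then show ?thesis by (auto simp: C_def)
    qed
    have "D (C Z) x u \<in> W" if "vector_field M Z" "\<And>y. C Z y \<in> W" for Z u
      by (rule has_derivative_in_subspace[OF D_works[OF C_differentiable[OF that(1)]] W that(2)])
    then have "D (C Y) x (C X x) - D (C X) x (C Y x) + br (C X x) (C Y x) \<in> W"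
      using br CW XY W by (intro subspace_add subspace_diff) auto
    then show ?thesis by (simp add: lie_bracket_M XY Ds)
  qed
  then show "involutive M Ds" by (auto simp: involutive_def points_M)
qed

text \<open>Tangent vectors live in a function space and not in a Euclidean one, so the dimension is
  transported through an explicit basis.\<close>

lemma dim_T_image:
  assumes "subspace W"
  shows "dim (T (p x) ` W) = dim W"
proof -
  obtain B where B: "B \<subseteq> W" "independent B" "W \<subseteq> span B" "card B = dim W"
    using basis_exists by blast
  have ind: "independent (T (p x) ` B)"
    using linear_independent_injective_image[OF linear_T B(2)] inj_T inj_on_subset by blast
  have "span B = W" using B assms by (metis span_eq_iff span_mono subset_antisym)
  then have "span (T (p x) ` B) = T (p x) ` W"
    by (simp add: linear_span_image[OF linear_T])
  then have "dim (T (p x) ` W) = card (T (p x) ` B)"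
    using ind by (metis dim_span dim_eq_card)
  also have "\<dots> = dim W"
    using B(4) card_image[OF inj_on_subset[OF inj_T subset_UNIV]] by metis
  finally show ?thesis .
qed

end

subsection \<open>Left-invariant almost Kaehler structures\<close>

text \<open>The form is omega(u, v) = \<open>J u \<bullet> v\<close>, with the standard inner
  product as associated metric; \<open>closed\<close> is the vanishing of d omega on left-invariant
  fields.\<close>

locale almost_kaehler_quotient = lattice_quotient +
  fixes J :: "'a \<Rightarrow> 'a"
  assumes linear_J: "linear J" and J_J: "J (J u) = - u" and J_inner: "J u \<bullet> J v = u \<bullet> v"
    and closed: "J (br u v) \<bullet> w + J (br v w) \<bullet> u + J (br w u) \<bullet> v = 0"
begin

definition JM :: "'a set \<Rightarrow> 'a set tangent \<Rightarrow> 'a set tangent" where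
  "JM q v = T q (J (inv_into UNIV (T q) v))"

definition \<omega>M :: "'a set \<Rightarrow> 'a set tangent \<Rightarrow> 'a set tangent \<Rightarrow> real" where
  "\<omega>M q v w = J (inv_into UNIV (T q) v) \<bullet> inv_into UNIV (T q) w"

definition N0 :: "'a \<Rightarrow> 'a \<Rightarrow> 'a" where
  "N0 u v = br (J u) (J v) - J (br (J u) v) - J (br u (J v)) - br u v"

definition NN :: "'a set" where
  "NN = span {N0 u v | u v. True}"

lemmas J_simps = linear_add[OF linear_J] linear_diff[OF linear_J] linear_neg[OF linear_J]
  linear_cmul[OF linear_J] linear_0[OF linear_J] J_J

lemma J_skew: "J u \<bullet> v = - (u \<bullet> J v)"
  using J_inner[of u "J v"] by (simp add: J_J)

lemma J_antisym: "J u \<bullet> v = - (J v \<bullet> u)"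
  using J_skew[of u v] by (simp add: inner_commute)

lemma J_eq_0_iff: "J u = 0 \<longleftrightarrow> u = 0"
  by (metis J_J linear_0 linear_J neg_equal_0_iff_equal)

lemma JM_T [simp]: "JM (p x) (T (p x) u) = T (p x) (J u)"
  by (simp add: JM_def)

lemma \<omega>M_T [simp]: "\<omega>M (p x) (T (p x) u) (T (p x) v) = J u \<bullet> v"
  by (simp add: \<omega>M_def)

lemmas T_simps = linear_add[OF linear_T] linear_diff[OF linear_T] linear_neg[OF linear_T]
  linear_cmul[OF linear_T] linear_0[OF linear_T]

lemma T_eq_0_iff: "T (p x) u = 0 \<longleftrightarrow> u = 0"
  using inj_T[of x] linear_T[of x] linear_injective_0 by (metis T_simps(5))

lemma vector_field_JM:
  assumes "vector_field M X"
  shows "vector_field M (\<lambda>q. JM q (X q))" "C (\<lambda>q. JM q (X q)) x = J (C X x)"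
proof -
  have *: "JM (p x) (X (p x)) = T (p x) (J (C X x))" for x
    by (subst vector_field_T_C[OF assms]) simp
  show "vector_field M (\<lambda>q. JM q (X q))"
    by (rule vector_fieldI[OF smooth_on_linear_compose[OF open_UNIV linear_J smooth_on_C[OF assms]] *])
  show "C (\<lambda>q. JM q (X q)) x = J (C X x)"
    by (simp add: C_def *)
qed

lemma \<omega>M_vector_fields:
  assumes "vector_field M X" "vector_field M Y"
  shows "\<omega>M (p x) (X (p x)) (Y (p x)) = J (C X x) \<bullet> C Y x"
  by (subst vector_field_T_C[OF assms(1)], subst vector_field_T_C[OF assms(2)]) simp

lemma almost_complex_structure_JM: "almost_complex_structure M JM"
  unfolding almost_complex_structure_def points_M
  using vector_field_JM(1)
  by (auto simp: tangent_space_M J_simps T_simps[symmetric])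

lemma positive_compatible_JM: "positive_compatible M \<omega>M JM"
  unfolding positive_compatible_def points_M
  by (auto simp: tangent_space_M T_eq_0_iff J_inner inner_commute)

lemma D_J: "vector_field M X \<Longrightarrow> D (\<lambda>y. J (C X y)) x u = J (D (C X) x u)"
  using D_unique[OF bounded_linear.has_derivative[OF _ D_works[OF C_differentiable]], of J X x]
    linear_J linear_conv_bounded_linear by metis

lemma smooth_\<omega>M:
  assumes X: "vector_field M X" and Y: "vector_field M Y"
  shows "smooth_fun_on M (points M) (\<lambda>q. \<omega>M q (X q) (Y q))"
proof -
  have "p -` points M = UNIV" by (auto simp: points_M)
  then show ?thesis
    unfolding smooth_fun_on_M \<omega>M_vector_fields[OF assms]
    by (simp add: smooth_on_inner smooth_on_linear_compose linear_J smooth_on_C assms)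
qed

lemma derivative_\<omega>M:
  assumes X: "vector_field M X" and Y: "vector_field M Y" and Z: "vector_field M Z"
  shows "X (p x) (\<lambda>q. \<omega>M q (Y q) (Z q)) =
    J (D (C Y) x (C X x)) \<bullet> C Z x + J (C Y x) \<bullet> D (C Z) x (C X x)"
proof -
  have "smooth_near M (p x) (\<lambda>q. \<omega>M q (Y q) (Z q))"
    unfolding smooth_near_def using smooth_\<omega>M[OF Y Z] by (intro exI[of _ "points M"]) (simp add: points_M)
  then have "X (p x) (\<lambda>q. \<omega>M q (Y q) (Z q)) = D (\<lambda>y. J (C Y y) \<bullet> C Z y) x (C X x)"
    by (simp add: vector_field_apply[OF X] \<omega>M_vector_fields[OF Y Z])
  also have "\<dots> = J (D (C Y) x (C X x)) \<bullet> C Z x + J (C Y x) \<bullet> D (C Z) x (C X x)"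
  proof -
    have "((\<lambda>y. J (C Y (x \<odot> y))) has_derivative (\<lambda>u. J (D (C Y) x u))) (at 0)"
      by (rule bounded_linear.has_derivative[OF _ D_works[OF C_differentiable[OF Y]]])
         (simp add: linear_J linear_conv_bounded_linear[symmetric])
    from D_unique[of "\<lambda>y. J (C Y y) \<bullet> C Z y",
        OF has_derivative_inner[OF this D_works[OF C_differentiable[OF Z]]]]
    show ?thesis by simp
  qed
  finally show ?thesis .
qed

text \<open>In d omega the terms that differentiate coordinates cancel by the product rule and the
  skewness of \<open>J\<close>. What remains is minus the cyclic sum in
  \<open>closed\<close>.\<close>

lemma symplectic_manifold_M: "symplectic_manifold M \<omega>M"
  unfolding symplectic_manifold_def symplectic_form_def
proof (intro conjI smooth_manifold_M)
  show "\<forall>x\<in>points M. \<forall>u\<in>tangent_space M x. \<forall>v\<in>tangent_space M x. \<forall>w\<in>tangent_space M x. \<forall>a b.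
        \<omega>M x (a *\<^sub>R u + b *\<^sub>R v) w = a * \<omega>M x u w + b * \<omega>M x v w \<and> \<omega>M x u v = - \<omega>M x v u"
    unfolding points_M
    by (auto simp: tangent_space_M T_simps[symmetric] J_simps inner_add_left
        intro: J_antisym)
  show "\<forall>x\<in>points M. \<forall>u\<in>tangent_space M x. (\<forall>v\<in>tangent_space M x. \<omega>M x u v = 0) \<longrightarrow> u = 0"
    unfolding points_M
    using J_eq_0_iff inner_eq_zero_iff by (auto simp: tangent_space_M T_eq_0_iff)
  show "\<forall>X Y. vector_field M X \<and> vector_field M Y \<longrightarrow>
        smooth_fun_on M (points M) (\<lambda>x. \<omega>M x (X x) (Y x))"
    using smooth_\<omega>M by blast
  have "X (p x) (\<lambda>y. \<omega>M y (Y y) (Z y)) - Y (p x) (\<lambda>y. \<omega>M y (X y) (Z y)) + Z (p x) (\<lambda>y. \<omega>M y (X y) (Y y))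
          - \<omega>M (p x) (lie_bracket M X Y (p x)) (Z (p x)) + \<omega>M (p x) (lie_bracket M X Z (p x)) (Y (p x))
          - \<omega>M (p x) (lie_bracket M Y Z (p x)) (X (p x)) = 0"
    if XYZ: "vector_field M X" "vector_field M Y" "vector_field M Z" for X Y Z x
  proof -
    have lb: "\<omega>M (p x) (lie_bracket M X Y (p x)) (Z (p x)) =
        J (D (C Y) x (C X x) - D (C X) x (C Y x) + br (C X x) (C Y x)) \<bullet> C Z x"
      if "vector_field M X" "vector_field M Y" "vector_field M Z" for X Y Z
      by (simp add: lie_bracket_M that vector_field_T_C[of Z])
    show ?thesis
      unfolding lb[OF XYZ] lb[OF XYZ(1,3,2)] lb[OF XYZ(2,3,1)] derivative_\<omega>M[OF XYZ]
        derivative_\<omega>M[OF XYZ(2,1,3)] derivative_\<omega>M[OF XYZ(3,1,2)]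
      using closed[of "C X x" "C Y x" "C Z x"]
      by (simp add: J_simps inner_add_left inner_diff_left br_antisym[of "C Z x" "C X x"])
         (simp add: J_skew inner_commute)
  qed
  then show "closed_2form M \<omega>M"
    unfolding closed_2form_def points_M by blast
qed

text \<open>\<open>J\<close> is constant in the left-invariant frame and so commutes with
  \<open>D\<close>; all derivatives of coordinates cancel, and the algebraic expression
  \<open>N0\<close> is left.\<close>

lemma nijenhuis_M:
  assumes X: "vector_field M X" and Y: "vector_field M Y"
  shows "nijenhuis M JM X Y (p x) = T (p x) (N0 (C X x) (C Y x))"
proof -
  note JX = vector_field_JM(1)[OF X] and JY = vector_field_JM(1)[OF Y]
  have CJ: "C (\<lambda>q. JM q (X q)) = (\<lambda>x. J (C X x))" if "vector_field M X" for X
    using vector_field_JM(2)[OF that] by blast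
  show ?thesis
    unfolding nijenhuis_def lie_bracket_M[OF JX JY] lie_bracket_M[OF JX Y] lie_bracket_M[OF X JY]
      lie_bracket_M[OF X Y] CJ[OF X] CJ[OF Y] JM_T
    by (simp add: D_J X Y T_simps[symmetric] J_simps N0_def)
qed

lemma Im_N_M: "Im_N M JM (p x) = T (p x) ` NN"
proof -
  have "{nijenhuis M JM X Y (p x) | X Y. vector_field M X \<and> vector_field M Y} =
      T (p x) ` {N0 u v | u v. True}"
  proof (intro equalityI subsetI)
    fix z assume "z \<in> T (p x) ` {N0 u v | u v. True}"
    then obtain u v where "z = T (p x) (N0 u v)" by blast
    then have "z = nijenhuis M JM (\<lambda>q. T q u) (\<lambda>q. T q v) (p x)"
      by (simp add: nijenhuis_M vector_field_const)
    then show "z \<in> {nijenhuis M JM X Y (p x) | X Y. vector_field M X \<and> vector_field M Y}"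
      using vector_field_const(1) by blast
  qed (use nijenhuis_M in blast)
  then show ?thesis
    by (simp add: Im_N_def NN_def linear_span_image[OF linear_T])
qed

lemma J_N0: "J (N0 u v) = - N0 u (J v)"
  by (simp add: N0_def J_simps br_minus_right)

lemma subspace_NN: "subspace NN"
  by (simp add: NN_def)

lemma J_NN: "w \<in> NN \<Longrightarrow> J w \<in> NN"
  unfolding NN_def
proof (induction rule: span_induct_alt)
  case base
  then show ?case by (simp add: J_simps span_zero)
next
  case (step c z y)
  then obtain u v where "z = N0 u v" by blast
  then have "J z \<in> span {N0 u v |u v. True}"
    by (auto simp: J_N0 intro: span_neg span_base)
  then show ?case
    using step by (simp add: J_simps span_add span_scale)
qed

text \<open>Since \<open>NN\<close> is stable under \<open>J\<close>, its symplectic and its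
  Euclidean complement are the same.\<close>

lemma orthogonal_Im_N:
  "symplectic_orthogonal M \<omega>M (Im_N M JM) (p x) = T (p x) ` {u. \<forall>w\<in>NN. u \<bullet> w = 0}"
proof -
  have "(\<forall>w\<in>NN. J u \<bullet> w = 0) \<longleftrightarrow> (\<forall>w\<in>NN. u \<bullet> w = 0)" for u
  proof
    assume *: "\<forall>w\<in>NN. J u \<bullet> w = 0"
    show "\<forall>w\<in>NN. u \<bullet> w = 0"
      using * J_NN J_inner by metis
  next
    assume *: "\<forall>w\<in>NN. u \<bullet> w = 0"
    then show "\<forall>w\<in>NN. J u \<bullet> w = 0"
      using J_NN by (simp add: J_skew)
  qed
  moreover have "symplectic_orthogonal M \<omega>M (Im_N M JM) (p x) = T (p x) ` {u. \<forall>w\<in>NN. J u \<bullet> w = 0}"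
    by (auto simp: symplectic_orthogonal_def tangent_space_M Im_N_M)
  ultimately show ?thesis by simp
qed

lemma constant_rank_Im_N: "constant_rank M (Im_N M JM) (dim NN)"
  by (auto simp: constant_rank_def points_M Im_N_M dim_T_image subspace_NN)

lemma involutive_Im_N: "involutive M (Im_N M JM) \<longleftrightarrow> (\<forall>u\<in>NN. \<forall>v\<in>NN. br u v \<in> NN)"
  by (rule involutive_T_iff[OF Im_N_M subspace_NN])

lemma involutive_orthogonal_Im_N:
  "involutive M (symplectic_orthogonal M \<omega>M (Im_N M JM)) \<longleftrightarrow>
    (\<forall>u v. (\<forall>w\<in>NN. u \<bullet> w = 0) \<and> (\<forall>w\<in>NN. v \<bullet> w = 0) \<longrightarrow> (\<forall>w\<in>NN. br u v \<bullet> w = 0))"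
proof -
  have "subspace {u. \<forall>w\<in>NN. u \<bullet> w = 0}"
    by (auto simp: subspace_def inner_add_left)
  from involutive_T_iff[OF orthogonal_Im_N this] show ?thesis by blast
qed

end

section \<open>A family of nilpotent groups\<close>

lemma smooth_on_vec_nth:
  fixes f :: "'a::real_normed_vector \<Rightarrow> real ^ 'm"
  shows "open S \<Longrightarrow> smooth_on S f \<Longrightarrow> smooth_on S (\<lambda>x. f x $ i)"
  by (rule smooth_on_linear_compose) (auto intro: linearI)

lemma smooth_on_vec_lambda:
  fixes f :: "'a::real_normed_vector \<Rightarrow> real ^ 'm"
  assumes "open S" "\<And>i. smooth_on S (\<lambda>x. f x $ i)"
  shows "smooth_on S f"
  by (rule smooth_on_componentwise) (use assms in \<open>auto simp: Basis_vec_def inner_axis\<close>)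

text \<open>The coordinates in \<open>E\<close> and those outside are exchanged by the involution \<open>\<tau>\<close>, and
  \<open>J\<close> maps the basis vector with index \<open>i \<in> E\<close> to the one with index \<open>\<tau> i\<close>. The nonzero
  brackets of the Lie algebra are \<open>[e (a j), e (\<tau> j)] = c j e j\<close> for \<open>j \<notin> E\<close> and
  \<open>[e (\<tau> z), e r] = 2 \<epsilon> e z\<close>. The factor \<open>2\<close> makes the group law integral.\<close>

locale model_group =
  fixes E :: "'m::finite set" and \<tau> a :: "'m \<Rightarrow> 'm" and c :: "'m \<Rightarrow> real" and \<epsilon> :: real and z r :: 'm
  assumes \<tau>_\<tau> [simp]: "\<tau> (\<tau> j) = j" and \<tau>_E [simp]: "\<tau> j \<in> E \<longleftrightarrow> j \<notin> E" and a_E [simp]: "a j \<in> E"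
    and c_E: "j \<in> E \<Longrightarrow> c j = 0" and c_int: "c j \<in> \<int>" and \<epsilon>_int: "\<epsilon> \<in> \<int>"
    and z_E: "z \<notin> E" and r_E: "r \<notin> E"
    and \<epsilon>: "\<epsilon> \<noteq> 0 \<Longrightarrow> a r = \<tau> z \<and> c r = 1 \<and> r \<noteq> z"
begin

text \<open>Left translation by \<open>x\<close> is the affine map taking \<open>y\<close> to x +
  exp(N) y, where N is the nilpotent matrix given by the bracket with the
  \<open>E\<close>-coordinates of \<open>x\<close>. The quadratic term is N^2/2, whose denominator
  cancels against the factor \<open>2\<close> of the second bracket.\<close>

definition mul :: "real ^ 'm \<Rightarrow> real ^ 'm \<Rightarrow> real ^ 'm" where
  "mul x y = (\<chi> j. x $ j + y $ j + c j * x $ a j * y $ \<tau> j +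
     (if j = z then \<epsilon> * (2 * x $ \<tau> z * y $ r + (x $ \<tau> z)\<^sup>2 * y $ \<tau> r) else 0))"

definition iv :: "real ^ 'm \<Rightarrow> real ^ 'm" where
  "iv x = (\<chi> j. - x $ j + c j * x $ a j * x $ \<tau> j +
     (if j = z then \<epsilon> * (2 * x $ \<tau> z * x $ r - (x $ \<tau> z)\<^sup>2 * x $ \<tau> r) else 0))"

definition L :: "(real ^ 'm) set" where
  "L = {x. \<forall>j. x $ j \<in> \<int>}"

definition J :: "real ^ 'm \<Rightarrow> real ^ 'm" where
  "J u = (\<chi> j. if j \<in> E then - u $ \<tau> j else u $ \<tau> j)"

section \<open>The group law and the lattice\<close>

lemma mul_E: "j \<in> E \<Longrightarrow> mul x y $ j = x $ j + y $ j"
  using z_E by (auto simp: mul_def c_E)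

lemma mul_not_E: "j \<notin> E \<Longrightarrow> j \<noteq> z \<Longrightarrow> mul x y $ j = x $ j + y $ j + c j * x $ a j * y $ \<tau> j"
  by (auto simp: mul_def)

lemma mul_z: "mul x y $ z = x $ z + y $ z + c z * x $ a z * y $ \<tau> z +
     \<epsilon> * (2 * x $ \<tau> z * y $ r + (x $ \<tau> z)\<^sup>2 * y $ \<tau> r)"
  by (auto simp: mul_def)

lemma iv_E: "j \<in> E \<Longrightarrow> iv x $ j = - x $ j"
  using z_E by (auto simp: iv_def c_E)

lemma iv_not_E: "j \<notin> E \<Longrightarrow> j \<noteq> z \<Longrightarrow> iv x $ j = - x $ j + c j * x $ a j * x $ \<tau> j"
  by (auto simp: iv_def)

lemma iv_z: "iv x $ z = - x $ z + c z * x $ a z * x $ \<tau> z +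
     \<epsilon> * (2 * x $ \<tau> z * x $ r - (x $ \<tau> z)\<^sup>2 * x $ \<tau> r)"
  by (auto simp: iv_def)

text \<open>The values of \<open>a r\<close> and \<open>c r\<close> are known only when
  \<open>\<epsilon>\<close> is nonzero. Multiplying by \<open>\<epsilon>\<close> yields an identity
  valid in both cases, so later computations need no case distinction.\<close>

lemma eps_mul_r: "\<epsilon> * mul x y $ r = \<epsilon> * (x $ r + y $ r + x $ \<tau> z * y $ \<tau> r)"
  using \<epsilon> r_E by (cases "\<epsilon> = 0") (auto simp: mul_not_E)

lemma eps_iv_r: "\<epsilon> * iv x $ r = \<epsilon> * (- x $ r + x $ \<tau> z * x $ \<tau> r)"
  using \<epsilon> r_E by (cases "\<epsilon> = 0") (auto simp: iv_not_E)

lemma coordinate_cases: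
  obtains "j \<in> E" | "j \<notin> E" "j \<noteq> z" | "j = z"
  by blast

lemma mul_assoc: "mul (mul x y) w = mul x (mul y w)"
proof (rule vec_eq_iff[THEN iffD2], intro allI)
  fix j
  show "mul (mul x y) w $ j = mul x (mul y w) $ j"
  proof (cases rule: coordinate_cases[of j])
    case 3
    have *: "\<epsilon> * (2 * t * mul y w $ r) = 2 * t * (\<epsilon> * (y $ r + w $ r + y $ \<tau> z * w $ \<tau> r))" for t
      by (subst eps_mul_r[symmetric]) (simp add: algebra_simps)
    show ?thesis
      using z_E r_E
      by (simp only: 3 mul_z distrib_left[of \<epsilon>] *)
        (simp add: mul_E algebra_simps power2_eq_square)
  qed (simp_all add: mul_E mul_not_E algebra_simps)
qed

lemma mul_iv: "mul x (iv x) = 0" "mul (iv x) x = 0"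
proof -
  have *: "\<epsilon> * (2 * t * iv x $ r) = 2 * t * (\<epsilon> * (- x $ r + x $ \<tau> z * x $ \<tau> r))" for t
    by (subst eps_iv_r[symmetric]) (simp add: algebra_simps)
  have "mul x (iv x) $ j = 0 \<and> mul (iv x) x $ j = 0" for j
  proof (cases rule: coordinate_cases[of j])
    case 3
    show ?thesis
      using z_E r_E
      by (simp only: 3 mul_z distrib_left[of \<epsilon>] * iv_z)
        (simp add: iv_E algebra_simps power2_eq_square)
  qed (simp_all add: mul_E mul_not_E iv_E iv_not_E algebra_simps)
  then show "mul x (iv x) = 0" "mul (iv x) x = 0" by (simp_all add: vec_eq_iff)
qed

lemma smooth_mul: "smooth_on UNIV (\<lambda>(x, y). mul x y)"
proof (rule smooth_on_vec_lambda)
  fix j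
  have coord: "smooth_on UNIV (\<lambda>p::(real ^ 'm) \<times> (real ^ 'm). fst p $ i)"
    "smooth_on UNIV (\<lambda>p::(real ^ 'm) \<times> (real ^ 'm). snd p $ i)" for i
    by (intro smooth_on_vec_nth open_UNIV smooth_on_bounded_linear bounded_linear_fst bounded_linear_snd)+
  have "smooth_on UNIV (\<lambda>p. fst p $ j + snd p $ j + c j * fst p $ a j * snd p $ \<tau> j +
     (if j = z then \<epsilon> else 0) * (2 * fst p $ \<tau> z * snd p $ r + (fst p $ \<tau> z * fst p $ \<tau> z) * snd p $ \<tau> r))"
    by (intro smooth_on_add smooth_on_mult smooth_on_const coord open_UNIV)
  moreover have "(\<lambda>p. (case p of (x, y) \<Rightarrow> mul x y) $ j) =
    (\<lambda>p. fst p $ j + snd p $ j + c j * fst p $ a j * snd p $ \<tau> j +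
     (if j = z then \<epsilon> else 0) * (2 * fst p $ \<tau> z * snd p $ r + (fst p $ \<tau> z * fst p $ \<tau> z) * snd p $ \<tau> r))"
    by (auto simp: mul_def power2_eq_square)
  ultimately show "smooth_on UNIV (\<lambda>p. (case p of (x, y) \<Rightarrow> mul x y) $ j)"
    by (simp only:)
qed simp

lemma smooth_iv: "smooth_on UNIV iv"
proof (rule smooth_on_vec_lambda)
  fix j
  have coord: "smooth_on UNIV (\<lambda>x::real ^ 'm. x $ i)" for i
    by (intro smooth_on_vec_nth open_UNIV smooth_on_bounded_linear bounded_linear_ident)
  have "smooth_on UNIV (\<lambda>x. - x $ j + c j * x $ a j * x $ \<tau> j +
     (if j = z then \<epsilon> else 0) * (2 * x $ \<tau> z * x $ r - (x $ \<tau> z * x $ \<tau> z) * x $ \<tau> r))"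
    by (intro smooth_on_add smooth_on_diff smooth_on_minus smooth_on_mult smooth_on_const coord open_UNIV)
  moreover have "(\<lambda>x. iv x $ j) = (\<lambda>x. - x $ j + c j * x $ a j * x $ \<tau> j +
     (if j = z then \<epsilon> else 0) * (2 * x $ \<tau> z * x $ r - (x $ \<tau> z * x $ \<tau> z) * x $ \<tau> r))"
    by (auto simp: iv_def power2_eq_square)
  ultimately show "smooth_on UNIV (\<lambda>x. iv x $ j)"
    by (simp only:)
qed simp

lemma L_mul: "x \<in> L \<Longrightarrow> y \<in> L \<Longrightarrow> mul x y \<in> L"
  by (auto simp: L_def mul_def power2_eq_square intro!: Ints_add Ints_mult c_int \<epsilon>_int)

lemma L_iv: "x \<in> L \<Longrightarrow> iv x \<in> L"
  by (auto simp: L_def iv_def power2_eq_square intro!: Ints_add Ints_diff Ints_minus Ints_mult c_int \<epsilon>_int)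

lemma closed_L: "closed L"
  unfolding L_def
  by (intro closed_Collect_all closed_vimage[of "\<int>" "\<lambda>x. x $ j" for j, unfolded vimage_def]
      closed_Ints continuous_intros)

lemma L_ball: "L \<inter> ball 0 1 = {0}"
proof -
  have "x $ j = 0" if "x \<in> L" "norm x < 1" for x j
  proof -
    have "\<bar>x $ j\<bar> < 1"
      using component_le_norm_cart[of x j] that(2) by linarith
    then show ?thesis
      using that(1) Ints_nonzero_abs_less1 by (auto simp: L_def)
  qed
  then show ?thesis by (auto simp: vec_eq_iff) (simp add: L_def)
qed

text \<open>The \<open>E\<close>-coordinates add, so integer parts reduce them independently. Once
  they are chosen, any other coordinate of the product is \<open>h $ j\<close> plus the number
  \<open>f j\<close>, which involves only the \<open>E\<close>-coordinates of \<open>h\<close>, and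
  an integral \<open>h $ j\<close> brings it into the unit interval.\<close>

lemma cocompact_L: "\<exists>h\<in>L. mul h x \<in> cbox 0 1"
proof -
  define h0 :: "real ^ 'm" where "h0 = (\<chi> j. - of_int \<lfloor>x $ j\<rfloor>)"
  define f where "f = (\<lambda>j. x $ j + c j * h0 $ a j * x $ \<tau> j +
     (if j = z then \<epsilon> * (2 * h0 $ \<tau> z * x $ r + (h0 $ \<tau> z)\<^sup>2 * x $ \<tau> r) else 0))"
  define h :: "real ^ 'm" where "h = (\<chi> j. if j \<in> E then h0 $ j else - of_int \<lfloor>f j\<rfloor>)"
  have "h \<in> L" by (auto simp: L_def h_def h0_def)
  have hE: "h $ j = h0 $ j" if "j \<in> E" for j using that by (simp add: h_def)
  have fr: "0 \<le> - of_int \<lfloor>t\<rfloor> + t \<and> - of_int \<lfloor>t\<rfloor> + t \<le> 1" for t :: real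
    by linarith
  have "0 \<le> mul h x $ j \<and> mul h x $ j \<le> 1" for j
  proof (cases "j \<in> E")
    case True
    then show ?thesis using fr[of "x $ j"] by (simp add: mul_E hE h0_def)
  next
    case False
    have "mul h x $ j = h $ j + f j"
      using z_E by (simp add: mul_def hE f_def)
    then show ?thesis
      using fr[of "f j"] False by (simp add: h_def)
  qed
  then show ?thesis using \<open>h \<in> L\<close> by (auto simp: mem_box_cart)
qed

sublocale lattice_quotient mul iv L
proof
  show "mul 0 x = x" "mul x 0 = x" for x by (simp_all add: mul_def vec_eq_iff)
  show "\<exists>e>0. L \<inter> ball 0 e = {0}" using L_ball zero_less_one by blast
  show "\<exists>K. compact K \<and> (\<forall>x. \<exists>h\<in>L. mul h x \<in> K)" using cocompact_L compact_cbox by blast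
qed (use mul_assoc mul_iv smooth_mul smooth_iv L_mul L_iv closed_L in \<open>auto simp: L_def\<close>)

section \<open>The Lie algebra and its almost Kaehler structure\<close>

lemma A_apply: "A x v = mul x v - x"
proof -
  have "linear (\<lambda>v. mul x v - x)"
    by (rule linearI) (auto simp: mul_def vec_eq_iff algebra_simps)
  from has_derivative_add[OF has_derivative_const linear_imp_has_derivative[OF this], of x "at 0"]
  show ?thesis
    unfolding A_def by (simp add: frechet_derivative_eqI)
qed

text \<open>\<open>A y v\<close> is \<open>v\<close> plus a part linear in \<open>y\<close> plus a
  multiple of the square of \<open>y $ \<tau> z\<close>, whose derivative at \<open>0\<close>
  vanishes.\<close>

lemma derivative_A:
  "frechet_derivative (\<lambda>y. A y v) (at 0) u =
    (\<chi> j. c j * u $ a j * v $ \<tau> j + (if j = z then \<epsilon> * 2 * u $ \<tau> z * v $ r else 0))"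
proof -
  define F where "F = (\<lambda>u. \<chi> j. c j * u $ a j * v $ \<tau> j + (if j = z then \<epsilon> * 2 * u $ \<tau> z * v $ r else 0))"
  have "linear F"
    by (rule linearI) (auto simp: F_def vec_eq_iff algebra_simps)
  then have "((\<lambda>y. v + F y + (y $ \<tau> z)\<^sup>2 *\<^sub>R axis z (\<epsilon> * v $ \<tau> r)) has_derivative F) (at 0)"
    by (auto intro!: derivative_eq_intros linear_imp_has_derivative
        bounded_linear_imp_has_derivative[OF bounded_linear_vec_nth])
  moreover have "(\<lambda>y. v + F y + (y $ \<tau> z)\<^sup>2 *\<^sub>R axis z (\<epsilon> * v $ \<tau> r)) = (\<lambda>y. A y v)"
    by (auto simp: A_apply mul_def F_def vec_eq_iff axis_def algebra_simps)
  ultimately show ?thesis by (simp add: frechet_derivative_eqI F_def)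
qed

lemma br_eq: "br u v = (\<chi> j. c j * (u $ a j * v $ \<tau> j - v $ a j * u $ \<tau> j) +
    (if j = z then 2 * \<epsilon> * (u $ \<tau> z * v $ r - v $ \<tau> z * u $ r) else 0))"
  unfolding br_def derivative_A by (auto simp: vec_eq_iff algebra_simps)

lemma br_nth: "br u v $ j = c j * (u $ a j * v $ \<tau> j - v $ a j * u $ \<tau> j) +
    (if j = z then 2 * \<epsilon> * (u $ \<tau> z * v $ r - v $ \<tau> z * u $ r) else 0)"
  by (simp add: br_eq)

lemma sum_\<tau>: "(\<Sum>j\<in>UNIV. f (\<tau> j)) = (\<Sum>j\<in>UNIV. f j)"
  by (rule sum.reindex_bij_witness[of _ \<tau> \<tau>]) auto

lemma J_J': "J (J u) = - u"
  by (auto simp: J_def vec_eq_iff)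

lemma J_inner': "J u \<bullet> J v = u \<bullet> v"
proof -
  have "J u \<bullet> J v = (\<Sum>j\<in>UNIV. u $ \<tau> j * v $ \<tau> j)"
    by (auto simp: inner_vec_def J_def intro: sum.cong)
  then show ?thesis by (simp add: sum_\<tau>[of "\<lambda>j. u $ j * v $ j"] inner_vec_def)
qed

lemma J_br_inner: "J (br u v) \<bullet> w = - (\<Sum>j\<in>UNIV. br u v $ j * w $ \<tau> j)"
proof -
  have "J (br u v) \<bullet> w = (\<Sum>j\<in>UNIV. J (br u v) $ \<tau> j * w $ \<tau> j)"
    by (simp add: inner_vec_def sum_\<tau>[of "\<lambda>j. J (br u v) $ j * w $ j"])
  also have "\<dots> = (\<Sum>j\<in>UNIV. - (br u v $ j * w $ \<tau> j))"
    by (intro sum.cong refl) (use z_E in \<open>auto simp: J_def br_nth c_E algebra_simps\<close>)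
  finally show ?thesis by (simp add: sum_negf)
qed

sublocale almost_kaehler_quotient mul iv L J
proof (rule almost_kaehler_quotient.intro[OF lattice_quotient_axioms], rule almost_kaehler_quotient_axioms.intro)
  show "linear J"
    by (rule linearI) (auto simp: J_def vec_eq_iff algebra_simps)
  fix u v w
  have "br u v $ j * w $ \<tau> j + br v w $ j * u $ \<tau> j + br w u $ j * v $ \<tau> j = 0" for j
    by (auto simp: br_nth algebra_simps)
  moreover have "J (br u v) \<bullet> w + J (br v w) \<bullet> u + J (br w u) \<bullet> v =
     - (\<Sum>j\<in>UNIV. br u v $ j * w $ \<tau> j + br v w $ j * u $ \<tau> j + br w u $ j * v $ \<tau> j)"
    by (simp add: J_br_inner sum.distrib)
  ultimately show "J (br u v) \<bullet> w + J (br v w) \<bullet> u + J (br w u) \<bullet> v = 0" by simp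
qed (use J_J' J_inner' in auto)

section \<open>Nilpotency\<close>

lemma commutator_eq:
  assumes "w = mul (mul (mul h g) (iv h)) (iv g)"
  shows "mul w (mul g h) = mul h g"
  by (simp add: assms mul_assoc)

lemma subgroupI':
  assumes "0 \<in> H" "\<And>x y. x \<in> H \<Longrightarrow> y \<in> H \<Longrightarrow> mul x y \<in> H" "\<And>x. x \<in> H \<Longrightarrow> iv x \<in> H"
  shows "subgroup H G"
  by (rule group.subgroupI[OF group_G]) (use assms in auto)

text \<open>The commutator \<open>w\<close> of \<open>h\<close> and \<open>g\<close> enters only
  through \<open>mul w (mul g h) = mul h g\<close>, which contains no inverse and can be compared
  coordinate by coordinate.\<close>

lemma lower_central_Suc_subset:
  assumes "lower_central G i \<subseteq> H" "subgroup H' G"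
    "\<And>h g w. h \<in> H \<Longrightarrow> mul w (mul g h) = mul h g \<Longrightarrow> w \<in> H'"
  shows "lower_central G (Suc i) \<subseteq> H'"
  unfolding lower_central.simps
proof (rule group.generate_subgroup_incl[OF group_G _ assms(2)], clarify)
  fix h g assume "h \<in> lower_central G i"
  then have "mul (mul (mul h g) (iv h)) (iv g) \<in> H'"
    using assms(1) by (intro assms(3)[OF _ commutator_eq[OF refl]]) auto
  then show "h \<otimes>\<^bsub>G\<^esub> g \<otimes>\<^bsub>G\<^esub> inv\<^bsub>G\<^esub> h \<otimes>\<^bsub>G\<^esub> inv\<^bsub>G\<^esub> g \<in> H'" by simp
qed

text \<open>At most three steps: \<open>E\<close>-coordinates add, so commutators have none; when
  \<open>h\<close> has none, swapping it with \<open>g\<close> affects only coordinate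
  \<open>z\<close>; and elements of the \<open>z\<close>-axis are central.\<close>

lemma nilpotent_G: "nilpotent_group G"
proof -
  define H1 where "H1 = {x :: real ^ 'm. \<forall>j\<in>E. x $ j = 0}"
  define H2 where "H2 = {x :: real ^ 'm. \<forall>j. j \<noteq> z \<longrightarrow> x $ j = 0}"
  have "lower_central G (Suc 0) \<subseteq> H1"
  proof (rule lower_central_Suc_subset[of 0 UNIV])
    show "subgroup H1 G" by (rule subgroupI') (auto simp: H1_def mul_E iv_E)
    fix h g w assume *: "mul w (mul g h) = mul h g"
    have "w $ j = 0" if "j \<in> E" for j
      using arg_cong[OF *, of "\<lambda>x. x $ j"] that by (simp add: mul_E)
    then show "w \<in> H1" by (simp add: H1_def)
  qed simp
  then have "lower_central G (Suc (Suc 0)) \<subseteq> H2"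
  proof (rule lower_central_Suc_subset)
    have zE: "j \<noteq> z" if "j \<in> E" for j using that z_E by auto
    show "subgroup H2 G" by (rule subgroupI') (auto simp: H2_def mul_def iv_def zE)
    fix h g w assume h: "h \<in> H1" and *: "mul w (mul g h) = mul h g"
    have wE: "w $ j = 0" if "j \<in> E" for j
      using arg_cong[OF *, of "\<lambda>x. x $ j"] that by (simp add: mul_E)
    have "w $ j = 0" if "j \<notin> E" "j \<noteq> z" for j
      using arg_cong[OF *, of "\<lambda>x. x $ j"] that h by (simp add: mul_not_E wE H1_def)
    then show "w \<in> H2" using wE unfolding H2_def by blast
  qed
  then have "lower_central G (Suc (Suc (Suc 0))) \<subseteq> {0}"
  proof (rule lower_central_Suc_subset)
    show "subgroup {0} G" by (rule subgroupI') (auto simp: mul_def iv_def vec_eq_iff)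
    fix h g w assume h: "h \<in> H2" and *: "mul w (mul g h) = mul h g"
    have zE: "j \<noteq> z" if "j \<in> E" for j using that z_E by auto
    have h0: "h $ j = 0" if "j \<in> E" for j using h zE[OF that] by (simp add: H2_def)
    have wE: "w $ j = 0" if "j \<in> E" for j
      using arg_cong[OF *, of "\<lambda>x. x $ j"] that by (simp add: mul_E)
    have hr: "\<epsilon> * h $ r = 0" using \<epsilon> h by (auto simp: H2_def)
    have "w $ j = 0" if "j \<notin> E" "j \<noteq> z" for j
      using arg_cong[OF *, of "\<lambda>x. x $ j"] that h by (simp add: mul_not_E wE h0)
    moreover have "w $ z = 0"
      using arg_cong[OF *, of "\<lambda>x. x $ z"] hr z_E r_E by (auto simp: mul_z wE h0)
    ultimately show "w \<in> {0}" using wE by (auto simp: vec_eq_iff)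
  qed
  moreover have "0 \<in> lower_central G (Suc (Suc (Suc 0)))"
    using generate.one[of G] by simp
  ultimately have "lower_central G (Suc (Suc (Suc 0))) = {\<one>\<^bsub>G\<^esub>}" by auto
  then show ?thesis unfolding nilpotent_group_def using group_G by blast
qed

section \<open>The image of the Nijenhuis tensor\<close>

definition supp :: "'m set" where
  "supp = {j. c j \<noteq> 0 \<or> c (\<tau> j) \<noteq> 0}"

text \<open>The shear caused by the second bracket. With \<tau> z, z, \<tau> r, r as the indices of
  e_0, f_0, e_1, f_1, it sends f_1 to f_1 - 2 e_0 and e_1 to e_1 + 2 f_0 when
  \<open>\<epsilon> = 1\<close>, and it is the identity when \<open>\<epsilon> = 0\<close>.\<close>

definition \<phi> :: "real ^ 'm \<Rightarrow> real ^ 'm" where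
  "\<phi> w = w + (\<epsilon> * (- 2 * w $ r)) *\<^sub>R axis (\<tau> z) 1 + (\<epsilon> * (2 * w $ \<tau> r)) *\<^sub>R axis z 1"

definition W0 :: "(real ^ 'm) set" where
  "W0 = {w. \<forall>j. j \<notin> supp \<longrightarrow> w $ j = 0}"

lemma \<phi>_nth: "\<phi> w $ j = w $ j + \<epsilon> * ((if j = \<tau> z then - 2 * w $ r else 0) + (if j = z then 2 * w $ \<tau> r else 0))"
  by (auto simp: \<phi>_def axis_def algebra_simps)

lemma linear_\<phi>: "linear \<phi>"
  by (rule linearI) (auto simp: vec_eq_iff \<phi>_nth algebra_simps)

lemma subspace_W0: "subspace W0"
  by (auto simp: subspace_def W0_def)

lemma dim_W0: "dim W0 = card supp"
proof -
  have "W0 = {x. \<forall>i\<in>Basis. i \<notin> (\<lambda>j. axis j 1) ` supp \<longrightarrow> x \<bullet> i = 0}"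
    by (auto simp: W0_def Basis_vec_def inner_axis axis_eq_axis)
  also have "dim \<dots> = card ((\<lambda>j. axis j 1 :: real ^ 'm) ` supp)"
    by (rule dim_substandard) (auto simp: Basis_vec_def)
  also have "\<dots> = card supp"
    by (rule card_image) (auto simp: inj_on_def axis_eq_axis)
  finally show ?thesis .
qed

lemma \<tau>_eq_iff [simp]: "\<tau> i = \<tau> j \<longleftrightarrow> i = j"
  by (metis \<tau>_\<tau>)

lemma r_z_neq: "r \<noteq> \<tau> z" "\<tau> r \<noteq> z" "\<tau> r \<noteq> r" "\<tau> z \<noteq> z" "\<tau> z \<noteq> r"
  using z_E r_E \<tau>_E by metis+

lemma J_nth: "J u $ j = (if j \<in> E then - u $ \<tau> j else u $ \<tau> j)"
  by (simp add: J_def)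

end

text \<open>For \<open>i = j\<close>, \<open>indep\<close> says that the two arguments of a bracket
  are distinct; for other indices, that no two brackets use the same pair of arguments in opposite
  order.\<close>

locale model_group_generic = model_group E \<tau> a c \<epsilon> z r
  for E :: "'m::finite set" and \<tau> a :: "'m \<Rightarrow> 'm" and c :: "'m \<Rightarrow> real" and \<epsilon> :: real and z r :: 'm +
  assumes indep: "c i \<noteq> 0 \<Longrightarrow> c j \<noteq> 0 \<Longrightarrow> \<not> (a i = \<tau> j \<and> a j = \<tau> i)"
    and \<epsilon>_1: "\<epsilon> \<noteq> 0 \<Longrightarrow> \<epsilon> = 1 \<and> (\<forall>j. a j = \<tau> z) \<and> c z = 0"
begin

lemma inj_\<phi>: "inj \<phi>"
proof (rule injI)
  fix u v assume *: "\<phi> u = \<phi> v"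
  show "u = v"
  proof (cases "\<epsilon> = 0")
    case True
    then show ?thesis using *[unfolded \<phi>_def] by simp
  next
    case False
    have "u $ r = v $ r" "u $ \<tau> r = v $ \<tau> r"
      using arg_cong[OF *, of "\<lambda>x. x $ r"] arg_cong[OF *, of "\<lambda>x. x $ \<tau> r"] \<epsilon>[OF False] r_z_neq
      by (simp_all add: \<phi>_nth)
    then show ?thesis using * by (simp add: \<phi>_def)
  qed
qed

lemma axis_nth_E: "k \<in> E \<Longrightarrow> i \<notin> E \<Longrightarrow> axis k 1 $ i = (0::real)"
  by (auto simp: axis_def)

lemma J_axis_nth_E: "k \<in> E \<Longrightarrow> i \<in> E \<Longrightarrow> J (axis k 1) $ i = 0"
  by (simp add: J_nth axis_nth_E)

text \<open>\<open>J\<close> moves both arguments out of the \<open>E\<close>-directions, which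
  kills the first two brackets in \<open>N0\<close>. The bracket of the first argument with
  \<open>J\<close> of the second survives only for \<open>j = r\<close>, where it is 2 f_0 if
  \<open>\<epsilon> = 1\<close>; its image under \<open>- J\<close> is the tilt 2 e_0.\<close>

lemma N0_generator:
  assumes "c j \<noteq> 0"
  shows "N0 (axis (a j) 1) (axis (\<tau> j) 1) = (- c j) *\<^sub>R \<phi> (axis j 1)"
proof -
  have jE: "j \<notin> E" using assms c_E by auto
  let ?u = "axis (a j) 1 :: real ^ 'm" and ?v = "axis (\<tau> j) 1 :: real ^ 'm"
  have vz: "\<epsilon> * ?v $ \<tau> z = 0"
  proof (cases "\<epsilon> = 0")
    case False
    then have "\<tau> j \<noteq> \<tau> z" using \<epsilon>_1 assms by (metis \<tau>_\<tau>)
    then show ?thesis by (simp add: axis_def)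
  qed simp
  have uz: "\<epsilon> * ?u $ \<tau> z = \<epsilon>"
    using \<epsilon>_1 by (cases "\<epsilon> = 0") (auto simp: axis_def)
  have J0: "J ?u $ i = 0" "J ?v $ i = 0" if "i \<in> E" for i
    using J_axis_nth_E jE that by simp_all
  have Jz: "J ?u $ \<tau> z = 0" "J ?v $ \<tau> z = 0" using J0 z_E by simp_all
  have E0: "c i * J ?u $ \<tau> i = 0" "c i * J ?v $ \<tau> i = 0" for i
    using J0[of "\<tau> i"] c_E[of i] by auto
  have r0: "?u $ r = 0" "?v $ r = 0" using jE r_E by (simp_all add: axis_nth_E)
  have Jv_r: "J ?v $ r = (if j = r then 1 else 0)"
    using r_E by (auto simp: J_nth axis_def)
  \<comment> \<open>The products are regrouped so that the factors already known to vanish appear as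
    subterms.\<close>
  have br: "br x y $ i = x $ a i * (c i * y $ \<tau> i) - y $ a i * (c i * x $ \<tau> i) +
      (if i = z then 2 * ((\<epsilon> * x $ \<tau> z) * y $ r - (\<epsilon> * y $ \<tau> z) * x $ r) else 0)" for x y i
    unfolding br_nth by (simp add: algebra_simps)
  have b1: "br (J ?u) (J ?v) = 0"
    unfolding vec_eq_iff br E0 Jz by simp
  have b2: "br (J ?u) ?v = 0"
    unfolding vec_eq_iff br E0 Jz vz J0(1)[OF a_E] by simp
  have b3: "br ?u (J ?v) = (if j = r then 2 * \<epsilon> else 0) *\<^sub>R axis z 1"
    unfolding vec_eq_iff br E0 Jz uz J0(2)[OF a_E] Jv_r by (simp add: axis_def)
  have b4: "br ?u ?v = c j *\<^sub>R axis j 1"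
  proof -
    have "c i * (?u $ a i * ?v $ \<tau> i - ?v $ a i * ?u $ \<tau> i) = c j * axis j 1 $ i" for i
    proof (cases "i = j")
      case True
      have "\<not> (a j = \<tau> j \<and> a j = \<tau> j)" using indep[OF assms assms] .
      then show ?thesis using True by (simp add: axis_def)
    next
      case False
      then have "\<tau> i \<noteq> \<tau> j" by (metis \<tau>_\<tau>)
      then show ?thesis using indep[of i j] assms False by (cases "c i = 0") (auto simp: axis_def)
    qed
    then show ?thesis by (auto simp: vec_eq_iff br_nth r0)
  qed
  have "J (axis z 1) = - axis (\<tau> z) 1"
    using z_E by (auto simp: vec_eq_iff J_nth axis_def)
  then have "N0 ?u ?v = (if j = r then 2 * \<epsilon> else 0) *\<^sub>R axis (\<tau> z) 1 - c j *\<^sub>R axis j 1"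
    by (simp add: N0_def b1 b2 b3 b4 J_simps)
  also have "\<dots> = (- c j) *\<^sub>R \<phi> (axis j 1)"
    unfolding \<phi>_def using \<epsilon> jE r_E r_z_neq(3)
    by (cases "\<epsilon> = 0"; cases "j = r") (auto simp: axis_nth_E axis_def vec_eq_iff)
  finally show ?thesis .
qed

lemma J_\<phi>_axis:
  assumes "j \<notin> E"
  shows "J (\<phi> (axis j 1)) = - \<phi> (axis (\<tau> j) 1)"
proof -
  have "J (axis i 1) = - axis (\<tau> i) 1" if "i \<notin> E" for i
    using that by (auto simp: vec_eq_iff J_nth axis_def)
  moreover have "J (axis i 1) = axis (\<tau> i) 1" if "i \<in> E" for i
    using that by (auto simp: vec_eq_iff J_nth axis_def)
  moreover have "axis j 1 $ \<tau> r = (0::real)" "axis (\<tau> j) 1 $ r = (0::real)"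
    using assms r_E by (auto simp: axis_def)
  moreover have "axis (\<tau> j) 1 $ \<tau> r = (axis j 1 $ r :: real)"
    by (auto simp: axis_def)
  ultimately show ?thesis
    using assms z_E by (simp add: \<phi>_def J_simps)
qed

text \<open>Only the indices of \<open>supp\<close> with nonzero \<open>c\<close> come directly from
  \<open>N0_generator\<close>; the others are reached by applying \<open>J\<close>, which permutes
  the sheared axes up to sign.\<close>

lemma \<phi>_axis_in_NN:
  assumes "j \<in> supp"
  shows "\<phi> (axis j 1) \<in> NN"
proof -
  have *: "\<phi> (axis j 1) \<in> NN" if "c j \<noteq> 0" for j
  proof -
    have "N0 (axis (a j) 1) (axis (\<tau> j) 1) \<in> NN"
      unfolding NN_def by (rule span_base) blast
    then have "(- inverse (c j)) *\<^sub>R ((- c j) *\<^sub>R \<phi> (axis j 1)) \<in> NN"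
      unfolding N0_generator[OF that] by (rule subspace_scale[OF subspace_NN])
    then show ?thesis using that by simp
  qed
  show ?thesis
  proof (cases "c j = 0")
    case True
    then have "c (\<tau> j) \<noteq> 0" using assms by (simp add: supp_def)
    then have "\<phi> (axis (\<tau> j) 1) \<in> NN" "\<tau> j \<notin> E" using * c_E by blast+
    then show ?thesis
      using J_NN[of "\<phi> (axis (\<tau> j) 1)"] J_\<phi>_axis[of "\<tau> j"] subspace_neg[OF subspace_NN] by force
  qed (rule *)
qed

lemma br_E: "j \<in> E \<Longrightarrow> br u v $ j = 0"
  using z_E by (auto simp: br_nth c_E)

text \<open>A preimage is obtained by cutting \<open>N0 u v\<close> down to \<open>supp\<close>. As
  \<open>\<phi>\<close> alters only the coordinates \<open>z\<close> and \<open>\<tau> z\<close>,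
  everything reduces to two relations: coordinate \<open>z\<close> is twice coordinate
  \<open>\<tau> r\<close>, and coordinate \<open>\<tau> z\<close> is minus twice coordinate
  \<open>r\<close>.\<close>

lemma N0_in_\<phi>_W0: "N0 u v \<in> \<phi> ` W0"
proof -
  define w :: "real ^ 'm" where "w = (\<chi> j. if j \<in> supp then N0 u v $ j else 0)"
  \<comment> \<open>Brackets have no \<open>E\<close>-coordinates, so each coordinate of
    \<open>N0\<close> sees only two of its four brackets.\<close>
  have n_not_E: "N0 u v $ j = br (J u) (J v) $ j - br u v $ j" if "j \<notin> E" for j
    using that by (simp add: N0_def J_nth br_E)
  have n_E: "N0 u v $ j = br (J u) v $ \<tau> j + br u (J v) $ \<tau> j" if "j \<in> E" for j
    using that by (simp add: N0_def J_nth br_E)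
  have "N0 u v $ j = \<phi> w $ j" for j
  proof (cases "\<epsilon> = 0")
    case True
    have "N0 u v $ j = 0" if "j \<notin> supp"
    proof (cases "j \<in> E")
      case jE: True
      show ?thesis
        unfolding n_E[OF jE] br_nth using that True by (simp add: supp_def)
    next
      case jE: False
      show ?thesis
        unfolding n_not_E[OF jE] br_nth using that True by (simp add: supp_def)
    qed
    then show ?thesis unfolding \<phi>_nth using True by (simp add: w_def)
  next
    case False
    then have e: "\<epsilon> = 1" "a i = \<tau> z" "c z = 0" "c r = 1" "r \<noteq> z" for i
      using \<epsilon>_1 \<epsilon> by blast+
    have s: "z \<notin> supp" "\<tau> z \<notin> supp" "r \<in> supp" "\<tau> r \<in> supp"
      using e z_E by (auto simp: supp_def c_E)
    have rE: "\<tau> r \<in> E" and zE: "\<tau> z \<in> E" using z_E r_E by simp_all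
    consider "j = z" | "j = \<tau> z" | "j \<noteq> z" "j \<noteq> \<tau> z" by blast
    then show ?thesis
    proof cases
      case 1
      have "\<phi> w $ z = 2 * N0 u v $ \<tau> r"
        unfolding \<phi>_nth w_def using s e(1) r_z_neq by simp
      moreover have "N0 u v $ z = 2 * N0 u v $ \<tau> r"
        unfolding n_not_E[OF z_E] n_E[OF rE] br_nth J_nth
        using e z_E r_E r_z_neq by (simp add: algebra_simps)
      ultimately show ?thesis using 1 by simp
    next
      case 2
      have "\<phi> w $ \<tau> z = - 2 * N0 u v $ r"
        unfolding \<phi>_nth w_def using s e(1) r_z_neq by simp
      moreover have "N0 u v $ \<tau> z = - 2 * N0 u v $ r"
        unfolding n_not_E[OF r_E] n_E[OF zE] br_nth J_nth
        using e z_E r_E r_z_neq by (simp add: algebra_simps)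
      ultimately show ?thesis using 2 by simp
    next
      case 3
      then have "\<tau> j \<noteq> z" by auto
      then have "N0 u v $ j = 0" if "j \<notin> supp"
        using that 3 by (cases "j \<in> E") (simp_all add: n_E n_not_E br_nth supp_def)
      then show ?thesis using 3 by (simp add: \<phi>_nth w_def)
    qed
  qed
  then have "N0 u v = \<phi> w" by (simp add: vec_eq_iff)
  then show ?thesis by (auto simp: W0_def w_def)
qed

lemma NN_eq: "NN = \<phi> ` W0"
proof
  show "NN \<subseteq> \<phi> ` W0"
    unfolding NN_def
    by (rule span_minimal) (use N0_in_\<phi>_W0 linear_subspace_image[OF linear_\<phi> subspace_W0] in auto)
  show "\<phi> ` W0 \<subseteq> NN"
  proof clarify
    fix w assume w: "w \<in> W0"
    have "\<phi> w = \<phi> (\<Sum>j\<in>UNIV. w $ j *\<^sub>R axis j 1)"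
      using basis_expansion[of w] by (simp add: scalar_mult_eq_scaleR)
    also have "\<dots> = (\<Sum>j\<in>UNIV. w $ j *\<^sub>R \<phi> (axis j 1))"
      by (simp add: linear_sum[OF linear_\<phi>] linear_cmul[OF linear_\<phi>])
    also have "\<dots> \<in> NN"
    proof (rule subspace_sum[OF subspace_NN])
      show "w $ j *\<^sub>R \<phi> (axis j 1) \<in> NN" for j
        using w \<phi>_axis_in_NN subspace_scale[OF subspace_NN] subspace_0[OF subspace_NN]
        by (cases "j \<in> supp") (auto simp: W0_def)
    qed
    finally show "\<phi> w \<in> NN" .
  qed
qed

lemma dim_NN: "dim NN = card supp"
  unfolding NN_eq
  using dim_image_eq[OF linear_\<phi>, of W0] inj_\<phi> dim_W0 by (metis inj_on_subset subset_UNIV)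

section \<open>Involutivity of the two distributions\<close>

lemma involutive_if_\<epsilon>_0:
  assumes "\<epsilon> = 0"
  shows "involutive M (Im_N M JM)" "involutive M (symplectic_orthogonal M \<omega>M (Im_N M JM))"
proof -
  have "\<phi> w = w" for w unfolding \<phi>_def using assms by simp
  then have NN: "NN = W0" unfolding NN_eq by simp
  show "involutive M (Im_N M JM)"
  proof -
    have "br u v $ j = 0" if "j \<notin> supp" for u v j
      unfolding br_nth using that assms by (simp add: supp_def)
    then show ?thesis unfolding involutive_Im_N NN by (simp add: W0_def)
  qed
  have "br u v = 0" if uv: "\<forall>w\<in>NN. u \<bullet> w = 0" "\<forall>w\<in>NN. v \<bullet> w = 0" for u v
  proof -
    \<comment> \<open>Both products in coordinate \<open>j\<close> of a bracket contain a factor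
      with index \<open>\<tau> j\<close>, and orthogonality to this axis makes that factor
      zero.\<close>
    have "axis (\<tau> j) 1 \<in> NN" if "c j \<noteq> 0" for j
      using that by (auto simp: NN W0_def supp_def axis_def)
    then have "u $ \<tau> j = 0" "v $ \<tau> j = 0" if "c j \<noteq> 0" for j
      using that uv by (metis cart_eq_inner_axis)+
    then have "c j * (u $ a j * v $ \<tau> j - v $ a j * u $ \<tau> j) = 0" for j
      by (cases "c j = 0") auto
    then show ?thesis unfolding vec_eq_iff br_nth using assms by simp
  qed
  then show "involutive M (symplectic_orthogonal M \<omega>M (Im_N M JM))"
    unfolding involutive_orthogonal_Im_N by auto
qed

text \<open>On \<open>NN\<close> coordinate \<open>\<tau> z\<close> is minus twice coordinate
  \<open>r\<close>. A bracket has zero coordinate \<open>\<tau> z\<close>, so membership in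
  \<open>NN\<close> would force its coordinate \<open>r\<close> to vanish, but it is -2 for the
  chosen generators. In the complement the same coordinate is the inner product of a bracket with
  f_1 - 2 e_0.\<close>

lemma not_involutive_if_\<epsilon>_nonzero:
  assumes "\<epsilon> \<noteq> 0"
  shows "\<not> involutive M (Im_N M JM)" "\<not> involutive M (symplectic_orthogonal M \<omega>M (Im_N M JM))"
proof -
  have e: "\<epsilon> = 1" "a i = \<tau> z" "c z = 0" "c r = 1" "r \<noteq> z" for i
    using \<epsilon>_1 \<epsilon> assms by blast+
  have NN_z: "w $ \<tau> z = - 2 * w $ r" "w $ z = 2 * w $ \<tau> r" if w: "w \<in> NN" for w
  proof -
    obtain y where y: "w = \<phi> y" "y \<in> W0" using w unfolding NN_eq by blast
    then have "y $ z = 0" "y $ \<tau> z = 0" using e(3) z_E c_E by (simp_all add: W0_def supp_def)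
    then show "w $ \<tau> z = - 2 * w $ r" "w $ z = 2 * w $ \<tau> r"
      unfolding y(1) \<phi>_nth using e(1,5) r_z_neq by simp_all
  qed
  have s: "r \<in> supp" "\<tau> r \<in> supp" using e by (auto simp: supp_def)
  note neq = r_z_neq
  have br_r: "br (\<phi> (axis r 1)) (\<phi> (axis (\<tau> r) 1)) $ r = - 2"
    unfolding br_nth \<phi>_nth using e neq neq[symmetric] by (simp add: axis_def)
  have "br (\<phi> (axis r 1)) (\<phi> (axis (\<tau> r) 1)) \<notin> NN"
    using NN_z(1) br_E[of "\<tau> z"] br_r z_E by fastforce
  then show "\<not> involutive M (Im_N M JM)"
    unfolding involutive_Im_N using \<phi>_axis_in_NN s by blast
  let ?u = "axis (\<tau> z) 1 + 2 *\<^sub>R axis r 1 :: real ^ 'm"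
  let ?v = "axis z 1 - 2 *\<^sub>R axis (\<tau> r) 1 :: real ^ 'm"
  have "?u \<bullet> w = 0" "?v \<bullet> w = 0" if "w \<in> NN" for w
    using NN_z[OF that]
    by (simp_all add: inner_add_left inner_diff_left inner_axis' )
  moreover have "br ?u ?v \<bullet> \<phi> (axis r 1) \<noteq> 0"
  proof -
    have "axis r 1 $ r = (1::real)" "axis r 1 $ \<tau> r = (0::real)"
      using neq by (simp_all add: axis_def)
    then have "\<phi> (axis r 1) = axis r 1 - 2 *\<^sub>R axis (\<tau> z) 1"
      unfolding \<phi>_def using e(1) by simp
    then have "x \<bullet> \<phi> (axis r 1) = x $ r - 2 * x $ \<tau> z" for x
      by (simp add: inner_diff_right inner_axis)
    then have "br ?u ?v \<bullet> \<phi> (axis r 1) = br ?u ?v $ r"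
      using z_E by (simp add: br_E)
    also have "\<dots> = - 2"
      unfolding br_nth using e neq neq[symmetric] by (simp add: axis_def)
    finally show ?thesis by simp
  qed
  ultimately show "\<not> involutive M (symplectic_orthogonal M \<omega>M (Im_N M JM))"
    unfolding involutive_orthogonal_Im_N using \<phi>_axis_in_NN[OF s(1)] by blast
qed

end

text \<open>The bijection \<open>h\<close> labels e_i by \<open>(i, True)\<close> and f_i by
  \<open>(i, False)\<close>; \<open>s\<close> is the map a of the overview on these labels.\<close>

lemma model_exists:
  fixes h :: "'m::finite \<Rightarrow> nat \<times> bool"
  assumes h: "bij_betw h UNIV ({..<n} \<times> UNIV)"
    and s: "\<And>i. i < n \<Longrightarrow> s i < n" and K: "K \<subseteq> {..<n}" and "0 < n"
    and indep: "\<And>i j. i \<in> K \<Longrightarrow> j \<in> K \<Longrightarrow> \<not> (s i = j \<and> s j = i)"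
    and noninv: "noninv \<Longrightarrow> 1 \<in> K \<and> 0 \<notin> K \<and> (\<forall>i. s i = 0)"
  shows "\<exists>(M :: ((real ^ 'm) set, real ^ 'm) manifold) \<omega> J.
            compact_nilmanifold M \<and> symplectic_manifold M \<omega> \<and>
            almost_complex_structure M J \<and> positive_compatible M \<omega> J \<and>
            constant_rank M (Im_N M J) (2 * card K) \<and>
            (involutive M (Im_N M J) \<longleftrightarrow> \<not> noninv) \<and>
            (involutive M (symplectic_orthogonal M \<omega> (Im_N M J)) \<longleftrightarrow> \<not> noninv)"
proof -
  define g where "g = inv_into UNIV h"
  have hg: "h (g q) = q" if "fst q < n" for q
    unfolding g_def using h that by (intro f_inv_into_f) (auto simp: bij_betw_def mem_Times_iff)
  have gh: "g (h j) = j" for j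
    unfolding g_def using h by (intro inv_into_f_f) (auto simp: bij_betw_def)
  have fh: "fst (h j) < n" for j
    using bij_betw_apply[OF h UNIV_I, of j] by (simp add: mem_Times_iff)
  define E where "E = {j. snd (h j)}"
  define \<tau> where "\<tau> = (\<lambda>j. g (fst (h j), \<not> snd (h j)))"
  define a where "a = (\<lambda>j. g (s (fst (h j)), True))"
  define c :: "'m \<Rightarrow> real" where "c = (\<lambda>j. of_bool (\<not> snd (h j) \<and> fst (h j) \<in> K))"
  define \<epsilon> :: real where "\<epsilon> = of_bool noninv"
  define z where "z = g (0, False)"
  \<comment> \<open>In the non-involutive case \<open>1 \<in> K\<close> guarantees that the label
    exists. Otherwise \<open>\<epsilon> = 0\<close>, and \<open>z\<close> serves as an index outside
    \<open>E\<close>.\<close>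
  define r where "r = (if noninv then g (1, False) else z)"
  have h\<tau>: "h (\<tau> j) = (fst (h j), \<not> snd (h j))" for j by (simp add: \<tau>_def hg fh)
  have ha: "h (a j) = (s (fst (h j)), True)" for j by (simp add: a_def hg s fh)
  have hz: "h z = (0, False)" by (simp add: z_def hg \<open>0 < n\<close>)
  have hr: "h r = (if noninv then (1, False) else (0, False))"
    using noninv K hz by (auto simp: r_def intro!: hg)
  have eq_iff: "i = j \<longleftrightarrow> h i = h j" for i j using gh by metis
  interpret model_group_generic E \<tau> a c \<epsilon> z r
  proof
    show "\<tau> (\<tau> j) = j" for j by (simp add: eq_iff h\<tau>)
    show "c j \<in> \<int>" for j by (simp add: c_def)
    show "\<epsilon> \<in> \<int>" by (simp add: \<epsilon>_def)
    show "a r = \<tau> z \<and> c r = 1 \<and> r \<noteq> z" if "\<epsilon> \<noteq> 0"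
      using that noninv by (auto simp: \<epsilon>_def eq_iff h\<tau> ha hz hr c_def)
    show "\<not> (a i = \<tau> j \<and> a j = \<tau> i)" if "c i \<noteq> 0" "c j \<noteq> 0" for i j
      using that indep[of "fst (h i)" "fst (h j)"] by (auto simp: c_def eq_iff h\<tau> ha)
    show "\<epsilon> = 1 \<and> (\<forall>j. a j = \<tau> z) \<and> c z = 0" if "\<epsilon> \<noteq> 0"
      using that noninv by (auto simp: \<epsilon>_def eq_iff h\<tau> ha hz c_def)
  qed (auto simp: E_def c_def h\<tau> ha hz hr)
  have "supp = g ` (K \<times> UNIV)"
  proof -
    have "j \<in> g ` (K \<times> UNIV) \<longleftrightarrow> fst (h j) \<in> K" for j
    proof
      assume "j \<in> g ` (K \<times> UNIV)"
      then show "fst (h j) \<in> K" using K hg by force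
    next
      assume "fst (h j) \<in> K"
      then show "j \<in> g ` (K \<times> UNIV)"
        by (intro image_eqI[of _ _ "h j"]) (auto simp: gh mem_Times_iff)
    qed
    moreover have "supp = {j. fst (h j) \<in> K}"
      unfolding supp_def by (auto simp: c_def h\<tau>)
    ultimately show ?thesis by blast
  qed
  moreover have "inj_on g (K \<times> UNIV)"
    by (rule inj_on_inverseI[of _ h]) (use K hg in auto)
  ultimately have "card supp = 2 * card K"
    using K finite_subset[OF K] by (simp add: card_image card_cartesian_product)
  moreover have "(involutive M (Im_N M JM) \<longleftrightarrow> \<not> noninv) \<and>
      (involutive M (symplectic_orthogonal M \<omega>M (Im_N M JM)) \<longleftrightarrow> \<not> noninv)"
  proof (cases noninv)
    case True
    then have "\<epsilon> \<noteq> 0" by (simp add: \<epsilon>_def)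
    with True show ?thesis using not_involutive_if_\<epsilon>_nonzero by blast
  next
    case False
    then have "\<epsilon> = 0" by (simp add: \<epsilon>_def)
    with False show ?thesis using involutive_if_\<epsilon>_0 by blast
  qed
  ultimately show ?thesis
    using compact_nilmanifold_M[OF nilpotent_G] symplectic_manifold_M almost_complex_structure_JM
      positive_compatible_JM constant_rank_Im_N dim_NN by metis
qed

theorem proposition4p5:
  fixes n k :: nat
  assumes "2 \<le> n" and "k \<le> n" and "n = 2 \<Longrightarrow> k < n"
    and dim: "CARD('m::finite) = 2 * n"
  shows "(\<exists>(M :: ((real ^ 'm) set, real ^ 'm) manifold) \<omega> J.
            compact_nilmanifold M \<and> symplectic_manifold M \<omega> \<and>
            almost_complex_structure M J \<and> positive_compatible M \<omega> J \<and>
            constant_rank M (Im_N M J) (2 * k) \<and>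
            involutive M (Im_N M J) \<and>
            involutive M (symplectic_orthogonal M \<omega> (Im_N M J))) \<and>
         (0 < k \<and> k < n \<longrightarrow>
          (\<exists>(M :: ((real ^ 'm) set, real ^ 'm) manifold) \<omega> J.
            compact_nilmanifold M \<and> symplectic_manifold M \<omega> \<and>
            almost_complex_structure M J \<and> positive_compatible M \<omega> J \<and>
            constant_rank M (Im_N M J) (2 * k) \<and>
            \<not> involutive M (Im_N M J) \<and>
            \<not> involutive M (symplectic_orthogonal M \<omega> (Im_N M J))))"
proof -
  have "card (UNIV :: 'm set) = card ({..<n} \<times> (UNIV :: bool set))"
    by (simp add: dim card_cartesian_product)
  then obtain h :: "'m \<Rightarrow> nat \<times> bool" where h: "bij_betw h UNIV ({..<n} \<times> UNIV)"
    using finite_same_card_bij[of "UNIV :: 'm set" "{..<n} \<times> (UNIV :: bool set)"] by auto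
  \<comment> \<open>Two unit steps modulo \<open>n\<close> return to the start only if
    \<open>n = 2\<close>; both indices 0 and 1 would then be below \<open>k\<close>, against
    \<open>k < n\<close>.\<close>
  have indep: "\<not> ((i + 1) mod n = j \<and> (j + 1) mod n = i)" if "i \<in> {..<k}" "j \<in> {..<k}" for i j
  proof
    assume *: "(i + 1) mod n = j \<and> (j + 1) mod n = i"
    have "i < n" "j < n" using that \<open>k \<le> n\<close> by auto
    then have "i + 1 = n \<or> j = i + 1" "j + 1 = n \<or> i = j + 1"
      using * by (metis Suc_eq_plus1 Suc_lessI mod_less)+
    moreover have "i + 1 = n \<Longrightarrow> j = 0" "j + 1 = n \<Longrightarrow> i = 0" using * by auto
    ultimately show False using that assms(1-3) by auto
  qed
  have "\<exists>(M :: ((real ^ 'm) set, real ^ 'm) manifold) \<omega> J.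
            compact_nilmanifold M \<and> symplectic_manifold M \<omega> \<and>
            almost_complex_structure M J \<and> positive_compatible M \<omega> J \<and>
            constant_rank M (Im_N M J) (2 * card {..<k}) \<and>
            (involutive M (Im_N M J) \<longleftrightarrow> \<not> False) \<and>
            (involutive M (symplectic_orthogonal M \<omega> (Im_N M J)) \<longleftrightarrow> \<not> False)"
    by (rule model_exists[OF h, where s = "\<lambda>i. (i + 1) mod n"]) (use assms indep in auto)
  \<comment> \<open>Here \<open>K\<close> is \<open>{1..k}\<close>, which lies below
    \<open>n\<close> because \<open>k < n\<close>; it omits 0 and contains 1 because
    \<open>k\<close> is positive.\<close>
  moreover have "\<exists>(M :: ((real ^ 'm) set, real ^ 'm) manifold) \<omega> J.
            compact_nilmanifold M \<and> symplectic_manifold M \<omega> \<and>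
            almost_complex_structure M J \<and> positive_compatible M \<omega> J \<and>
            constant_rank M (Im_N M J) (2 * card {1..k}) \<and>
            (involutive M (Im_N M J) \<longleftrightarrow> \<not> True) \<and>
            (involutive M (symplectic_orthogonal M \<omega> (Im_N M J)) \<longleftrightarrow> \<not> True)"
    if "0 < k" "k < n"
    by (rule model_exists[OF h, where s = "\<lambda>i. 0"]) (use that in auto)
  ultimately show ?thesis by simp
qed

end
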